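(* Let $A$ be an invariant algebra on a compact Hausdorff group $G$ and let $\epsilon$ be the least idempotent of $\mathcal{M}_A$. The set $G_\epsilon=\{g\in G: g\epsilon=\epsilon g=\epsilon\}$ is a maximal set of antisymmetry for $A$. It is a normal subgroup of $G$, all other maximal sets of antisymmetry are the cosets $gG_\epsilon$, $g\in G$, and $A_{\mathbb{R}}$ (the algebra of all real valued functions in $A$) consists of all real valued continuous functions on $G$ which are constant on these cosets. Furthermore, the following assertions are equivalent: a) $A$ is antisymmetric; b) $\mathcal{M}_A$ is a semigroup with zero; c) the (normalized) Haar measure of $G$ is multiplicative on $A$.
   Context: $C(G)$ is the Banach algebra of continuous complex functions on $G$ with the sup-norm. An invariant algebra on $G$ is a closed subalgebra of $C(G)$ that contains the constants and is invariant under all left and right translations. $\mathcal{M}_A$ is the set of all nonzero multiplicative linear functionals on $A$ with the weak-* topology; it is a compact semigroup under convolution: $(\varphi\psi)(f)=\int_{G\times G}f(gh)\,d\mu(g)\,d\nu(h)$ for any finite regular Borel complex measures $\mu,\nu$ on $G$ extending $\varphi,\psi$ to $C(G)$ (independent of the choice). In products, $g\in G$ stands for the evaluation functional $f\mapsto f(g)$. Idempotents of $\mathcal{M}_A$ are ordered by $j\leq k\iff jk=kj=j$; a least idempotent $\epsilon$ always exists. An element $z$ of a semigroup $S$ is a zero if $zs=sz=z$ for all $s\in S$. $A$ is antisymmetric if each real valued function in $A$ is constant. A set $E\subseteq G$ is a set of antisymmetry for $A$ if every $f\in A$ which is real valued on $E$ is constant on $E$; maximality is with respect to inclusion. A probability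 measure $\mu$ on $G$ is multiplicative on $A$ if $f\mapsto\int f\,d\mu$ is a multiplicative functional on $A$. *)

theory Defs
  imports "HOL-Probability.Probability" "HOL-Algebra.Coset"
begin

text \<open>
  The group occupies its whole type, so that the topology, the Borel sets and the measures on it
  are those provided by the type classes.
\<close>

locale compact_group = group G
  for G :: "('a::t2_space, 'b) monoid_scheme" (structure) +
  assumes carrier_UNIV: "carrier G = UNIV"
    and compact_UNIV: "compact (UNIV :: 'a set)"
    and continuous_mult: "continuous_on UNIV (\<lambda>p. fst p \<otimes> snd p)"
    and continuous_inv: "continuous_on UNIV (\<lambda>x. inv x)"

text \<open>
  Closedness in the sup-norm is closedness under uniform limits of sequences. Closure under
  multiplication by scalars is the case where one factor of a product is constant.
\<close>

definition invariant_algebra ::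
    "('a::t2_space, 'b) monoid_scheme \<Rightarrow> ('a \<Rightarrow> complex) set \<Rightarrow> bool" where
  "invariant_algebra G A \<longleftrightarrow>
     (\<forall>f\<in>A. continuous_on UNIV f) \<and>
     (\<forall>c. (\<lambda>_. c) \<in> A) \<and>
     (\<forall>f\<in>A. \<forall>g\<in>A. (\<lambda>x. f x + g x) \<in> A) \<and>
     (\<forall>f\<in>A. \<forall>g\<in>A. (\<lambda>x. f x * g x) \<in> A) \<and>
     (\<forall>F f. (\<forall>n::nat. F n \<in> A) \<and> uniform_limit UNIV F f sequentially \<longrightarrow> f \<in> A) \<and>
     (\<forall>f\<in>A. \<forall>g\<in>carrier G. (\<lambda>x. f (g \<otimes>\<^bsub>G\<^esub> x)) \<in> A) \<and>
     (\<forall>f\<in>A. \<forall>g\<in>carrier G. (\<lambda>x. f (x \<otimes>\<^bsub>G\<^esub> g)) \<in> A)"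

definition multiplicative_functionals ::
    "('a \<Rightarrow> complex) set \<Rightarrow> (('a \<Rightarrow> complex) \<Rightarrow> complex) set" where
  "multiplicative_functionals A =
     {\<phi> \<in> extensional A.
        (\<exists>f\<in>A. \<phi> f \<noteq> 0) \<and>
        (\<forall>f\<in>A. \<forall>g\<in>A. \<phi> (\<lambda>x. f x + g x) = \<phi> f + \<phi> g) \<and>
        (\<forall>c. \<forall>f\<in>A. \<phi> (\<lambda>x. c * f x) = c * \<phi> f) \<and>
        (\<forall>f\<in>A. \<forall>g\<in>A. \<phi> (\<lambda>x. f x * g x) = \<phi> f * \<phi> g)}"

definition evaluation :: "('a \<Rightarrow> complex) set \<Rightarrow> 'a \<Rightarrow> ('a \<Rightarrow> complex) \<Rightarrow> complex" where
  "evaluation A g = (\<lambda>f\<in>A. f g)"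

definition finite_regular_borel :: "('a::topological_space) measure \<Rightarrow> bool" where
  "finite_regular_borel M \<longleftrightarrow>
     finite_measure M \<and> sets M = sets borel \<and>
     (\<forall>B\<in>sets borel.
        emeasure M B = (INF U\<in>{U. B \<subseteq> U \<and> open U}. emeasure M U) \<and>
        emeasure M B = (SUP K\<in>{K. K \<subseteq> B \<and> compact K}. emeasure M K))"

text \<open>
  By the Jordan decomposition, the finite regular Borel complex measures are exactly the
  combinations \<open>\<mu>\<^sub>1 - \<mu>\<^sub>2 + \<i> (\<mu>\<^sub>3 - \<mu>\<^sub>4)\<close> of finite regular positive Borel measures. Such a
  combination is recorded by its four parts, which need not be mutually singular: the integral
  does not depend on the choice of the parts.
\<close>

record 'a complex_measure =
  re_pos :: "'a measure"
  re_neg :: "'a measure"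
  im_pos :: "'a measure"
  im_neg :: "'a measure"

definition regular_complex_measure :: "('a::topological_space) complex_measure \<Rightarrow> bool" where
  "regular_complex_measure \<mu> \<longleftrightarrow>
     finite_regular_borel (re_pos \<mu>) \<and> finite_regular_borel (re_neg \<mu>) \<and>
     finite_regular_borel (im_pos \<mu>) \<and> finite_regular_borel (im_neg \<mu>)"

definition complex_measure_integral :: "'a complex_measure \<Rightarrow> ('a \<Rightarrow> complex) \<Rightarrow> complex" where
  "complex_measure_integral \<mu> f =
     (integral\<^sup>L (re_pos \<mu>) f - integral\<^sup>L (re_neg \<mu>) f) +
     \<i> * (integral\<^sup>L (im_pos \<mu>) f - integral\<^sup>L (im_neg \<mu>) f)"

definition measure_extends ::
    "('a::topological_space \<Rightarrow> complex) set \<Rightarrow> 'a complex_measure \<Rightarrow>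
     (('a \<Rightarrow> complex) \<Rightarrow> complex) \<Rightarrow> bool" where
  "measure_extends A \<mu> \<phi> \<longleftrightarrow>
     regular_complex_measure \<mu> \<and> (\<forall>f\<in>A. complex_measure_integral \<mu> f = \<phi> f)"

text \<open>
  The value is the common one for all extending measures. Since continuous functions are
  integrated against finite measures, the integral over the product is written as an iterated one.
\<close>

definition convolution ::
    "('a::t2_space, 'b) monoid_scheme \<Rightarrow> ('a \<Rightarrow> complex) set \<Rightarrow>
     (('a \<Rightarrow> complex) \<Rightarrow> complex) \<Rightarrow> (('a \<Rightarrow> complex) \<Rightarrow> complex) \<Rightarrow>
     (('a \<Rightarrow> complex) \<Rightarrow> complex)" where
  "convolution G A \<phi> \<psi> =
     (\<lambda>f\<in>A. THE c. \<exists>\<mu> \<nu>. measure_extends A \<mu> \<phi> \<and> measure_extends A \<nu> \<psi> \<and>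
        c = complex_measure_integral \<nu>
              (\<lambda>h. complex_measure_integral \<mu> (\<lambda>g. f (g \<otimes>\<^bsub>G\<^esub> h))))"

definition spectrum_semigroup ::
    "('a::t2_space, 'b) monoid_scheme \<Rightarrow> ('a \<Rightarrow> complex) set \<Rightarrow>
     (('a \<Rightarrow> complex) \<Rightarrow> complex) monoid" where
  "spectrum_semigroup G A =
     \<lparr>carrier = multiplicative_functionals A,
      mult = convolution G A,
      one = evaluation A \<one>\<^bsub>G\<^esub>\<rparr>"

definition idempotents :: "('m, 'n) monoid_scheme \<Rightarrow> 'm set" where
  "idempotents S = {j \<in> carrier S. j \<otimes>\<^bsub>S\<^esub> j = j}"

definition idempotent_le :: "('m, 'n) monoid_scheme \<Rightarrow> 'm \<Rightarrow> 'm \<Rightarrow> bool" where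
  "idempotent_le S j k \<longleftrightarrow> j \<otimes>\<^bsub>S\<^esub> k = j \<and> k \<otimes>\<^bsub>S\<^esub> j = j"

definition least_idempotent :: "('m, 'n) monoid_scheme \<Rightarrow> 'm \<Rightarrow> bool" where
  "least_idempotent S e \<longleftrightarrow> e \<in> idempotents S \<and> (\<forall>k\<in>idempotents S. idempotent_le S e k)"

definition semigroup_zero :: "('m, 'n) monoid_scheme \<Rightarrow> 'm \<Rightarrow> bool" where
  "semigroup_zero S z \<longleftrightarrow> z \<in> carrier S \<and> (\<forall>s\<in>carrier S. z \<otimes>\<^bsub>S\<^esub> s = z \<and> s \<otimes>\<^bsub>S\<^esub> z = z)"

definition fixing_set ::
    "('a::t2_space, 'b) monoid_scheme \<Rightarrow> ('a \<Rightarrow> complex) set \<Rightarrow>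
     (('a \<Rightarrow> complex) \<Rightarrow> complex) \<Rightarrow> 'a set" where
  "fixing_set G A e =
     {g \<in> carrier G. evaluation A g \<otimes>\<^bsub>spectrum_semigroup G A\<^esub> e = e \<and>
                     e \<otimes>\<^bsub>spectrum_semigroup G A\<^esub> evaluation A g = e}"

definition antisymmetric_algebra :: "('a \<Rightarrow> complex) set \<Rightarrow> bool" where
  "antisymmetric_algebra A \<longleftrightarrow> (\<forall>f\<in>A. (\<forall>x. f x \<in> \<real>) \<longrightarrow> f constant_on UNIV)"

definition antisymmetry_set :: "('a \<Rightarrow> complex) set \<Rightarrow> 'a set \<Rightarrow> bool" where
  "antisymmetry_set A E \<longleftrightarrow> (\<forall>f\<in>A. (\<forall>x\<in>E. f x \<in> \<real>) \<longrightarrow> f constant_on E)"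

definition maximal_antisymmetry_set :: "('a \<Rightarrow> complex) set \<Rightarrow> 'a set \<Rightarrow> bool" where
  "maximal_antisymmetry_set A E \<longleftrightarrow>
     antisymmetry_set A E \<and> (\<forall>F. antisymmetry_set A F \<and> E \<subseteq> F \<longrightarrow> F = E)"

definition real_valued_part :: "('a \<Rightarrow> complex) set \<Rightarrow> ('a \<Rightarrow> complex) set" where
  "real_valued_part A = {f \<in> A. \<forall>x. f x \<in> \<real>}"

definition normalized_haar :: "('a::t2_space, 'b) monoid_scheme \<Rightarrow> 'a measure \<Rightarrow> bool" where
  "normalized_haar G m \<longleftrightarrow>
     prob_space m \<and> finite_regular_borel m \<and>
     (\<forall>g\<in>carrier G. distr m borel (\<lambda>x. g \<otimes>\<^bsub>G\<^esub> x) = m)"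

definition multiplicative_measure :: "('a \<Rightarrow> complex) set \<Rightarrow> 'a measure \<Rightarrow> bool" where
  "multiplicative_measure A m \<longleftrightarrow> (\<lambda>f\<in>A. integral\<^sup>L m f) \<in> multiplicative_functionals A"

end

(*
  Bishop's theorem identifies the real part of A with the continuous real functions that are constant on
  the cosets of the maximal set of antisymmetry N containing the identity; translation invariance makes N
  a closed normal subgroup. If f, g in A and the Haar integral of f over N vanishes, then convolving f
  with g, and the result with its own conjugate, produces a function of positive type in A whose
  conjugate agrees on N with an element of A. Antisymmetry of N makes its real part constant on N, and
  this forces the integral of f g to vanish. So the Haar measure of N is multiplicative on A, hence an
  idempotent of the spectrum; it lies below every other idempotent, because an idempotent restricted to
  the self-adjoint algebra of N-invariant functions is evaluation at the identity coset. Therefore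
  epsilon is the Haar measure of N, and its stabilizer, being a set of antisymmetry, is N.

  Convolution in the spectrum only makes sense for functionals extended to measures, which is what the
  Hahn-Banach and Riesz theorems are for; the Haar measure is obtained from the same extension theorem.
*)

theory Submission
  imports Defs
begin

text \<open>Antisymmetry of \<open>N\<close> speaks only of elements of \<open>A\<close> that are
  real on \<open>N\<close>, and \<open>A\<close> need not be closed under conjugation or under
  inversion of the variable, so real parts are not directly available. A function of positive type
  satisfies \<open>k (inv x) = cnj (k x)\<close>, which trades conjugation for inversion. For a
  convolution over \<open>N\<close>, inverting the variable is a substitution in the integral: it
  moves the translation from one factor to the other, and translates do stay in \<open>A\<close>.
  This is why the single number to be shown zero, the integral of \<open>f g\<close>, is first made
  the value at the identity of a function on the group. Bishop's theorem supplies elements of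
  \<open>A\<close>: every continuous \<open>N\<close>-invariant function belongs to it, and a
  functional can be applied to such a function only once this is known. Integrals of translates
  belong to \<open>A\<close> for a simpler reason: they are uniform limits of finite
  combinations.\<close>

section \<open>The Hahn-Banach theorem\<close>

text \<open>Homogeneity is asked only as \<open>\<le>\<close>, the form that passes to infima; for
  \<open>c > 0\<close> the reverse inequality follows by scaling with \<open>1 / c\<close>.\<close>

definition sublinear :: "('v::real_vector \<Rightarrow> real) \<Rightarrow> bool" where
  "sublinear q \<longleftrightarrow> (\<forall>x y. q (x + y) \<le> q x + q y) \<and> (\<forall>c x. 0 \<le> c \<longrightarrow> q (c *\<^sub>R x) \<le> c * q x)"

lemma sublinear_add: "sublinear q \<Longrightarrow> q (x + y) \<le> q x + q y"
  and sublinear_scale: "sublinear q \<Longrightarrow> 0 \<le> c \<Longrightarrow> q (c *\<^sub>R x) \<le> c * q x"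
  by (auto simp: sublinear_def)

lemma sublinear_zero:
  assumes "sublinear q" shows "q 0 = 0"
  using sublinear_scale[OF assms, of 0 0] sublinear_add[OF assms, of 0 0] by simp

lemma sublinear_lower:
  assumes "sublinear q" shows "- q (- x) \<le> q x"
  using sublinear_add[OF assms, of x "- x"] sublinear_zero[OF assms] by simp

text \<open>Zorn's lemma downwards. The infimum of a chain stays finite because every sublinear
  \<open>q \<le> p\<close> satisfies \<open>- p (- x) \<le> q x\<close>. Minimal elements turn out
  to be linear, so they replace the extension by one dimension at a time.\<close>

lemma sublinear_minimal_exists:
  fixes p :: "'v::real_vector \<Rightarrow> real"
  assumes p: "sublinear p"
  obtains q where "sublinear q" "\<And>x. q x \<le> p x"
    "\<And>r. sublinear r \<Longrightarrow> (\<And>x. r x \<le> q x) \<Longrightarrow> r = q"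
proof -
  define Q where "Q = {q. sublinear q \<and> (\<forall>x. q x \<le> p x)}"
  define P where "P = (\<lambda>q r::'v \<Rightarrow> real. \<forall>x. r x \<le> q x)"
  have "\<exists>m\<in>Q. \<forall>a\<in>Q. P m a \<longrightarrow> a = m"
  proof (rule predicate_Zorn)
    show "partial_order_on Q (relation_of P Q)"
      by (rule partial_order_on_relation_ofI) (auto simp: P_def fun_eq_iff intro: order_trans antisym)
    fix C assume C: "C \<in> Chains (relation_of P Q)"
    have CQ: "q \<in> Q" if "q \<in> C" for q
      using C that by (auto simp: Chains_def relation_of_def)
    have Ch: "P q r \<or> P r q" if "q \<in> C" "r \<in> C" for q r
      using C that by (auto simp: Chains_def relation_of_def)
    show "\<exists>u\<in>Q. \<forall>a\<in>C. P a u"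
    proof (cases "C = {}")
      case True
      then show ?thesis using p by (auto simp: Q_def)
    next
      case False
      define u where "u = (\<lambda>x. INF q\<in>C. q x)"
      have low: "- p (- x) \<le> q x" if "q \<in> C" for q x
        using CQ[OF that] sublinear_lower[of q x] unfolding Q_def by (smt (verit) mem_Collect_eq)
      then have bdd: "bdd_below ((\<lambda>q. q x) ` C)" for x
        by (auto intro!: bdd_belowI)
      have u_le: "u x \<le> q x" if "q \<in> C" for q x
        unfolding u_def by (rule cINF_lower[OF bdd that])
      have u_ge: "b \<le> u x" if "\<And>q. q \<in> C \<Longrightarrow> b \<le> q x" for b x
        unfolding u_def by (rule cINF_greatest[OF False that])
      \<comment> \<open>The infima at \<open>x\<close> and \<open>y\<close> may be approached along
        different members of the chain; the smaller member serves both points.\<close>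
      have two: "u (x + y) \<le> q x + r y" if "q \<in> C" "r \<in> C" for q r x y
        using Ch[OF that]
      proof
        assume "P q r"
        then show ?thesis
          using u_le[OF that(2), of "x + y"] CQ[OF that(2)] sublinear_add[of r x y]
          by (smt (verit) P_def Q_def mem_Collect_eq)
      next
        assume "P r q"
        then show ?thesis
          using u_le[OF that(1), of "x + y"] CQ[OF that(1)] sublinear_add[of q x y]
          by (smt (verit) P_def Q_def mem_Collect_eq)
      qed
      have "u (x + y) \<le> u x + u y" for x y
      proof -
        have "u (x + y) - r y \<le> u x" if "r \<in> C" for r
          by (rule u_ge) (use two[OF _ that] in \<open>simp add: algebra_simps\<close>)
        then have "u (x + y) - u x \<le> u y"
          by (intro u_ge) (simp add: algebra_simps)
        then show ?thesis by simp
      qed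
      moreover have "u (c *\<^sub>R x) \<le> c * u x" if "0 \<le> c" for c x
      proof (cases "c = 0")
        case True
        obtain q where "q \<in> C" using False by auto
        then show ?thesis
          using u_le[of q 0] CQ sublinear_zero[of q] True by (auto simp: Q_def)
      next
        case c: False
        have "u (c *\<^sub>R x) / c \<le> u x"
        proof (rule u_ge)
          fix q assume q: "q \<in> C"
          then have "u (c *\<^sub>R x) \<le> c * q x"
            using u_le[OF q, of "c *\<^sub>R x"] CQ[OF q] sublinear_scale[of q c x] that
            by (auto simp: Q_def)
          then show "u (c *\<^sub>R x) / c \<le> q x"
            using c that by (simp add: field_simps)
        qed
        then show ?thesis using c that by (simp add: field_simps)
      qed
      ultimately have "sublinear u" by (simp add: sublinear_def)
      moreover have "u x \<le> p x" for x
      proof -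
        obtain q where "q \<in> C" using False by auto
        then show ?thesis using u_le[of q x] CQ[of q] by (auto simp: Q_def intro: order_trans)
      qed
      ultimately show ?thesis using u_le by (auto simp: Q_def P_def)
    qed
  qed
  then obtain q where "q \<in> Q" "\<And>a. a \<in> Q \<Longrightarrow> P q a \<Longrightarrow> a = q" by blast
  then show ?thesis
    by (intro that[of q]) (auto simp: Q_def P_def intro: order_trans)
qed

text \<open>Lowering \<open>q\<close> as far as possible along the ray in direction \<open>v\<close>
  gives a sublinear \<open>r \<le> q\<close>. Minimality forces \<open>r = q\<close>, and the
  competitor \<open>t = 1\<close> in the infimum then reads
  \<open>q x + q v \<le> q (x + v)\<close>.\<close>

lemma minimal_sublinear_linear:
  fixes q :: "'v::real_vector \<Rightarrow> real"
  assumes q: "sublinear q"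
    and minimal: "\<And>r. sublinear r \<Longrightarrow> (\<And>x. r x \<le> q x) \<Longrightarrow> r = q"
  shows "linear q"
proof -
  have superadd: "q x + q v \<le> q (x + v)" for x v
  proof -
    define r where "r = (\<lambda>x. INF t\<in>{0::real..}. q (x + t *\<^sub>R v) - t * q v)"
    have low: "- q (- x) \<le> q (x + t *\<^sub>R v) - t * q v" if "0 \<le> t" for x t
    proof -
      have "t * q v \<le> q (t *\<^sub>R v)"
      proof (cases "t = 0")
        case False
        then show ?thesis
          using sublinear_scale[OF q, of "1/t" "t *\<^sub>R v"] that by (simp add: field_simps)
      qed (simp add: sublinear_zero[OF q])
      also have "\<dots> \<le> q (x + t *\<^sub>R v) + q (- x)"
        using sublinear_add[OF q, of "x + t *\<^sub>R v" "- x"] by simp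
      finally show ?thesis by simp
    qed
    then have bdd: "bdd_below ((\<lambda>t. q (x + t *\<^sub>R v) - t * q v) ` {0..})" for x
      by (intro bdd_belowI[of _ "- q (- x)"]) auto
    have r_le: "r x \<le> q (x + t *\<^sub>R v) - t * q v" if "0 \<le> t" for x t
      unfolding r_def by (rule cINF_lower[OF bdd]) (use that in simp)
    have r_ge: "b \<le> r x" if "\<And>t. 0 \<le> t \<Longrightarrow> b \<le> q (x + t *\<^sub>R v) - t * q v" for b x
      unfolding r_def by (rule cINF_greatest) (use that in auto)
    have "r (x + y) \<le> r x + r y" for x y
    proof -
      have "r (x + y) - (q (y + t *\<^sub>R v) - t * q v) \<le> r x" if "0 \<le> t" for t
      proof (rule r_ge)
        fix s :: real assume "0 \<le> s"
        then have "r (x + y) \<le> q ((x + y) + (s + t) *\<^sub>R v) - (s + t) * q v"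
          using that by (intro r_le) simp
        also have "(x + y) + (s + t) *\<^sub>R v = (x + s *\<^sub>R v) + (y + t *\<^sub>R v)"
          by (simp add: algebra_simps)
        finally show "r (x + y) - (q (y + t *\<^sub>R v) - t * q v) \<le> q (x + s *\<^sub>R v) - s * q v"
          using sublinear_add[OF q, of "x + s *\<^sub>R v" "y + t *\<^sub>R v"] by (simp add: algebra_simps)
      qed
      then have "r (x + y) - r x \<le> r y"
        by (intro r_ge) (simp add: algebra_simps)
      then show ?thesis by simp
    qed
    moreover have "r (c *\<^sub>R x) \<le> c * r x" if "0 \<le> c" for c x
    proof (cases "c = 0")
      case True
      then show ?thesis using r_le[of 0 0] sublinear_zero[OF q] by simp
    next
      case False
      have "r (c *\<^sub>R x) / c \<le> r x"
      proof (rule r_ge)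
        fix t :: real assume t: "0 \<le> t"
        have "r (c *\<^sub>R x) \<le> q (c *\<^sub>R (x + t *\<^sub>R v)) - (c * t) * q v"
          using r_le[of "c * t" "c *\<^sub>R x"] t that by (simp add: algebra_simps)
        also have "\<dots> \<le> c * (q (x + t *\<^sub>R v) - t * q v)"
          using sublinear_scale[OF q that, of "x + t *\<^sub>R v"] by (simp add: algebra_simps)
        finally show "r (c *\<^sub>R x) / c \<le> q (x + t *\<^sub>R v) - t * q v"
          using False that by (simp add: field_simps)
      qed
      then show ?thesis using False that by (simp add: field_simps)
    qed
    ultimately have "sublinear r" by (simp add: sublinear_def)
    then have "r = q" by (rule minimal) (use r_le[of 0] in simp)
    then show ?thesis using r_le[of 1 x] by simp
  qed
  have add: "q (x + y) = q x + q y" for x y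
    using superadd[of x y] sublinear_add[OF q, of x y] by simp
  have neg: "q (- x) = - q x" for x
    using add[of x "- x"] sublinear_zero[OF q] by simp
  have pos: "q (c *\<^sub>R x) = c * q x" if "0 \<le> c" for c x
    using sublinear_scale[OF q that, of x] sublinear_scale[OF q that, of "- x"] neg
    by (simp add: neg)
  have "q (c *\<^sub>R x) = c * q x" for c x
    using pos[of c x] pos[of "- c" x] neg[of "c *\<^sub>R x"] by (cases "0 \<le> c") auto
  with add show ?thesis by (simp add: linear_iff)
qed

text \<open>The infimal convolution \<open>r\<close> of \<open>p\<close> with \<open>l\<close> is
  sublinear, below \<open>p\<close> everywhere and below \<open>l\<close> on \<open>S\<close>. A
  minimal sublinear \<open>L \<le> r\<close> is linear, and a linear \<open>L \<le> l\<close> on a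
  subspace equals \<open>l\<close> there, by comparing at \<open>s\<close> and
  \<open>- s\<close>.\<close>

theorem hahn_banach:
  fixes p :: "'v::real_vector \<Rightarrow> real"
  assumes p: "sublinear p"
    and S: "subspace S"
    and add: "\<And>x y. x \<in> S \<Longrightarrow> y \<in> S \<Longrightarrow> l (x + y) = l x + l y"
    and scale: "\<And>c x. x \<in> S \<Longrightarrow> l (c *\<^sub>R x) = c * l x"
    and le: "\<And>x. x \<in> S \<Longrightarrow> l x \<le> p x"
  obtains L where "linear L" "\<And>x. L x \<le> p x" "\<And>x. x \<in> S \<Longrightarrow> L x = l x"
proof -
  define r where "r = (\<lambda>x. INF s\<in>S. p (x - s) + l s)"
  have neg: "l (- s) = - l s" if "s \<in> S" for s
    using scale[OF that, of "-1"] by simp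
  have low: "- p (- x) \<le> p (x - s) + l s" if "s \<in> S" for x s
    using le[of "- s"] neg[OF that] subspace_neg[OF S that] sublinear_add[OF p, of "x - s" "- x"]
    by simp
  then have bdd: "bdd_below ((\<lambda>s. p (x - s) + l s) ` S)" for x
    by (intro bdd_belowI[of _ "- p (- x)"]) auto
  have ne: "S \<noteq> {}" using subspace_0[OF S] by auto
  have r_le: "r x \<le> p (x - s) + l s" if "s \<in> S" for x s
    unfolding r_def by (rule cINF_lower[OF bdd that])
  have r_ge: "b \<le> r x" if "\<And>s. s \<in> S \<Longrightarrow> b \<le> p (x - s) + l s" for b x
    unfolding r_def by (rule cINF_greatest[OF ne that])
  have l0: "l 0 = 0" using scale[of 0 0] subspace_0[OF S] by simp
  have "r (x + y) \<le> r x + r y" for x y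
  proof -
    have "r (x + y) - (p (y - t) + l t) \<le> r x" if t: "t \<in> S" for t
    proof (rule r_ge)
      fix s assume s: "s \<in> S"
      have "r (x + y) \<le> p ((x - s) + (y - t)) + (l s + l t)"
        using r_le[OF subspace_add[OF S s t], of "x + y"] add[OF s t] by (simp add: algebra_simps)
      then show "r (x + y) - (p (y - t) + l t) \<le> p (x - s) + l s"
        using sublinear_add[OF p, of "x - s" "y - t"] by simp
    qed
    then have "r (x + y) - r x \<le> r y"
      by (intro r_ge) (simp add: algebra_simps)
    then show ?thesis by simp
  qed
  moreover have "r (c *\<^sub>R x) \<le> c * r x" if "0 \<le> c" for c x
  proof (cases "c = 0")
    case True
    then show ?thesis using r_le[OF subspace_0[OF S], of 0] sublinear_zero[OF p] l0 by simp
  next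
    case False
    have "r (c *\<^sub>R x) / c \<le> r x"
    proof (rule r_ge)
      fix s assume s: "s \<in> S"
      have "r (c *\<^sub>R x) \<le> p (c *\<^sub>R (x - s)) + c * l s"
        using r_le[OF subspace_scale[OF S s, of c], of "c *\<^sub>R x"] scale[OF s]
        by (simp add: algebra_simps)
      also have "\<dots> \<le> c * (p (x - s) + l s)"
        using sublinear_scale[OF p that, of "x - s"] by (simp add: algebra_simps)
      finally show "r (c *\<^sub>R x) / c \<le> p (x - s) + l s"
        using False that by (simp add: field_simps)
    qed
    then show ?thesis using False that by (simp add: field_simps)
  qed
  ultimately have r: "sublinear r" by (simp add: sublinear_def)
  obtain L where L: "sublinear L" "\<And>x. L x \<le> r x"
    "\<And>q. sublinear q \<Longrightarrow> (\<And>x. q x \<le> L x) \<Longrightarrow> q = L"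
    using sublinear_minimal_exists[OF r] by blast
  have lin: "linear L" using minimal_sublinear_linear[OF L(1,3)] by blast
  have le_l: "L s \<le> l s" if "s \<in> S" for s
    using L(2)[of s] r_le[OF that, of s] sublinear_zero[OF p] by simp
  show ?thesis
  proof (rule that[OF lin])
    show "L x \<le> p x" for x
      using L(2)[of x] r_le[OF subspace_0[OF S], of x] l0 by simp
    show "L s = l s" if "s \<in> S" for s
      using le_l[OF that] le_l[OF subspace_neg[OF S that]] neg[OF that] linear_neg[OF lin, of s]
      by simp
  qed
qed

section \<open>The Riesz representation theorem\<close>

lemma compact_Hausdorff_Urysohn:
  fixes S T :: "'a::t2_space set"
  assumes "compact (UNIV :: 'a set)" "closed S" "closed T" "S \<inter> T = {}"
  obtains v :: "'a \<Rightarrow> real" where "continuous_on UNIV v" "\<And>x. 0 \<le> v x" "\<And>x. v x \<le> 1"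
    "\<And>x. x \<in> S \<Longrightarrow> v x = 0" "\<And>x. x \<in> T \<Longrightarrow> v x = 1"
proof -
  have "normal_space (euclidean :: 'a topology)"
    using assms(1) by (intro compact_Hausdorff_or_regular_imp_normal_space)
      (use hausdorff in \<open>auto simp: compact_space_def Hausdorff_space_def disjnt_def\<close>)
  then obtain v where v: "continuous_map (euclidean :: 'a topology) (top_of_set {0..1::real}) v"
      "v ` S \<subseteq> {0}" "v ` T \<subseteq> {1}"
    using Urysohn_lemma[of "euclidean :: 'a topology" S T 0 1] assms by (auto simp: disjnt_def)
  show ?thesis
    by (rule that[of v]) (use v in \<open>auto simp: continuous_map_in_subtopology\<close>)
qed

text \<open>Complements of open sets are compact here, so inner regularity at \<open>B\<close> is
  outer regularity at \<open>- B\<close>; finiteness of the measure allows the subtraction.\<close>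

lemma finite_regular_borelI:
  fixes M :: "'a::t2_space measure"
  assumes compact: "compact (UNIV :: 'a set)"
    and fin: "finite_measure M"
    and sets: "sets M = sets borel"
    and outer: "\<And>B. B \<in> sets borel \<Longrightarrow>
      emeasure M B = (INF U\<in>{U. B \<subseteq> U \<and> open U}. emeasure M U)"
  shows "finite_regular_borel M"
proof -
  interpret finite_measure M by (rule fin)
  have space: "space M = UNIV" using sets_eq_imp_space_eq[OF sets] by simp
  have "emeasure M B = (SUP K\<in>{K. K \<subseteq> B \<and> compact K}. emeasure M K)" (is "_ = ?S")
    if B: "B \<in> sets borel" for B
  proof (rule antisym)
    show "?S \<le> emeasure M B"
      by (rule SUP_least) (use B sets in \<open>auto intro!: emeasure_mono\<close>)
    show "emeasure M B \<le> ?S"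
    proof (rule ennreal_le_epsilon)
      fix e :: real assume e: "0 < e"
      have "(INF U\<in>{U. - B \<subseteq> U \<and> open U}. emeasure M U) < emeasure M (- B) + e"
        using e outer[of "- B"] B emeasure_finite[of "- B"]
        by (auto simp: ennreal_less_top less_top intro: borel_comp)
      then obtain U where U: "- B \<subseteq> U" "open U" "emeasure M U < emeasure M (- B) + e"
        by (auto simp: INF_less_iff)
      have m: "U \<in> sets M" "B \<in> sets M" "- B \<in> sets M" "- U \<in> sets M"
        using U B sets by auto
      have "emeasure M (- B) + emeasure M (U \<inter> B) = emeasure M U"
        using m U(1) by (subst plus_emeasure) (auto intro: arg_cong[where f = "emeasure M"])
      then have "emeasure M (U \<inter> B) \<le> e"
        using U(3) emeasure_finite[of "- B"]
        by (metis ennreal_add_left_cancel_le less_imp_le infinity_ennreal_def)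
      moreover have "emeasure M B = emeasure M (- U) + emeasure M (U \<inter> B)"
        using m U(1) by (subst plus_emeasure) (auto intro: arg_cong[where f = "emeasure M"])
      moreover have "emeasure M (- U) \<le> ?S"
        using U compact_Int_closed[OF compact, of "- U"] by (intro SUP_upper) auto
      ultimately show "emeasure M B \<le> ?S + e"
        by (simp add: add_mono)
    qed
  qed
  then show ?thesis
    using fin sets outer unfolding finite_regular_borel_def by blast
qed

lemma integrable_continuous_compact:
  fixes f :: "'a::t2_space \<Rightarrow> 'b::{banach, second_countable_topology}"
  assumes "compact (UNIV :: 'a set)" "finite_measure M" "sets M = sets borel"
    and f: "continuous_on UNIV f"
  shows "integrable M f"
proof -
  interpret finite_measure M by fact
  have "bounded (range f)"
    using compact_imp_bounded[OF compact_continuous_image[OF f assms(1)]] .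
  then obtain B where "\<And>x. norm (f x) \<le> B" by (auto simp: bounded_iff)
  moreover have "f \<in> borel_measurable M"
    using borel_measurable_continuous_onI[OF f] measurable_cong_sets[OF assms(3) refl] by blast
  ultimately show ?thesis by (intro integrable_const_bound[of _ B]) auto
qed

locale positive_functional =
  fixes L :: "('a::t2_space \<Rightarrow> real) \<Rightarrow> real"
  assumes compact: "compact (UNIV :: 'a set)"
    and add: "continuous_on UNIV f \<Longrightarrow> continuous_on UNIV g \<Longrightarrow> L (\<lambda>x. f x + g x) = L f + L g"
    and scale: "continuous_on UNIV f \<Longrightarrow> L (\<lambda>x. c * f x) = c * L f"
    and nonneg: "continuous_on UNIV f \<Longrightarrow> (\<And>x. 0 \<le> f x) \<Longrightarrow> 0 \<le> L f"
begin

section \<open>Positive functionals and the outer measure they induce\<close>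

lemma L_zero: "L (\<lambda>_. 0) = 0"
  using scale[of "\<lambda>_. 0" 0] by simp

lemma L_const: "L (\<lambda>_. c) = c * L (\<lambda>_. 1)"
  using scale[of "\<lambda>_. 1" c] by simp

lemma L_one_nonneg: "0 \<le> L (\<lambda>_. 1)"
  by (rule nonneg) auto

lemma L_mono:
  assumes "continuous_on UNIV f" "continuous_on UNIV g" "\<And>x. f x \<le> g x"
  shows "L f \<le> L g"
proof -
  have "L g = L (\<lambda>x. f x + (g x - f x))" by simp
  also have "\<dots> = L f + L (\<lambda>x. g x - f x)"
    using assms by (intro add continuous_intros) auto
  finally show ?thesis using nonneg[of "\<lambda>x. g x - f x"] assms by (auto intro!: continuous_intros)
qed

lemma L_sum:
  assumes "finite I" "\<And>i. i \<in> I \<Longrightarrow> continuous_on UNIV (f i)"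
  shows "L (\<lambda>x. \<Sum>i\<in>I. f i x) = (\<Sum>i\<in>I. L (f i))"
  using assms
proof (induction I)
  case (insert j I)
  then show ?case by (simp add: L_zero) (subst add; auto intro!: continuous_intros)
qed (simp add: L_zero)

text \<open>Domination by the indicator replaces the usual condition of compact support inside
  \<open>U\<close>. Compactness is recovered by \<open>truncate\<close>: \<open>truncate d f\<close>
  vanishes off the closed set \<open>{x. d \<le> f x}\<close>, which lies in
  \<open>U\<close>.\<close>

definition below :: "'a set \<Rightarrow> ('a \<Rightarrow> real) set" where
  "below U = {f. continuous_on UNIV f \<and> (\<forall>x. 0 \<le> f x \<and> f x \<le> indicator U x)}"

definition weight :: "'a set \<Rightarrow> ennreal" where
  "weight U = (SUP f\<in>below U. ennreal (L f))"

definition outer :: "'a set \<Rightarrow> ennreal" where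
  "outer E = (INF U\<in>{U. E \<subseteq> U \<and> open U}. weight U)"

lemma zero_below: "(\<lambda>_. 0) \<in> below U"
  by (auto simp: below_def)

lemma below_le_weight: "f \<in> below U \<Longrightarrow> ennreal (L f) \<le> weight U"
  unfolding weight_def by (rule SUP_upper)

lemma belowD:
  assumes "f \<in> below U"
  shows "continuous_on UNIV f" "0 \<le> f x" "f x \<le> 1" "x \<notin> U \<Longrightarrow> f x = 0"
proof -
  have *: "0 \<le> f x" "f x \<le> indicator U x" using assms by (auto simp: below_def)
  then show "0 \<le> f x" "x \<notin> U \<Longrightarrow> f x = 0" by auto
  show "f x \<le> 1" using * by (cases "x \<in> U") auto
qed (use assms in \<open>simp add: below_def\<close>)

lemma belowI:
  assumes "continuous_on UNIV f" "\<And>x. 0 \<le> f x" "\<And>x. f x \<le> 1" "\<And>x. x \<notin> U \<Longrightarrow> f x = 0"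
  shows "f \<in> below U"
  using assms by (auto simp: below_def indicator_def)

lemma superlevel_below: "f \<in> below U \<Longrightarrow> 0 < d \<Longrightarrow> {x. d \<le> f x} \<subseteq> U"
  using belowD(4) by force

lemma weight_mono: "U \<subseteq> V \<Longrightarrow> weight U \<le> weight V"
  unfolding weight_def
  by (rule SUP_subset_mono) (auto intro!: belowI dest: belowD)

lemma weight_empty: "weight {} = 0"
proof -
  have "L f = 0" if "f \<in> below {}" for f
  proof -
    have "f = (\<lambda>_. 0)" using belowD(4)[OF that] by auto
    then show ?thesis by (simp add: L_zero)
  qed
  then show ?thesis by (auto simp: weight_def bot_ennreal intro!: antisym SUP_least)
qed

lemma weight_UNIV: "weight UNIV = ennreal (L (\<lambda>_. 1))"
  unfolding weight_def
  by (rule antisym) (auto intro!: SUP_least SUP_upper ennreal_leI L_mono belowI dest: belowD)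

lemma outer_open: "open U \<Longrightarrow> outer U = weight U"
  unfolding outer_def
  by (intro antisym INF_lower INF_greatest weight_mono) auto

lemma outer_mono: "E \<subseteq> F \<Longrightarrow> outer E \<le> outer F"
  unfolding outer_def by (rule INF_superset_mono) auto

definition truncate :: "real \<Rightarrow> ('a \<Rightarrow> real) \<Rightarrow> 'a \<Rightarrow> real" where
  "truncate d f = (\<lambda>x. max 0 (f x - d))"

lemma continuous_truncate: "continuous_on UNIV f \<Longrightarrow> continuous_on UNIV (truncate d f)"
  unfolding truncate_def by (intro continuous_intros)

lemma L_truncate:
  assumes "continuous_on UNIV f"
  shows "L f \<le> L (truncate d f) + d * L (\<lambda>_. 1)"
proof -
  have "L f \<le> L (\<lambda>x. truncate d f x + d)"
    by (rule L_mono) (use assms continuous_truncate[of f d] in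
      \<open>auto intro!: continuous_intros simp: truncate_def\<close>)
  also have "\<dots> = L (truncate d f) + d * L (\<lambda>_. 1)"
    using continuous_truncate[OF assms] by (subst add) (auto simp: L_const[of d])
  finally show ?thesis .
qed

lemma truncation_error:
  assumes f: "continuous_on UNIV f" and "0 < e"
  obtains d where "0 < d" "L f \<le> L (truncate d f) + e"
proof -
  \<comment> \<open>The summand 1 keeps the quotient defined when \<open>L\<close> is zero.\<close>
  define d where "d = e / (1 + L (\<lambda>_. 1))"
  have "0 < d" using assms(2) L_one_nonneg by (simp add: d_def add_pos_nonneg)
  moreover have "d * L (\<lambda>_. 1) \<le> e"
    using assms(2) L_one_nonneg unfolding d_def by (simp add: field_simps add_pos_nonneg)
  ultimately show ?thesis using L_truncate[OF f, of d] that[of d] by linarith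
qed

lemma closed_superlevel: "continuous_on UNIV f \<Longrightarrow> closed {x. d \<le> f x}" for f :: "'a \<Rightarrow> real"
  using closed_Collect_le[of "\<lambda>_. d" f] by auto

lemma compact_closed: "closed K \<Longrightarrow> compact (K :: 'a set)"
  using compact_Int_closed[OF compact, of K] by simp

lemma truncate_below:
  assumes "f \<in> below U" "0 < d" "{x. d \<le> f x} \<subseteq> V"
  shows "truncate d f \<in> below V"
proof (rule belowI)
  show "continuous_on UNIV (truncate d f)"
    using belowD(1)[OF assms(1)] by (rule continuous_truncate)
  fix x
  show "0 \<le> truncate d f x" by (simp add: truncate_def)
  show "truncate d f x \<le> 1"
    using belowD(3)[OF assms(1), of x] assms(2) by (simp add: truncate_def)
  show "truncate d f x = 0" if "x \<notin> V"
    using assms(3) that by (force simp: truncate_def)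
qed

text \<open>A Urysohn function \<open>v\<close> splits the truncated \<open>f\<close>. It vanishes
  off \<open>V\<close>, so \<open>t v\<close> lives in \<open>V\<close>; it is 1 on
  \<open>K - U\<close> while \<open>t\<close> vanishes off \<open>K\<close>, so
  \<open>t (1 - v)\<close> lives in \<open>U\<close>.\<close>

lemma weight_Un:
  assumes "open U" "open V"
  shows "weight (U \<union> V) \<le> weight U + weight V"
proof (rule ennreal_le_epsilon)
  fix e :: real assume e: "0 < e"
  have "ennreal (L f) \<le> weight U + weight V + ennreal e" if f: "f \<in> below (U \<union> V)" for f
  proof -
    have fc: "continuous_on UNIV f" using f by (simp add: below_def)
    obtain d where d: "0 < d" "L f \<le> L (truncate d f) + e"
      using truncation_error[OF fc e] .
    define K where "K = {x. d \<le> f x}"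
    have "closed K" unfolding K_def by (rule closed_superlevel[OF fc])
    have KUV: "K \<subseteq> U \<union> V" unfolding K_def by (rule superlevel_below[OF f d(1)])
    have "closed (- V)" "closed (K - U)" "- V \<inter> (K - U) = {}"
      using assms \<open>closed K\<close> KUV by auto
    then obtain v :: "'a \<Rightarrow> real" where v: "continuous_on UNIV v" "\<And>x. 0 \<le> v x" "\<And>x. v x \<le> 1"
      "\<And>x. x \<in> - V \<Longrightarrow> v x = 0" "\<And>x. x \<in> K - U \<Longrightarrow> v x = 1"
      using compact_Hausdorff_Urysohn[OF compact, of "- V" "K - U"] by blast
    let ?t = "truncate d f"
    have t: "?t \<in> below K" by (rule truncate_below[OF f d(1)]) (simp add: K_def)
    note t' = belowD(2-4)[OF t]
    have tc: "continuous_on UNIV ?t" using t by (rule belowD(1))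
    have a: "(\<lambda>x. ?t x * v x) \<in> below V"
      using v t' tc by (intro belowI continuous_intros mult_nonneg_nonneg mult_le_one) auto
    have b: "(\<lambda>x. ?t x * (1 - v x)) \<in> below U"
    proof (intro belowI continuous_intros mult_nonneg_nonneg mult_le_one)
      show "?t x * (1 - v x) = 0" if "x \<notin> U" for x
        using that v(5)[of x] t'(3)[of x] by auto
    qed (use v t' tc in auto)
    have "L ?t = L (\<lambda>x. ?t x * (1 - v x) + ?t x * v x)" by (simp add: algebra_simps)
    also have "\<dots> = L (\<lambda>x. ?t x * (1 - v x)) + L (\<lambda>x. ?t x * v x)"
      using v(1) tc by (intro add continuous_intros)
    finally have "ennreal (L f) \<le> ennreal (L (\<lambda>x. ?t x * (1 - v x)) + L (\<lambda>x. ?t x * v x) + e)"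
      using d(2) by (intro ennreal_leI) simp
    also have "\<dots> = ennreal (L (\<lambda>x. ?t x * (1 - v x))) + ennreal (L (\<lambda>x. ?t x * v x)) + ennreal e"
      using nonneg[OF belowD(1,2)[OF a]] nonneg[OF belowD(1,2)[OF b]] e by (simp add: ennreal_plus)
    also have "\<dots> \<le> weight U + weight V + ennreal e"
      by (intro add_mono below_le_weight a b order_refl)
    finally show ?thesis .
  qed
  then show "weight (U \<union> V) \<le> weight U + weight V + ennreal e"
    unfolding weight_def[of "U \<union> V"] by (rule SUP_least)
qed

lemma weight_finite_UN:
  fixes U :: "nat \<Rightarrow> 'a set"
  assumes "\<And>i. open (U i)"
  shows "weight (\<Union>i<n. U i) \<le> (\<Sum>i<n. weight (U i))"
proof (induction n)
  case (Suc n)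
  have "weight (\<Union>i<Suc n. U i) = weight ((\<Union>i<n. U i) \<union> U n)"
    by (simp add: lessThan_Suc Un_commute)
  also have "\<dots> \<le> weight (\<Union>i<n. U i) + weight (U n)"
    using assms by (intro weight_Un) auto
  also have "\<dots> \<le> (\<Sum>i<Suc n. weight (U i))"
    using Suc by (simp add: add_right_mono)
  finally show ?case .
qed (simp add: weight_empty)

text \<open>The truncated function lives on a compact superlevel set, which finitely many
  \<open>U i\<close> cover.\<close>

lemma weight_UN:
  fixes U :: "nat \<Rightarrow> 'a set"
  assumes U: "\<And>i. open (U i)"
  shows "weight (\<Union>i. U i) \<le> (\<Sum>i. weight (U i))"
proof (rule ennreal_le_epsilon)
  fix e :: real assume e: "0 < e"
  have "ennreal (L f) \<le> (\<Sum>i. weight (U i)) + ennreal e" if f: "f \<in> below (\<Union>i. U i)" for f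
  proof -
    have fc: "continuous_on UNIV f" using f by (simp add: below_def)
    obtain d where d: "0 < d" "L f \<le> L (truncate d f) + e"
      using truncation_error[OF fc e] .
    define K where "K = {x. d \<le> f x}"
    have K: "compact K" unfolding K_def by (rule compact_closed[OF closed_superlevel[OF fc]])
    have "K \<subseteq> (\<Union>i. U i)" unfolding K_def by (rule superlevel_below[OF f d(1)])
    then obtain C where C: "finite C" "K \<subseteq> (\<Union>i\<in>C. U i)"
      using compactE_image[OF K, of UNIV U] U by auto
    obtain n where "C \<subseteq> {..<n}" using finite_nat_iff_bounded C(1) by blast
    with C have "K \<subseteq> (\<Union>i<n. U i)" by blast
    then have t: "truncate d f \<in> below (\<Union>i<n. U i)"
      by (intro truncate_below[OF f d(1)]) (simp add: K_def)
    have "ennreal (L f) \<le> ennreal (L (truncate d f) + e)" using d(2) by (rule ennreal_leI)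
    also have "\<dots> = ennreal (L (truncate d f)) + ennreal e"
      using nonneg[OF belowD(1,2)[OF t]] e by (intro ennreal_plus) auto
    also have "\<dots> \<le> (\<Sum>i<n. weight (U i)) + ennreal e"
      using below_le_weight[OF t] weight_finite_UN[OF U, where n = n] by (intro add_right_mono) (rule order_trans)
    also have "\<dots> \<le> (\<Sum>i. weight (U i)) + ennreal e"
      by (intro add_right_mono sum_le_suminf) auto
    finally show ?thesis .
  qed
  then show "weight (\<Union>i. U i) \<le> (\<Sum>i. weight (U i)) + ennreal e"
    unfolding weight_def[of "\<Union>i. U i"] by (rule SUP_least)
qed

lemma outer_measure_space_outer: "outer_measure_space (Pow UNIV) outer"
proof -
  have "countably_subadditive (Pow UNIV) outer"
    unfolding countably_subadditive_def
  proof (intro allI impI)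
    fix A :: "nat \<Rightarrow> 'a set"
    show "outer (\<Union>i. A i) \<le> (\<Sum>i. outer (A i))"
    proof (rule ennreal_le_epsilon)
      fix e :: real assume e: "0 < e" and "(\<Sum>i. outer (A i)) < Orderings.top"
      then have less: "outer (A n) < outer (A n) + e * (1/2)^Suc n" for n
        by (auto simp add: less_top dest!: ennreal_suminf_lessD)
      have "\<exists>U. (A n \<subseteq> U \<and> open U) \<and> weight U < outer (A n) + e * (1/2)^Suc n" for n
        using less[of n] INF_less_iff[of weight "{U. A n \<subseteq> U \<and> open U}"
            "outer (A n) + e * (1/2)^Suc n", folded outer_def] by auto
      then obtain U where U: "\<And>n. A n \<subseteq> U n" "\<And>n. open (U n)"
          "\<And>n. weight (U n) < outer (A n) + e * (1/2)^Suc n"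
        using choice[of "\<lambda>n V. (A n \<subseteq> V \<and> open V) \<and> weight V < outer (A n) + e * (1/2)^Suc n"] by blast
      have "outer (\<Union>i. A i) \<le> weight (\<Union>i. U i)"
        unfolding outer_def using U(1,2) by (intro INF_lower) blast
      also have "\<dots> \<le> (\<Sum>i. weight (U i))" by (rule weight_UN[OF U(2)])
      also have "\<dots> \<le> (\<Sum>n. outer (A n) + e * (1/2)^Suc n)"
        using U(3) by (intro suminf_le less_imp_le) auto
      also have "\<dots> = (\<Sum>n. outer (A n)) + (\<Sum>n. ennreal e * ennreal ((1/2) ^ Suc n))"
        using e by (subst suminf_add[symmetric])
          (auto simp del: ennreal_suminf_cmult simp add: ennreal_mult[symmetric])
      also have "\<dots> = (\<Sum>n. outer (A n)) + e"
        unfolding ennreal_suminf_cmult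
        by (subst suminf_ennreal_eq[OF zero_le_power power_half_series]) auto
      finally show "outer (\<Union>i. A i) \<le> (\<Sum>n. outer (A n)) + e" .
    qed
  qed
  moreover have "outer {} = 0" using outer_open[of "{}"] weight_empty by simp
  ultimately show ?thesis
    by (auto simp: outer_measure_space_def positive_def increasing_def intro: outer_mono)
qed

text \<open>It suffices to split an open \<open>V\<close>. A nearly optimal function for
  \<open>V \<inter> U\<close>, truncated, lives on a closed
  \<open>K \<subseteq> V \<inter> U\<close>; any \<open>g\<close> below \<open>V - K\<close> can be
  added to it without exceeding 1 or leaving \<open>V\<close>, and \<open>V - K\<close> is an open
  set containing \<open>V - U\<close>.\<close>

lemma open_in_lambda_system:
  assumes U: "open U"
  shows "U \<in> lambda_system UNIV (Pow UNIV) outer"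
proof -
  interpret algebra UNIV "Pow UNIV :: 'a set set" by (rule algebra_Pow)
  have sub: "outer E \<le> outer (E \<inter> U) + outer (E - U)" for E
  proof -
    let ?A = "\<lambda>i::nat. if i = 0 then E \<inter> U else if i = 1 then E - U else {}"
    have "disjoint_family ?A" by (auto simp: disjoint_family_on_def)
    moreover have "countably_subadditive (Pow UNIV) outer"
      using outer_measure_space_outer by (simp add: outer_measure_space_def)
    ultimately have "outer (\<Union>i. ?A i) \<le> (\<Sum>i. outer (?A i))"
      unfolding countably_subadditive_def by blast
    also have "(\<Sum>i. outer (?A i)) = (\<Sum>i<2. outer (?A i))"
      using outer_open[of "{}"] weight_empty by (intro suminf_finite) auto
    also have "\<dots> = outer (E \<inter> U) + outer (E - U)"
      by (simp add: numeral_2_eq_2)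
    also have "(\<Union>i. ?A i) = E" by (auto split: if_splits)
    finally show ?thesis .
  qed
  have "weight (V \<inter> U) + outer (V - U) \<le> weight V" if V: "open V" for V
  proof (rule ennreal_le_epsilon)
    fix e :: real assume e: "0 < e"
    have "ennreal (L f) + outer (V - U) \<le> weight V + ennreal e" if f: "f \<in> below (V \<inter> U)" for f
    proof -
      have fc: "continuous_on UNIV f" using f by (simp add: below_def)
      obtain d where d: "0 < d" "L f \<le> L (truncate d f) + e"
        using truncation_error[OF fc e] .
      define K where "K = {x. d \<le> f x}"
      have "closed K" unfolding K_def by (rule closed_superlevel[OF fc])
      have KUV: "K \<subseteq> V \<inter> U" unfolding K_def by (rule superlevel_below[OF f d(1)])
      have t: "truncate d f \<in> below K" by (rule truncate_below[OF f d(1)]) (simp add: K_def)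
      have "ennreal (L (truncate d f)) + ennreal (L g) \<le> weight V" if g: "g \<in> below (V - K)" for g
      proof -
        have "(\<lambda>x. truncate d f x + g x) \<in> below V"
        proof (rule belowI)
          fix x
          show "truncate d f x + g x \<le> 1" "x \<notin> V \<Longrightarrow> truncate d f x + g x = 0"
            using belowD(2-4)[OF t, of x] belowD(2-4)[OF g, of x] KUV by (cases "x \<in> K"; auto)+
        qed (use belowD[OF t] belowD[OF g] in \<open>auto intro!: continuous_intros add_nonneg_nonneg\<close>)
        then have "ennreal (L (\<lambda>x. truncate d f x + g x)) \<le> weight V" by (rule below_le_weight)
        also have "L (\<lambda>x. truncate d f x + g x) = L (truncate d f) + L g"
          using belowD(1)[OF t] belowD(1)[OF g] by (rule add)
        also have "ennreal \<dots> = ennreal (L (truncate d f)) + ennreal (L g)"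
          using nonneg[OF belowD(1,2)[OF t]] nonneg[OF belowD(1,2)[OF g]] by (rule ennreal_plus)
        finally show ?thesis .
      qed
      then have *: "ennreal (L (truncate d f)) + weight (V - K) \<le> weight V"
        unfolding weight_def[of "V - K"]
        using zero_below[of "V - K"] by (subst ennreal_SUP_add_right) (auto intro!: SUP_least)
      have "ennreal (L f) \<le> ennreal (L (truncate d f) + e)" using d(2) by (rule ennreal_leI)
      also have "\<dots> = ennreal (L (truncate d f)) + ennreal e"
        using nonneg[OF belowD(1,2)[OF t]] e by (intro ennreal_plus) auto
      finally have "ennreal (L f) + outer (V - U) \<le> ennreal (L (truncate d f)) + ennreal e + outer (V - U)"
        by (rule add_right_mono)
      also have "outer (V - U) \<le> weight (V - K)"
        unfolding outer_def using KUV V \<open>closed K\<close> by (intro INF_lower) auto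
      finally show ?thesis
        using * by (smt (verit) add.assoc add.commute add_left_mono order_trans)
    qed
    then show "weight (V \<inter> U) + outer (V - U) \<le> weight V + ennreal e"
      unfolding weight_def[of "V \<inter> U"]
      using zero_below[of "V \<inter> U"] by (subst ennreal_SUP_add_left[symmetric]) (auto intro!: SUP_least)
  qed
  then have "outer (E \<inter> U) + outer (E - U) \<le> weight V" if "E \<subseteq> V" "open V" for E V
  proof -
    have "outer (E \<inter> U) + outer (E - U) \<le> outer (V \<inter> U) + outer (V - U)"
      using that by (intro add_mono outer_mono) auto
    also have "outer (V \<inter> U) = weight (V \<inter> U)" using that U by (intro outer_open) auto
    finally show ?thesis using \<open>\<And>V. open V \<Longrightarrow> _ V\<close>[OF that(2)] by (rule order_trans)
  qed
  then have "outer (E \<inter> U) + outer (E - U) \<le> outer E" for E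
    unfolding outer_def[of E] by (intro INF_greatest) auto
  then show ?thesis
    unfolding lambda_system_eq using sub by (auto intro!: antisym)
qed

section \<open>The representing measure\<close>

definition riesz :: "'a measure" where
  "riesz = measure_of UNIV (sets borel) outer"

lemma sets_riesz: "sets riesz = sets borel"
  unfolding riesz_def using sigma_algebra.sigma_sets_eq[OF sets.sigma_algebra_axioms[of borel]] by simp

lemma emeasure_riesz:
  assumes "B \<in> sets borel"
  shows "emeasure riesz B = outer B"
proof -
  let ?l = "lambda_system UNIV (Pow UNIV) outer"
  have ms: "measure_space UNIV ?l outer"
    by (rule sigma_algebra.caratheodory_lemma[OF sigma_algebra_Pow outer_measure_space_outer])
  then have l: "sigma_algebra UNIV ?l" by (simp add: measure_space_def)
  have sub: "sets borel \<subseteq> ?l"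
    unfolding borel_def
    by (subst sets_measure_of, simp, rule sigma_algebra.sigma_sets_subset[OF l])
      (use open_in_lambda_system in auto)
  have "measure_space UNIV (sets borel) outer"
    by (rule measure_down[OF ms _ sub]) (use sets.sigma_algebra_axioms[of "borel :: 'a measure"] in simp)
  then show ?thesis
    using assms unfolding riesz_def
    by (intro emeasure_measure_of_sigma) (auto simp: measure_space_def)
qed

lemma finite_regular_riesz: "finite_regular_borel riesz"
proof (rule finite_regular_borelI[OF compact _ sets_riesz])
  have "emeasure riesz (space riesz) = ennreal (L (\<lambda>_. 1))"
    using sets_eq_imp_space_eq[OF sets_riesz] by (simp add: emeasure_riesz outer_open weight_UNIV)
  then show "finite_measure riesz" by (intro finite_measureI) simp
  show "emeasure riesz B = (INF U\<in>{U. B \<subseteq> U \<and> open U}. emeasure riesz U)" if "B \<in> sets borel" for B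
    using that by (simp add: emeasure_riesz outer_def[of B] outer_open cong: INF_cong_simp)
qed

sublocale riesz: finite_measure riesz
  using finite_regular_riesz by (simp add: finite_regular_borel_def)

lemma integrable_riesz: "continuous_on UNIV f \<Longrightarrow> integrable riesz (f :: 'a \<Rightarrow> real)"
  by (rule integrable_continuous_compact[OF compact riesz.finite_measure_axioms sets_riesz])

lemma measure_riesz_UNIV: "measure riesz UNIV = L (\<lambda>_. 1)"
  using L_one_nonneg by (simp add: measure_def emeasure_riesz outer_open weight_UNIV)

lemma L_le_measure:
  assumes "f \<in> below U" "open U"
  shows "L f \<le> measure riesz U"
  using below_le_weight[OF assms(1)] assms(2)
  by (simp add: emeasure_riesz[symmetric] outer_open[symmetric] riesz.emeasure_eq_measure)

text \<open>Slicing the graph of \<open>f\<close> horizontally at the heights \<open>i / n\<close>.\<close>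

lemma L_le_integral:
  assumes f: "continuous_on UNIV f" and f01: "\<And>x. 0 \<le> f x" "\<And>x. f x \<le> 1"
  shows "L f \<le> integral\<^sup>L riesz f"
proof -
  have "L f \<le> integral\<^sup>L riesz f + measure riesz UNIV / Suc m" for m
  proof -
    define n where "n = Suc m"
    have n: "0 < real n" by (simp add: n_def)
    define U where "U = (\<lambda>i::nat. {x. real i / n < f x})"
    \<comment> \<open>\<open>s i\<close> is the part of the graph between the heights
      \<open>i / n\<close> and \<open>(i + 1) / n\<close>; multiplied by \<open>n\<close> it lies in
      \<open>below (U i)\<close>.\<close>
    define s where "s = (\<lambda>(i::nat) x. min (max (f x - real i / n) 0) (1 / n))"
    have oU: "open (U i)" for i
      unfolding U_def using f by (intro open_Collect_less continuous_intros) auto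
    have sc: "continuous_on UNIV (s i)" for i
      unfolding s_def using f by (intro continuous_intros)
    have sums: "(\<Sum>i<k. s i x) = min (f x) (real k / n)" for k x
    proof (induction k)
      case (Suc k)
      have split: "min t a + min (max (t - a) 0) b = min t (a + b)" if "0 < b" for t a b :: real
        using that by (auto simp: min_def max_def)
      show ?case
        using split[of "1 / n" "f x" "k / n"] Suc n by (simp add: s_def add_divide_distrib add.commute)
    qed (use f01 in simp)
    have "L f = L (\<lambda>x. \<Sum>i<n. s i x)"
      using f01 n by (simp add: sums min_absorb1)
    also have "\<dots> = (\<Sum>i<n. L (s i))" using sc by (intro L_sum) auto
    also have "\<dots> \<le> (\<Sum>i<n. measure riesz (U i) / n)"
    proof (rule sum_mono)
      fix i
      have "(\<lambda>x. n * s i x) \<in> below (U i)"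
        using sc n by (intro belowI continuous_intros)
          (auto simp: U_def s_def min_def max_def field_simps)
      then have "L (\<lambda>x. n * s i x) \<le> measure riesz (U i)" using oU by (rule L_le_measure)
      then show "L (s i) \<le> measure riesz (U i) / n"
        using scale[OF sc[of i], of n] n by (simp add: field_simps)
    qed
    also have "\<dots> = (\<integral>x. (\<Sum>i<n. indicator (U i) x / n) \<partial>riesz)"
      using oU by (subst Bochner_Integration.integral_sum)
        (auto simp: sets_riesz riesz.emeasure_eq_measure intro!: sum.cong)
    also have "\<dots> \<le> (\<integral>x. f x + 1 / n \<partial>riesz)"
    proof (rule integral_mono)
      show "integrable riesz (\<lambda>x. \<Sum>i<n. indicator (U i) x / n :: real)"
        using oU by (auto simp: sets_riesz riesz.emeasure_eq_measure)
      show "integrable riesz (\<lambda>x. f x + 1 / n)"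
        using f by (intro integrable_riesz continuous_intros)
      fix x
      \<comment> \<open>The number of heights \<open>i / n\<close> below \<open>f x\<close> exceeds
        \<open>n * f x\<close> by at most one; the minimum with \<open>k / n\<close> carries the
        induction.\<close>
      have "(\<Sum>i<k. indicator (U i) x / n) \<le> min (f x + 1 / n) (real k / n)" for k
      proof (induction k)
        case (Suc k)
        then show ?case using n f01[of x]
          by (auto simp: U_def indicator_def min_def add_divide_distrib split: if_splits)
      qed (use f01 n in simp)
      then show "(\<Sum>i<n. indicator (U i) x / n) \<le> f x + 1 / n"
        by (meson min.boundedE)
    qed
    also have "\<dots> = integral\<^sup>L riesz f + measure riesz UNIV / n"
      using integrable_riesz[OF f] sets_eq_imp_space_eq[OF sets_riesz] by simp
    finally show ?thesis by (simp add: n_def)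
  qed
  then have lim: "\<forall>m. L f \<le> integral\<^sup>L riesz f + measure riesz UNIV / Suc m" by blast
  have "(\<lambda>m. integral\<^sup>L riesz f + measure riesz UNIV / Suc m) \<longlonglongrightarrow> integral\<^sup>L riesz f + 0"
    by (intro tendsto_intros LIMSEQ_Suc[OF lim_const_over_n])
  then show ?thesis using lim LIMSEQ_le_const[of _ _ "L f"] by fastforce
qed

text \<open>For values in \<open>[0, 1]\<close>, \<open>L_le_integral\<close> applied to
  \<open>g\<close> and to \<open>1 - g\<close> gives both inequalities, since the total mass is
  \<open>L\<close> of 1. An affine change brings any continuous function into this range.\<close>

theorem riesz_representation:
  assumes f: "continuous_on UNIV f"
  shows "integral\<^sup>L riesz f = L f"
proof -
  have unit: "integral\<^sup>L riesz g = L g"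
    if g: "continuous_on UNIV g" "\<And>x. 0 \<le> g x" "\<And>x. g x \<le> 1" for g
  proof (rule antisym)
    show "L g \<le> integral\<^sup>L riesz g" by (rule L_le_integral[OF g])
    have "L (\<lambda>x. 1 - g x) \<le> integral\<^sup>L riesz (\<lambda>x. 1 - g x)"
      using g by (intro L_le_integral continuous_intros) auto
    also have "\<dots> = L (\<lambda>_. 1) - integral\<^sup>L riesz g"
      using integrable_riesz[OF g(1)] sets_eq_imp_space_eq[OF sets_riesz]
      by (simp add: measure_riesz_UNIV)
    also have "L (\<lambda>x. 1 - g x) = L (\<lambda>_. 1) - L g"
      using add[of "\<lambda>_. 1" "\<lambda>x. - 1 * g x"] scale[OF g(1), of "- 1"] g(1)
      by (auto intro!: continuous_intros)
    finally show "integral\<^sup>L riesz g \<le> L g" by simp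
  qed
  have "bounded (range f)"
    using compact_imp_bounded[OF compact_continuous_image[OF f compact]] .
  then obtain B where B: "0 < B" "\<And>x. \<bar>f x\<bar> \<le> B"
    by (auto simp: bounded_pos)
  define g where "g = (\<lambda>x. (f x + B) / (2 * B))"
  have gc: "continuous_on UNIV g" unfolding g_def using f B by (intro continuous_intros) auto
  have "integral\<^sup>L riesz g = L g"
    using B by (intro unit gc) (auto simp: g_def field_simps abs_le_iff, (smt (verit))+)
  moreover have f_eq: "f = (\<lambda>x. 2 * B * g x + (- B))" using B by (auto simp: g_def fun_eq_iff)
  have "integral\<^sup>L riesz f = 2 * B * integral\<^sup>L riesz g - B * L (\<lambda>_. 1)"
    unfolding f_eq using integrable_riesz[OF gc] sets_eq_imp_space_eq[OF sets_riesz]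
    by (simp add: measure_riesz_UNIV)
  moreover have "L f = 2 * B * L g - B * L (\<lambda>_. 1)"
    unfolding f_eq using gc
    by (subst add) (auto intro!: continuous_intros simp: scale L_const[of "- B"])
  ultimately show ?thesis by simp
qed

end

text \<open>The hypothesis on \<open>l\<close> is domination by the supremum, a sublinear
  functional. The extension inherits it: applied to \<open>- f\<close> it gives positivity, and to
  the constants 1 and -1 it gives total mass 1. It serves twice, for representing measures and for
  the Haar measure.\<close>

theorem dominated_functional_measure:
  fixes S :: "('a::t2_space \<Rightarrow> real) set"
  assumes compact: "compact (UNIV :: 'a set)"
    and cont: "\<And>f. f \<in> S \<Longrightarrow> continuous_on UNIV f"
    and zero: "(\<lambda>_. 0) \<in> S"
    and add: "\<And>f g. f \<in> S \<Longrightarrow> g \<in> S \<Longrightarrow> (\<lambda>x. f x + g x) \<in> S \<and> l (\<lambda>x. f x + g x) = l f + l g"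
    and scale: "\<And>f c. f \<in> S \<Longrightarrow> (\<lambda>x. c * f x) \<in> S \<and> l (\<lambda>x. c * f x) = c * l f"
    and le: "\<And>f c. f \<in> S \<Longrightarrow> (\<And>x. f x \<le> c) \<Longrightarrow> l f \<le> c"
  obtains M where "prob_space M" "finite_regular_borel M" "\<And>f. f \<in> S \<Longrightarrow> integral\<^sup>L M f = l f"
proof -
  \<comment> \<open>Bounded continuous functions form a type of class \<open>real_vector\<close>, as
    \<open>hahn_banach\<close> requires; by compactness every continuous function is one.\<close>
  define p where "p = (\<lambda>b :: 'a \<Rightarrow>\<^sub>C real. SUP x. apply_bcontfun b x)"
  have bdd: "bdd_above (range (apply_bcontfun b))" for b :: "'a \<Rightarrow>\<^sub>C real"
    by (rule bounded_imp_bdd_above) simp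
  have p_ge: "apply_bcontfun b x \<le> p b" for b x
    unfolding p_def by (rule cSUP_upper[OF _ bdd]) simp
  have p_le: "p b \<le> c" if "\<And>x. apply_bcontfun b x \<le> c" for b c
    unfolding p_def by (rule cSUP_least) (use that in auto)
  have "sublinear p"
    unfolding sublinear_def
  proof (intro conjI allI impI)
    show "p (a + b) \<le> p a + p b" for a b
      by (rule p_le) (simp add: plus_bcontfun.rep_eq add_mono p_ge)
    show "p (c *\<^sub>R b) \<le> c * p b" if "0 \<le> c" for c b
      by (rule p_le) (simp add: scaleR_bcontfun.rep_eq mult_left_mono p_ge that)
  qed
  moreover have "subspace {b. apply_bcontfun b \<in> S}"
    using zero add scale
    by (auto simp: subspace_def plus_bcontfun.rep_eq scaleR_bcontfun.rep_eq zero_bcontfun.rep_eq)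
  ultimately obtain \<Lambda> where \<Lambda>: "linear \<Lambda>" "\<And>b. \<Lambda> b \<le> p b"
    "\<And>b. apply_bcontfun b \<in> S \<Longrightarrow> \<Lambda> b = l (apply_bcontfun b)"
  proof (rule hahn_banach[where l = "\<lambda>b. l (apply_bcontfun b)"])
    show "l (apply_bcontfun b) \<le> p b" if "b \<in> {b. apply_bcontfun b \<in> S}" for b
      using that p_ge by (intro le) auto
  qed (use add scale in \<open>auto simp: plus_bcontfun.rep_eq scaleR_bcontfun.rep_eq\<close>)
  define L where "L = (\<lambda>f. \<Lambda> (Bcontfun f))"
  have inv: "apply_bcontfun (Bcontfun f) = f" if "continuous_on UNIV f" for f :: "'a \<Rightarrow> real"
    using that compact_imp_bounded[OF compact_continuous_image[OF that compact]]
    by (intro Bcontfun_inverse) (simp add: bcontfun_def)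
  have L_le: "L f \<le> c" if "continuous_on UNIV f" "\<And>x. f x \<le> c" for f c
    unfolding L_def using \<Lambda>(2) p_le inv that by (metis order_trans)
  have L_scale: "L (\<lambda>x. c * f x) = c * L f" if "continuous_on UNIV f" for c f
  proof -
    have "Bcontfun (\<lambda>x. c * f x) = c *\<^sub>R Bcontfun f"
      by (rule bcontfun_eqI) (use that in \<open>simp add: scaleR_bcontfun.rep_eq inv continuous_intros\<close>)
    then show ?thesis unfolding L_def by (simp add: linear_cmul[OF \<Lambda>(1)])
  qed
  interpret positive_functional L
  proof
    fix f g :: "'a \<Rightarrow> real" assume f: "continuous_on UNIV f" and g: "continuous_on UNIV g"
    have "Bcontfun (\<lambda>x. f x + g x) = Bcontfun f + Bcontfun g"
      by (rule bcontfun_eqI) (use f g in \<open>simp add: plus_bcontfun.rep_eq inv continuous_intros\<close>)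
    then show "L (\<lambda>x. f x + g x) = L f + L g"
      unfolding L_def by (simp add: linear_add[OF \<Lambda>(1)])
  next
    fix f :: "'a \<Rightarrow> real" assume f: "continuous_on UNIV f" "\<And>x. 0 \<le> f x"
    show "0 \<le> L f"
      using L_le[of "\<lambda>x. - 1 * f x" 0] L_scale[OF f(1), of "- 1"] f by (auto intro!: continuous_intros)
  qed (use compact L_scale in auto)
  have "L (\<lambda>_. 1) = 1"
    using L_le[of "\<lambda>_. 1" 1] L_le[of "\<lambda>_. -1" "-1"] L_const[of "-1"] by simp
  then have "measure riesz (space riesz) = 1"
    using sets_eq_imp_space_eq[OF sets_riesz] by (simp add: measure_riesz_UNIV)
  then have "prob_space riesz"
    by (intro prob_spaceI) (simp add: riesz.emeasure_eq_measure)
  then show ?thesis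
    by (rule that) (use finite_regular_riesz riesz_representation cont \<Lambda>(3) inv in \<open>auto simp: L_def\<close>)
qed

section \<open>Uniform algebras and their multiplicative functionals\<close>

locale uniform_algebra =
  fixes A :: "('a::t2_space \<Rightarrow> complex) set"
  assumes compact_space: "compact (UNIV :: 'a set)"
    and cont: "f \<in> A \<Longrightarrow> continuous_on UNIV f"
    and const_mem: "(\<lambda>_. c) \<in> A"
    and add_mem: "f \<in> A \<Longrightarrow> g \<in> A \<Longrightarrow> (\<lambda>x. f x + g x) \<in> A"
    and mult_mem: "f \<in> A \<Longrightarrow> g \<in> A \<Longrightarrow> (\<lambda>x. f x * g x) \<in> A"
    and limit_mem: "(\<And>n::nat. F n \<in> A) \<Longrightarrow> uniform_limit UNIV F f sequentially \<Longrightarrow> f \<in> A"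
begin

lemma scale_mem: "f \<in> A \<Longrightarrow> (\<lambda>x. c * f x) \<in> A"
  using mult_mem[OF const_mem] .

lemma diff_mem: "f \<in> A \<Longrightarrow> g \<in> A \<Longrightarrow> (\<lambda>x. f x - g x) \<in> A"
  using add_mem[of f "\<lambda>x. - 1 * g x"] scale_mem[of g "- 1"] by simp

lemma power_mem: "f \<in> A \<Longrightarrow> (\<lambda>x. f x ^ n) \<in> A"
  by (induction n) (simp_all add: const_mem mult_mem)

lemma sum_mem: "(\<And>i. i \<in> I \<Longrightarrow> f i \<in> A) \<Longrightarrow> (\<lambda>x. \<Sum>i\<in>I. f i x) \<in> A"
  by (induction I rule: infinite_finite_induct) (simp_all add: const_mem add_mem)

lemma approx_mem:
  assumes "\<And>e. 0 < e \<Longrightarrow> \<exists>g\<in>A. \<forall>x. norm (f x - g x) \<le> e"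
  shows "f \<in> A"
proof -
  obtain F where F: "\<And>n::nat. F n \<in> A" "\<And>n x. norm (f x - F n x) \<le> 1 / Suc n"
    using assms[of "1 / Suc _"] by (metis of_nat_0_less_iff zero_less_Suc zero_less_divide_1_iff)
  have "uniform_limit UNIV F f sequentially"
  proof (rule uniform_limitI)
    fix e :: real assume "0 < e"
    then obtain N where N: "1 / Suc N < e" using nat_approx_posE by blast
    show "\<forall>\<^sub>F n in sequentially. \<forall>x\<in>UNIV. dist (F n x) (f x) < e"
    proof (rule eventually_sequentiallyI[of N], rule ballI)
      fix n x assume "N \<le> n"
      then have "1 / real (Suc n) \<le> 1 / Suc N" by (simp add: frac_le)
      with F(2)[of x n] N show "dist (F n x) (f x) < e"
        by (simp add: dist_norm norm_minus_commute)
    qed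
  qed
  with F(1) show ?thesis by (rule limit_mem)
qed

lemma bounded_mem:
  assumes "f \<in> A"
  obtains B where "0 < B" "\<And>x. norm (f x) \<le> B"
  using compact_imp_bounded[OF compact_continuous_image[OF cont[OF assms] compact_space]]
  by (auto simp: bounded_pos)

lemma inverse_one_minus_mem:
  assumes g: "g \<in> A" and r: "r < 1" "\<And>x. norm (g x) \<le> r"
  shows "(\<lambda>x. 1 / (1 - g x)) \<in> A"
proof (rule approx_mem)
  fix e :: real assume e: "0 < e"
  have r0: "0 \<le> r" using r(2)[of undefined] norm_ge_zero order_trans by blast
  have "(\<lambda>n. r ^ n / (1 - r)) \<longlonglongrightarrow> 0 / (1 - r)"
    using r0 r(1) by (intro tendsto_intros LIMSEQ_realpow_zero) auto
  then have "\<forall>\<^sub>F n in sequentially. r ^ n / (1 - r) < e"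
    using e by (intro order_tendstoD) auto
  then obtain n where n: "r ^ n / (1 - r) < e" by (auto simp: eventually_sequentially)
  have "norm (1 / (1 - g x) - (\<Sum>k<n. g x ^ k)) \<le> e" for x
  proof -
    have "g x \<noteq> 1" using r by (metis norm_one not_le)
    then have "1 / (1 - g x) - (\<Sum>k<n. g x ^ k) = g x ^ n / (1 - g x)"
      by (simp add: sum_gp_strict field_simps)
    also have "norm \<dots> = norm (g x) ^ n / norm (1 - g x)"
      by (simp add: norm_divide norm_power)
    also have "\<dots> \<le> r ^ n / (1 - r)"
    proof (rule frac_le)
      show "1 - r \<le> norm (1 - g x)"
        using norm_triangle_ineq2[of 1 "g x"] r(2)[of x] by simp
    qed (use r r0 in \<open>auto intro: power_mono\<close>)
    finally show ?thesis using n by simp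
  qed
  moreover have "(\<lambda>x. \<Sum>k<n. g x ^ k) \<in> A"
    by (intro sum_mem power_mem g)
  ultimately show "\<exists>h\<in>A. \<forall>x. norm (1 / (1 - g x) - h x) \<le> e"
    by (intro bexI[of _ "\<lambda>x. \<Sum>k<n. g x ^ k"]) auto
qed

section \<open>Multiplicative functionals and representing measures\<close>

context
  fixes \<phi> :: "('a \<Rightarrow> complex) \<Rightarrow> complex"
  assumes phi: "\<phi> \<in> multiplicative_functionals A"
begin

lemma phi_add: "f \<in> A \<Longrightarrow> g \<in> A \<Longrightarrow> \<phi> (\<lambda>x. f x + g x) = \<phi> f + \<phi> g"
  and phi_scale: "f \<in> A \<Longrightarrow> \<phi> (\<lambda>x. c * f x) = c * \<phi> f"
  and phi_mult: "f \<in> A \<Longrightarrow> g \<in> A \<Longrightarrow> \<phi> (\<lambda>x. f x * g x) = \<phi> f * \<phi> g"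
  using phi by (auto simp: multiplicative_functionals_def)

lemma phi_one: "\<phi> (\<lambda>_. 1) = 1"
proof -
  obtain f where "f \<in> A" "\<phi> f \<noteq> 0" using phi by (auto simp: multiplicative_functionals_def)
  then show ?thesis using phi_mult[of f "\<lambda>_. 1"] const_mem by simp
qed

lemma phi_const: "\<phi> (\<lambda>_. c) = c"
  using phi_scale[OF const_mem, of c 1] phi_one by simp

lemma phi_diff: "f \<in> A \<Longrightarrow> g \<in> A \<Longrightarrow> \<phi> (\<lambda>x. f x - g x) = \<phi> f - \<phi> g"
  using phi_add[of f "\<lambda>x. - 1 * g x"] phi_scale[of g "- 1"] scale_mem[of g "- 1"] by simp

text \<open>\<open>1 - g\<close> is invertible in \<open>A\<close> by the geometric series, so a
  multiplicative functional cannot send it to 0.\<close>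

lemma phi_neq_one:
  assumes g: "g \<in> A" and r: "r < 1" "\<And>x. norm (g x) \<le> r"
  shows "\<phi> g \<noteq> 1"
proof
  assume "\<phi> g = 1"
  have "g x \<noteq> 1" for x using r by (metis norm_one not_le)
  then have "(\<lambda>x. 1 / (1 - g x) * (1 - g x)) = (\<lambda>_. 1)" by simp
  then have "1 = \<phi> (\<lambda>x. 1 / (1 - g x) * (1 - g x))" using phi_one by simp
  also have "\<dots> = \<phi> (\<lambda>x. 1 / (1 - g x)) * \<phi> (\<lambda>x. 1 - g x)"
    by (intro phi_mult inverse_one_minus_mem[OF g r] diff_mem const_mem g)
  also have "\<phi> (\<lambda>x. 1 - g x) = 0"
    using phi_diff[OF const_mem g, of 1] phi_one \<open>\<phi> g = 1\<close> by simp
  finally show False by simp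
qed

text \<open>If \<open>\<phi> f\<close> lay to the right of the half plane containing the values of
  \<open>f\<close>, a large disc would contain those values well inside and have
  \<open>\<phi> f\<close> on its boundary. Rescaled to the unit disc, this contradicts
  \<open>phi_neq_one\<close>.\<close>

lemma Re_phi_le:
  assumes f: "f \<in> A" and le: "\<And>x. Re (f x) \<le> c"
  shows "Re (\<phi> f) \<le> c"
proof (rule ccontr)
  define w d where "w = \<phi> f" and "d = Re w - c"
  assume "\<not> ?thesis"
  then have d: "0 < d" by (simp add: d_def w_def)
  have fw: "(\<lambda>x. f x - w) \<in> A" by (intro diff_mem f const_mem)
  obtain B where B: "0 < B" "\<And>x. norm (f x - w) \<le> B" using bounded_mem[OF fw] by blast
  \<comment> \<open>\<open>t * d \<ge> B\<^sup>2\<close> lets half of the cross term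
    \<open>2 * t * d\<close> absorb \<open>B\<^sup>2\<close>, leaving
    \<open>t\<^sup>2 - t * d\<close>.\<close>
  define t where "t = B\<^sup>2 / d + d"
  have t: "d < t" "B\<^sup>2 \<le> t * d" "0 < t"
    using d B by (auto simp: t_def field_simps power2_eq_square add_pos_pos)
  define g where "g = (\<lambda>x. (1 / complex_of_real t) * (complex_of_real t + (f x - w)))"
  have g: "g \<in> A" unfolding g_def by (intro scale_mem add_mem const_mem fw)
  have "norm (g x) \<le> sqrt (1 - d / t)" for x
  proof -
    have Re: "Re (f x - w) \<le> - d" using le[of x] by (simp add: d_def)
    have "(norm (of_real t + (f x - w)))\<^sup>2 = t\<^sup>2 + 2 * t * Re (f x - w) + (norm (f x - w))\<^sup>2"
      unfolding cmod_power2 by (simp add: power2_eq_square algebra_simps)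
    also have "\<dots> \<le> t\<^sup>2 + 2 * t * (- d) + B\<^sup>2"
      using Re B(2)[of x] t by (intro add_mono mult_left_mono power_mono) auto
    also have "\<dots> \<le> t\<^sup>2 * (1 - d / t)" using t by (simp add: field_simps power2_eq_square)
    finally have "norm (of_real t + (f x - w)) \<le> sqrt (t\<^sup>2 * (1 - d / t))"
      by (rule real_le_rsqrt)
    then show ?thesis
      using t unfolding real_sqrt_mult by (simp add: g_def norm_mult norm_divide mult.commute pos_divide_le_eq)
  qed
  moreover have "sqrt (1 - d / t) < 1" using t d by simp
  ultimately have "\<phi> g \<noteq> 1" by (intro phi_neq_one[OF g])
  moreover have "\<phi> g = 1"
  proof -
    have "\<phi> g = (1 / of_real t) * (of_real t + (\<phi> f - w))"
      unfolding g_def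
      by (subst phi_scale phi_add phi_diff; (intro add_mem const_mem fw f)?)+ (simp add: phi_const)
    then show ?thesis using t by (simp add: w_def)
  qed
  ultimately show False by simp
qed

text \<open>The extension theorem is real, so it is applied to the real parts of \<open>A\<close>.
  \<open>Re_phi_le\<close> makes \<open>Re (\<phi> f)\<close> depend on \<open>Re f\<close> alone
  and also gives the domination. Imaginary parts are real parts of
  \<open>- \<i> * f\<close>.\<close>

lemma representing_measure_exists:
  obtains M where "prob_space M" "finite_regular_borel M" "\<And>f. f \<in> A \<Longrightarrow> integral\<^sup>L M f = \<phi> f"
proof -
  define S where "S = (\<lambda>f x. Re (f x)) ` A"
  define l where "l = (\<lambda>u. Re (\<phi> (SOME f. f \<in> A \<and> u = (\<lambda>x. Re (f x)))))"
  have eq: "Re (\<phi> f) \<le> Re (\<phi> g)" if "f \<in> A" "g \<in> A" "(\<lambda>x. Re (f x)) = (\<lambda>x. Re (g x))" for f g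
    using Re_phi_le[OF diff_mem[OF that(1,2)], of 0] that(3) phi_diff[OF that(1,2)]
    by (simp add: fun_eq_iff)
  have l: "l (\<lambda>x. Re (f x)) = Re (\<phi> f)" if "f \<in> A" for f
  proof -
    define g where "g = (SOME g. g \<in> A \<and> (\<lambda>x. Re (f x)) = (\<lambda>x. Re (g x)))"
    have "g \<in> A \<and> (\<lambda>x. Re (f x)) = (\<lambda>x. Re (g x))"
      unfolding g_def by (rule someI[of _ f]) (use that in auto)
    then have "Re (\<phi> g) = Re (\<phi> f)"
      using eq[of f g] eq[of g f] that by (auto intro: antisym)
    then show ?thesis by (simp add: l_def g_def)
  qed
  have S: "(\<lambda>x. Re (f x)) \<in> S" if "f \<in> A" for f
    using that by (auto simp: S_def)
  obtain M where M: "prob_space M" "finite_regular_borel M"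
    "\<And>u. u \<in> S \<Longrightarrow> integral\<^sup>L M u = l u"
  proof (rule dominated_functional_measure[OF compact_space, of S l])
    show "continuous_on UNIV u" if "u \<in> S" for u
      using that cont by (auto simp: S_def intro: continuous_on_Re)
    show "(\<lambda>_. 0) \<in> S" using const_mem[of 0] by (force simp: S_def)
    show "(\<lambda>x. u x + v x) \<in> S \<and> l (\<lambda>x. u x + v x) = l u + l v" if "u \<in> S" "v \<in> S" for u v
    proof -
      obtain f g where fg: "f \<in> A" "g \<in> A" "u = (\<lambda>x. Re (f x))" "v = (\<lambda>x. Re (g x))"
        using \<open>u \<in> S\<close> \<open>v \<in> S\<close> by (auto simp: S_def)
      then have "(\<lambda>x. u x + v x) = (\<lambda>x. Re (f x + g x))" by simp
      then show ?thesis
        using l[OF add_mem[OF fg(1,2)]] l[OF fg(1)] l[OF fg(2)] fg S[OF add_mem[OF fg(1,2)]]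
        by (simp add: phi_add)
    qed
    show "(\<lambda>x. c * u x) \<in> S \<and> l (\<lambda>x. c * u x) = c * l u" if "u \<in> S" for u c
    proof -
      obtain f where f: "f \<in> A" "u = (\<lambda>x. Re (f x))"
        using \<open>u \<in> S\<close> by (auto simp: S_def)
      then have "(\<lambda>x. c * u x) = (\<lambda>x. Re (of_real c * f x))" by simp
      then show ?thesis
        using l[OF scale_mem[OF f(1), of "of_real c"]] l[OF f(1)] f S[OF scale_mem[OF f(1), of "of_real c"]]
        by (simp add: phi_scale)
    qed
    show "l u \<le> c" if "u \<in> S" "\<And>x. u x \<le> c" for u c
      using that Re_phi_le l by (auto simp: S_def)
  qed blast
  have fin: "finite_measure M" "sets M = sets borel"
    using M(2) by (auto simp: finite_regular_borel_def)
  show ?thesis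
  proof (rule that[OF M(1,2)])
    fix f assume f: "f \<in> A"
    have int: "integrable M f"
      by (rule integrable_continuous_compact[OF compact_space fin cont[OF f]])
    have Re: "integral\<^sup>L M (\<lambda>x. Re (g x)) = Re (\<phi> g)" if "g \<in> A" for g
      using M(3)[of "\<lambda>x. Re (g x)"] l[OF that] that by (auto simp: S_def)
    show "integral\<^sup>L M f = \<phi> f"
    proof (rule complex_eqI)
      show "Re (integral\<^sup>L M f) = Re (\<phi> f)" using Re[OF f] int by simp
      have "integral\<^sup>L M (\<lambda>x. Im (f x)) = Im (\<phi> f)"
        using Re[OF scale_mem[OF f, of "- \<i>"]] phi_scale[OF f, of "- \<i>"] by simp
      then show "Im (integral\<^sup>L M f) = Im (\<phi> f)" using int by simp
    qed
  qed
qed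

end

end

section \<open>Integrals of continuous functions on a product\<close>

text \<open>Compactness in \<open>x\<close> makes the continuity in \<open>y\<close> uniform in
  \<open>x\<close>; compactness in \<open>y\<close> then leaves finitely many
  representatives.\<close>

lemma finite_valued_approximation:
  fixes F :: "'a::t2_space \<times> 'b::t2_space \<Rightarrow> complex"
  assumes "compact (UNIV :: 'a set)" "compact (UNIV :: 'b set)" "continuous_on UNIV F" "0 < e"
  obtains p :: "'b \<Rightarrow> 'b" where "finite (range p)" "\<And>S. p -` S \<in> sets borel"
    "\<And>x y. norm (F (x, y) - F (x, p y)) \<le> e"
proof -
  have "\<exists>V. y \<in> V \<and> open V \<and> (\<forall>y'\<in>V. \<forall>x. norm (F (x, y') - F (x, y)) \<le> e)" for y
  proof -
    have "continuous_on (UNIV \<times> UNIV) (\<lambda>z. F (snd z, fst z))"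
      by (intro continuous_on_compose2[OF assms(3)] continuous_intros) auto
    from continuous_on_prod_compactE[OF this assms(1) UNIV_I[of y] assms(4)]
    obtain V where "y \<in> V" "open V"
      "\<forall>y'\<in>V \<inter> UNIV. \<forall>x\<in>UNIV. dist (F (snd (y', x), fst (y', x))) (F (snd (y, x), fst (y, x))) \<le> e"
      by metis
    then show ?thesis by (auto simp: dist_norm)
  qed
  from choice[OF allI, OF this] obtain V where
    "\<forall>y. y \<in> V y \<and> open (V y) \<and> (\<forall>y'\<in>V y. \<forall>x. norm (F (x, y') - F (x, y)) \<le> e)" ..
  then have V: "\<And>y. y \<in> V y" "\<And>y. open (V y)"
    "\<And>y y' x. y' \<in> V y \<Longrightarrow> norm (F (x, y') - F (x, y)) \<le> e" by auto
  obtain Y where Y: "finite Y" "UNIV \<subseteq> (\<Union>y\<in>Y. V y)"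
    by (rule compactE_image[OF assms(2), of UNIV V]) (use V in auto)
  obtain n and z :: "nat \<Rightarrow> 'b" where z: "Y = z ` {..<n}"
    using finite_imp_nat_seg_image_inj_on[OF Y(1)] by (auto simp: lessThan_def)
  \<comment> \<open>Taking the first index turns the open cover into a finite Borel
    partition.\<close>
  define q where "q = (\<lambda>y. LEAST i. y \<in> V (z i))"
  have ex: "\<exists>i<n. y \<in> V (z i)" for y using Y(2) z by blast
  have qV: "y \<in> V (z (q y))" for y
    unfolding q_def using ex[of y] LeastI_ex[of "\<lambda>i. y \<in> V (z i)"] by blast
  have qn: "q y < n" for y
    using ex[of y] Least_le[of "\<lambda>i. y \<in> V (z i)"] unfolding q_def by (meson le_less_trans)
  have q_borel: "q -` {i} \<in> sets borel" for i
  proof -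
    have "q -` {i} = V (z i) - (\<Union>j<i. V (z j))"
      using qV by (auto simp: q_def dest: not_less_Least intro!: Least_equality)
        (meson lessThan_iff not_le_imp_less)
    then show ?thesis using V(2) by auto
  qed
  show ?thesis
  proof (rule that[of "z \<circ> q"])
    show "finite (range (z \<circ> q))"
      by (rule finite_subset[of _ "z ` {..<n}"]) (use qn in auto)
    show "(z \<circ> q) -` S \<in> sets borel" for S
    proof -
      have "(z \<circ> q) -` S = (\<Union>i\<in>{i. z i \<in> S}. q -` {i})" by auto
      then show ?thesis using q_borel by auto
    qed
    show "norm (F (x, y) - F (x, (z \<circ> q) y)) \<le> e" for x y
      using V(3)[OF qV[of y], of x] by simp
  qed
qed

lemma finite_valued_sum:
  fixes F :: "'a \<times> 'b \<Rightarrow> complex"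
  assumes "finite (range p)"
  shows "F (x, p y) = (\<Sum>z\<in>range p. F (x, z) * indicator (p -` {z}) y)"
proof -
  have "(\<Sum>z\<in>range p. F (x, z) * indicator (p -` {z}) y) = (\<Sum>z\<in>range p. if z = p y then F (x, z) else 0)"
    by (rule sum.cong) (auto simp: indicator_def)
  then show ?thesis using assms by simp
qed

text \<open>Without a countable base, the Borel sets of a product may be more than the product of
  the Borel algebras, so continuity alone does not give measurability. Here \<open>F\<close> is a
  limit of finite sums of functions with separated variables.\<close>

lemma borel_measurable_continuous_prod:
  fixes F :: "'a::t2_space \<times> 'b::t2_space \<Rightarrow> complex"
  assumes "compact (UNIV :: 'a set)" "compact (UNIV :: 'b set)" and F: "continuous_on UNIV F"
  shows "F \<in> borel_measurable (borel \<Otimes>\<^sub>M borel)"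
proof -
  have "\<exists>p. finite (range p) \<and> (\<forall>S. p -` S \<in> sets borel) \<and>
      (\<forall>x y. norm (F (x, y) - F (x, p y)) \<le> 1 / Suc n)" for n
    by (rule finite_valued_approximation[OF assms, of "1 / Suc n"]) auto
  then obtain p where p: "\<And>n::nat. finite (range (p n))" "\<And>n S. p n -` S \<in> sets borel"
    "\<And>n x y. norm (F (x, y) - F (x, p n y)) \<le> 1 / Suc n" by metis
  have sect[measurable]: "(\<lambda>x. F (x, z)) \<in> borel_measurable borel" for z
    by (intro borel_measurable_continuous_onI continuous_on_compose2[OF F] continuous_intros) auto
  show ?thesis
  proof (rule borel_measurable_LIMSEQ_metric)
    fix n
    have [measurable]: "p n -` S \<in> sets borel" for S by (rule p(2))
    have "(\<lambda>w. \<Sum>z\<in>range (p n). F (fst w, z) * indicator (p n -` {z}) (snd w))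
        \<in> borel_measurable (borel \<Otimes>\<^sub>M borel)"
      by measurable
    then show "(\<lambda>w. F (fst w, p n (snd w))) \<in> borel_measurable (borel \<Otimes>\<^sub>M borel)"
      by (subst finite_valued_sum[OF p(1)])
  next
    fix w
    have "(\<lambda>n. norm (F (fst w, p n (snd w)) - F w)) \<longlonglongrightarrow> 0"
    proof (rule Lim_null_comparison)
      show "\<forall>\<^sub>F n in sequentially. norm (norm (F (fst w, p n (snd w)) - F w)) \<le> 1 / Suc n"
        using p(3)[of "fst w" "snd w"] by (simp add: norm_minus_commute)
      show "(\<lambda>n. 1 / real (Suc n)) \<longlonglongrightarrow> 0" by (rule LIMSEQ_Suc[OF lim_const_over_n])
    qed
    then show "(\<lambda>n. F (fst w, p n (snd w))) \<longlonglongrightarrow> F w"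
      by (rule LIM_zero_cancel[OF tendsto_norm_zero_cancel])
  qed
qed

lemma Fubini_continuous:
  fixes F :: "'a::t2_space \<Rightarrow> 'b::t2_space \<Rightarrow> complex"
  assumes "compact (UNIV :: 'a set)" "compact (UNIV :: 'b set)"
    and F: "continuous_on UNIV (\<lambda>z. F (fst z) (snd z))"
    and M: "finite_measure M" "sets M = sets borel"
    and N: "finite_measure N" "sets N = sets borel"
  shows "(\<integral>y. (\<integral>x. F x y \<partial>M) \<partial>N) = (\<integral>x. (\<integral>y. F x y \<partial>N) \<partial>M)"
proof -
  interpret M: finite_measure M by fact
  interpret N: finite_measure N by fact
  interpret pair_sigma_finite M N ..
  interpret MN: finite_measure "M \<Otimes>\<^sub>M N"
    by (rule finite_measure_pair_measure[OF N(1) M(1)])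
  have "case_prod F \<in> borel_measurable (borel \<Otimes>\<^sub>M borel)"
    using borel_measurable_continuous_prod[OF assms(1-3)] by (simp add: case_prod_beta')
  moreover have "sets (M \<Otimes>\<^sub>M N) = sets (borel \<Otimes>\<^sub>M borel)"
    by (rule sets_pair_measure_cong[OF M(2) N(2)])
  ultimately have meas: "case_prod F \<in> borel_measurable (M \<Otimes>\<^sub>M N)"
    using measurable_cong_sets by blast
  have "compact (UNIV :: ('a \<times> 'b) set)"
    using compact_Times[OF assms(1,2)] by simp
  then have "bounded (range (\<lambda>z. F (fst z) (snd z)))"
    using compact_continuous_image[OF F] compact_imp_bounded by blast
  then obtain B where "\<And>z. norm (F (fst z) (snd z)) \<le> B" by (auto simp: bounded_iff)
  then have "integrable (M \<Otimes>\<^sub>M N) (case_prod F)"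
    using meas by (intro MN.integrable_const_bound[of _ B]) (auto simp: case_prod_beta')
  then show ?thesis by (rule Fubini_integral)
qed

text \<open>Replacing \<open>y\<close> by \<open>p y\<close> turns the integral into a finite
  combination of sections of \<open>F\<close>, uniformly in \<open>x\<close>; \<open>A\<close>
  contains these combinations and is closed.\<close>

lemma (in uniform_algebra) integral_mem:
  fixes F :: "'a \<Rightarrow> 'b::t2_space \<Rightarrow> complex"
  assumes comp: "compact (UNIV :: 'b set)" and F: "continuous_on UNIV (\<lambda>z. F (fst z) (snd z))"
    and mem: "\<And>y. (\<lambda>x. F x y) \<in> A"
    and M: "finite_measure M" "sets M = sets borel"
  shows "(\<lambda>x. \<integral>y. F x y \<partial>M) \<in> A"
proof (rule approx_mem)
  fix e :: real assume e: "0 < e"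
  interpret finite_measure M by fact
  have space: "space M = UNIV" using sets_eq_imp_space_eq[OF M(2)] by simp
  define d where "d = e / (1 + measure M UNIV)"
  have pos: "0 < 1 + measure M UNIV" by (simp add: add_pos_nonneg)
  then have d: "0 < d" using e by (simp add: d_def)
  obtain p where p: "finite (range p)" "\<And>S. p -` S \<in> sets borel"
    "\<And>x y. norm (F x y - F x (p y)) \<le> d"
    using finite_valued_approximation[OF compact_space comp F d] by auto
  define g where "g = (\<lambda>x. \<Sum>z\<in>range p. of_real (measure M (p -` {z})) * F x z)"
  have "g \<in> A" unfolding g_def by (intro sum_mem scale_mem mem)
  moreover have "norm ((\<integral>y. F x y \<partial>M) - g x) \<le> e" for x
  proof -
    have sum: "F x (p y) = (\<Sum>z\<in>range p. F x z * indicator (p -` {z}) y)" for y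
      using finite_valued_sum[OF p(1), of "\<lambda>z. F (fst z) (snd z)"] by simp
    have ind: "has_bochner_integral M (\<lambda>y. F x z * indicator (p -` {z}) y)
        (of_real (measure M (p -` {z})) * F x z)" for z
    proof -
      have "(\<lambda>y. F x z * indicator (p -` {z}) y) = (\<lambda>y. indicator (p -` {z}) y *\<^sub>R F x z)"
        by (auto simp: indicator_def)
      then show ?thesis
        using has_bochner_integral_indicator[of "p -` {z}" M "F x z"] p(2)[of "{z}"] M(2)
        by (simp add: emeasure_eq_measure scaleR_conv_of_real)
    qed
    note int_ind = integrable.intros[OF ind]
    have int1: "integrable M (\<lambda>y. F x y)"
      by (intro integrable_continuous_compact[OF comp M] continuous_on_compose2[OF F, of _ "\<lambda>y. (x, y)", simplified]
          continuous_intros)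
    have int2: "integrable M (\<lambda>y. F x (p y))"
      unfolding sum using int_ind by (intro Bochner_Integration.integrable_sum)
    have "(\<integral>y. F x (p y) \<partial>M) = (\<Sum>z\<in>range p. (\<integral>y. F x z * indicator (p -` {z}) y \<partial>M))"
      unfolding sum using int_ind by (intro Bochner_Integration.integral_sum)
    also have "\<dots> = g x"
      unfolding g_def by (simp only: has_bochner_integral_integral_eq[OF ind])
    finally have "(\<integral>y. F x y \<partial>M) - g x = (\<integral>y. F x y - F x (p y) \<partial>M)"
      using int1 int2 by simp
    also have "norm \<dots> \<le> (\<integral>y. norm (F x y - F x (p y)) \<partial>M)" by (rule integral_norm_bound)
    also have "\<dots> \<le> (\<integral>y. d \<partial>M)" using int1 int2 p(3) by (intro integral_mono) auto
    also have "\<dots> \<le> e" using e pos by (simp add: space d_def field_simps)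
    finally show ?thesis .
  qed
  ultimately show "\<exists>g\<in>A. \<forall>x. norm ((\<integral>y. F x y \<partial>M) - g x) \<le> e" by blast
qed

text \<open>With this algebra, \<open>integral_mem\<close> becomes the continuity of integrals
  depending on a parameter.\<close>

lemma uniform_algebra_continuous:
  assumes "compact (UNIV :: 'a::t2_space set)"
  shows "uniform_algebra {f :: 'a \<Rightarrow> complex. continuous_on UNIV f}"
proof
  show "f \<in> {f :: 'a \<Rightarrow> complex. continuous_on UNIV f}"
    if "\<And>n::nat. F n \<in> {f. continuous_on UNIV f}" "uniform_limit UNIV F f sequentially" for F f
    using uniform_limit_theorem[OF _ that(2)] that(1) by simp
qed (use assms in \<open>auto intro: continuous_intros\<close>)

lemma continuous_on_integral:
  fixes F :: "'a::t2_space \<Rightarrow> 'b::t2_space \<Rightarrow> complex"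
  assumes "compact (UNIV :: 'a set)" "compact (UNIV :: 'b set)"
    and F: "continuous_on UNIV (\<lambda>z. F (fst z) (snd z))"
    and "finite_measure M" "sets M = sets borel"
  shows "continuous_on UNIV (\<lambda>x. \<integral>y. F x y \<partial>M)"
proof -
  have "continuous_on UNIV (\<lambda>x. F x y)" for y
  proof -
    have "continuous_on UNIV (\<lambda>x. (x, y))" by (intro continuous_intros)
    from continuous_on_compose2[OF F this] show ?thesis by simp
  qed
  then show ?thesis
    using uniform_algebra.integral_mem[OF uniform_algebra_continuous[OF assms(1)] assms(2,3) _ assms(4,5)]
    by auto
qed

section \<open>Bishop's theorem\<close>

context uniform_algebra
begin

text \<open>Zorn's lemma for closed sets under reverse inclusion. For each \<open>g\<close>, the
  points with error at least \<open>e\<close> form a compact set meeting every member of a chain,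
  hence also the intersection; the error bound is non-strict to make this set closed.\<close>

lemma closed_approx_minimal_exists:
  assumes f: "continuous_on UNIV f"
    and bad: "\<And>g. g \<in> A \<Longrightarrow> \<exists>x. e \<le> norm (f x - g x)"
  obtains E where "closed E" "\<And>g. g \<in> A \<Longrightarrow> \<exists>x\<in>E. e \<le> norm (f x - g x)"
    "\<And>F. closed F \<Longrightarrow> F \<subset> E \<Longrightarrow> \<exists>g\<in>A. \<forall>x\<in>F. norm (f x - g x) < e"
proof -
  define Q where "Q = {E. closed E \<and> (\<forall>g\<in>A. \<exists>x\<in>E. e \<le> norm (f x - g x))}"
  define P where "P = (\<lambda>E F :: 'a set. F \<subseteq> E)"
  have "\<exists>m\<in>Q. \<forall>a\<in>Q. P m a \<longrightarrow> a = m"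
  proof (rule predicate_Zorn)
    show "partial_order_on Q (relation_of P Q)"
      by (rule partial_order_on_relation_ofI) (auto simp: P_def)
    fix C assume C: "C \<in> Chains (relation_of P Q)"
    have CQ: "E \<in> Q" if "E \<in> C" for E
      using C that by (auto simp: Chains_def relation_of_def)
    have Ch: "E \<subseteq> F \<or> F \<subseteq> E" if "E \<in> C" "F \<in> C" for E F
      using C that by (auto simp: Chains_def relation_of_def P_def)
    have fin: "\<Inter>D \<in> C" if "finite D" "D \<noteq> {}" "D \<subseteq> C" for D
      using that
    proof (induction D rule: finite_ne_induct)
      case (insert E D)
      then have "\<Inter>D \<in> C" "E \<in> C" by auto
      then show ?case using Ch[of E "\<Inter>D"] by (auto simp: Int_absorb1 Int_absorb2)
    qed auto
    have "\<exists>x\<in>\<Inter>C. e \<le> norm (f x - g x)" if g: "g \<in> A" for g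
    proof -
      define K where "K = {x. e \<le> norm (f x - g x)}"
      have "closed K"
        unfolding K_def by (intro closed_Collect_le continuous_intros f cont[OF g])
      then have K: "compact K" using compact_Int_closed[OF compact_space, of K] by simp
      have "K \<inter> \<Inter>C \<noteq> {}"
      proof (rule compact_imp_fip[OF K])
        show "closed E" if "E \<in> C" for E using CQ[OF that] by (simp add: Q_def)
        show "K \<inter> \<Inter>D \<noteq> {}" if "finite D" "D \<subseteq> C" for D
        proof (cases "D = {}")
          case True
          then show ?thesis using bad[OF g] by (auto simp: K_def)
        next
          case False
          then have "\<Inter>D \<in> Q" using fin that CQ by blast
          then show ?thesis using g by (auto simp: Q_def K_def)
        qed
      qed
      then show ?thesis by (auto simp: K_def)
    qed
    moreover have "closed (\<Inter>C)" using CQ by (auto simp: Q_def)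
    ultimately show "\<exists>u\<in>Q. \<forall>a\<in>C. P a u"
      by (intro bexI[of _ "\<Inter>C"]) (auto simp: Q_def P_def)
  qed
  then obtain E where E: "E \<in> Q" "\<And>F. F \<in> Q \<Longrightarrow> F \<subseteq> E \<Longrightarrow> F = E"
    by (auto simp: P_def)
  show ?thesis
  proof (rule that)
    show "\<exists>g\<in>A. \<forall>x\<in>F. norm (f x - g x) < e" if "closed F" "F \<subset> E" for F
      using E(2)[of F] that by (force simp: Q_def not_le)
  qed (use E(1) in \<open>auto simp: Q_def\<close>)
qed

text \<open>The polynomials \<open>(1 - t^n)^(2^n)\<close> separate \<open>t < 1/2\<close> from \<open>t > 1/2\<close>.\<close>

lemma switch_bounds:
  fixes t :: real and n :: nat
  assumes t: "0 \<le> t" "t \<le> 1"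
  defines "k \<equiv> (1 - t ^ n) ^ (2 ^ n)"
  shows "0 \<le> k" "k \<le> 1" "t \<le> 1/3 \<Longrightarrow> 1 - k \<le> (3/4) ^ n" "2/3 \<le> t \<Longrightarrow> k \<le> (3/4) ^ n"
proof -
  have tn: "0 \<le> t ^ n" "t ^ n \<le> 1" using t by (auto simp: power_le_one)
  show k: "0 \<le> k" "k \<le> 1" using tn by (auto simp: k_def power_le_one)
  show "1 - k \<le> (3/4) ^ n" if "t \<le> 1/3"
  proof -
    have "1 - 2 ^ n * t ^ n \<le> k"
      using Bernoulli_inequality[of "- (t ^ n)" "2 ^ n"] tn by (simp add: k_def)
    then have "1 - k \<le> (2 * t) ^ n" by (simp add: power_mult_distrib)
    \<comment> \<open>Here \<open>2 * t \<le> 2/3\<close>; the weaker ratio 3/4 is the one that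
      \<open>2 * t \<ge> 4/3\<close> yields in the other case.\<close>
    also have "\<dots> \<le> (3/4) ^ n" using that t by (intro power_mono) auto
    finally show ?thesis .
  qed
  show "k \<le> (3/4) ^ n" if "2/3 \<le> t"
  proof -
    have "2 ^ n * t ^ n \<le> (1 + t ^ n) ^ (2 ^ n)"
      using Bernoulli_inequality[of "t ^ n" "2 ^ n"] tn by simp
    \<comment> \<open>Bernoulli bounds \<open>(2 * t) ^ n\<close> by a power whose product with
      \<open>k\<close> is at most 1.\<close>
    then have "k * (2 * t) ^ n \<le> k * (1 + t ^ n) ^ (2 ^ n)"
      using k by (simp add: power_mult_distrib mult_left_mono)
    also have "\<dots> = (1 - t ^ n * t ^ n) ^ (2 ^ n)"
      unfolding k_def power_mult_distrib[symmetric] by (simp add: algebra_simps)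
    also have "\<dots> \<le> 1" using tn by (intro power_le_one) (auto simp: mult_le_one)
    finally have "k * (2 * t) ^ n \<le> 1" .
    moreover have "k * (4/3) ^ n \<le> k * (2 * t) ^ n"
      using that k by (intro mult_left_mono power_mono) auto
    ultimately have "k * (4/3) ^ n \<le> 1" by linarith
    then show ?thesis by (simp add: power_divide field_simps)
  qed
qed

text \<open>Ransford's proof of Machado's theorem: a minimal closed set on which \<open>f\<close> is not approximable
  within \<open>e\<close> is a set of antisymmetry.\<close>

lemma minimal_nonapproximable_antisymmetric:
  assumes f: "continuous_on UNIV f" and E: "closed E"
    and bad: "\<And>g. g \<in> A \<Longrightarrow> \<exists>x\<in>E. e \<le> norm (f x - g x)"
    and minimal: "\<And>F. closed F \<Longrightarrow> F \<subset> E \<Longrightarrow> \<exists>g\<in>A. \<forall>x\<in>F. norm (f x - g x) < e"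
  shows "antisymmetry_set A E"
  unfolding antisymmetry_set_def
proof (intro ballI impI, rule ccontr)
  fix h assume h: "h \<in> A" "\<forall>x\<in>E. h x \<in> \<real>" and nonconst: "\<not> h constant_on E"
  have cE: "compact E" using compact_Int_closed[OF compact_space E] by simp
  have neE: "E \<noteq> {}" using nonconst by (auto simp: constant_on_def)
  have Reh: "continuous_on E (\<lambda>x. Re (h x))"
    using continuous_on_subset[OF cont[OF h(1)]] by (intro continuous_intros) auto
  obtain a where a: "a \<in> E" "\<And>x. x \<in> E \<Longrightarrow> Re (h a) \<le> Re (h x)"
    using continuous_attains_inf[OF cE neE Reh] by blast
  obtain b where b: "b \<in> E" "\<And>x. x \<in> E \<Longrightarrow> Re (h x) \<le> Re (h b)"
    using continuous_attains_sup[OF cE neE Reh] by blast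
  have "Re (h a) \<noteq> Re (h b)"
  proof
    assume "Re (h a) = Re (h b)"
    then have "h x = h a" if "x \<in> E" for x
      using a(2)[OF that] b(2)[OF that] h(2) that a(1) by (auto simp: complex_is_Real_iff complex_eq_iff)
    then show False using nonconst by (auto simp: constant_on_def)
  qed
  then have ab: "Re (h a) < Re (h b)" using a(2)[OF b(1)] by simp
  define t where "t = (\<lambda>x. (Re (h x) - Re (h a)) / (Re (h b) - Re (h a)))"
  \<comment> \<open>\<open>u\<close> lies in \<open>A\<close> but equals the real function
    \<open>t\<close> only on \<open>E\<close>, where the error is to be estimated.\<close>
  define u where "u = (\<lambda>x. (1 / of_real (Re (h b) - Re (h a))) * (h x - of_real (Re (h a))))"
  have u: "u \<in> A" unfolding u_def by (intro scale_mem diff_mem const_mem h)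
  have ut: "u x = of_real (t x)" if "x \<in> E" for x
    using h(2) that by (auto simp: u_def t_def complex_is_Real_iff complex_eq_iff)
  have t01: "0 \<le> t x" "t x \<le> 1" if "x \<in> E" for x
    using a(2)[OF that] b(2)[OF that] ab by (auto simp: t_def)
  have tc: "continuous_on UNIV t"
    unfolding t_def using ab cont[OF h(1)] by (intro continuous_intros) auto
  have tab: "t a = 0" "t b = 1" using ab by (auto simp: t_def)
  \<comment> \<open>Each set misses an extremal point of \<open>t\<close>, hence is a proper subset
    to which minimality applies. They overlap where \<open>t\<close> is between 1/3 and 2/3, the
    range in which the switching polynomial is not controlled.\<close>
  define E1 E2 where "E1 = E \<inter> {x. t x \<le> 2/3}" and "E2 = E \<inter> {x. 1/3 \<le> t x}"
  have "closed E1" "closed E2"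
    unfolding E1_def E2_def using E tc by (auto intro!: closed_Int closed_Collect_le continuous_intros)
  moreover have "b \<notin> E1" "a \<notin> E2" using tab by (auto simp: E1_def E2_def)
  then have "E1 \<subset> E" "E2 \<subset> E" using a(1) b(1) by (auto simp: E1_def E2_def)
  ultimately obtain g1 g2 where g: "g1 \<in> A" "g2 \<in> A"
    "\<And>x. x \<in> E1 \<Longrightarrow> norm (f x - g1 x) < e" "\<And>x. x \<in> E2 \<Longrightarrow> norm (f x - g2 x) < e"
    using minimal by metis
  \<comment> \<open>Compactness turns the strict bound into a gap below \<open>e\<close>, which
    absorbs the error \<open>(3/4) ^ n * B\<close> of switching.\<close>
  have sup: "\<exists>d<e. \<forall>x\<in>F. norm (f x - g x) \<le> d"
    if "closed F" "F \<noteq> {}" "g \<in> A" "\<And>x. x \<in> F \<Longrightarrow> norm (f x - g x) < e" for F g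
  proof -
    have "compact F" using compact_Int_closed[OF compact_space that(1)] by simp
    moreover have "continuous_on F (\<lambda>x. norm (f x - g x))"
      using continuous_on_subset[OF f] continuous_on_subset[OF cont[OF that(3)]]
      by (intro continuous_intros) auto
    ultimately show ?thesis using continuous_attains_sup[OF _ that(2)] that(4) by blast
  qed
  have "E1 \<noteq> {}" "E2 \<noteq> {}" using a(1) b(1) tab by (auto simp: E1_def E2_def)
  then obtain d1 d2 where "d1 < e" "\<And>x. x \<in> E1 \<Longrightarrow> norm (f x - g1 x) \<le> d1"
    "d2 < e" "\<And>x. x \<in> E2 \<Longrightarrow> norm (f x - g2 x) \<le> d2"
    using sup[OF \<open>closed E1\<close> _ g(1,3)] sup[OF \<open>closed E2\<close> _ g(2,4)] by metis
  then obtain d where d: "d < e" "\<And>x. x \<in> E1 \<Longrightarrow> norm (f x - g1 x) \<le> d"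
    "\<And>x. x \<in> E2 \<Longrightarrow> norm (f x - g2 x) \<le> d"
    by (intro that[of "max d1 d2"]) force+
  have "\<exists>B. \<forall>x. norm (f x - g x) \<le> B" if "g \<in> A" for g
  proof -
    have "continuous_on UNIV (\<lambda>x. f x - g x)" using f cont[OF that] by (intro continuous_intros)
    from compact_imp_bounded[OF compact_continuous_image[OF this compact_space]]
    show ?thesis by (auto simp: bounded_iff)
  qed
  then obtain B1 B2 where "\<And>x. norm (f x - g1 x) \<le> B1" "\<And>x. norm (f x - g2 x) \<le> B2"
    using g(1,2) by metis
  then obtain B where B: "\<And>x. norm (f x - g1 x) \<le> B" "\<And>x. norm (f x - g2 x) \<le> B"
    by (intro that[of "max B1 B2"]) (auto intro: le_max_iff_disj[THEN iffD2])
  have B0: "0 \<le> B" using B(1)[of a] norm_ge_zero order_trans by blast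
  have "(\<lambda>n. d + (3/4) ^ n * B) \<longlonglongrightarrow> d + 0 * B"
    by (intro tendsto_intros LIMSEQ_realpow_zero) auto
  then have "\<forall>\<^sub>F n in sequentially. d + (3/4) ^ n * B < e"
    using d(1) by (intro order_tendstoD) auto
  then obtain n where n: "d + (3/4) ^ n * B < e" by (auto simp: eventually_sequentially)
  define k where "k = (\<lambda>x. (1 - t x ^ n) ^ (2 ^ n))"
  \<comment> \<open>On \<open>E\<close> this is a convex combination, nearly \<open>g1\<close> for
    small \<open>t\<close> and nearly \<open>g2\<close> for large \<open>t\<close>; on the overlap
    any convex combination is good.\<close>
  define g where "g = (\<lambda>x. (1 - u x ^ n) ^ (2 ^ n) * (g1 x - g2 x) + g2 x)"
  have "g \<in> A"
    unfolding g_def by (intro add_mem mult_mem diff_mem power_mem const_mem u \<open>g1 \<in> A\<close> \<open>g2 \<in> A\<close>)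
  then obtain x where x: "x \<in> E" "e \<le> norm (f x - g x)" using bad by blast
  have k: "0 \<le> k x" "k x \<le> 1" "t x \<le> 1/3 \<Longrightarrow> 1 - k x \<le> (3/4) ^ n"
    "2/3 \<le> t x \<Longrightarrow> k x \<le> (3/4) ^ n"
    unfolding k_def using switch_bounds[OF t01[OF x(1)]] by auto
  have "(1 - u x ^ n) ^ (2 ^ n) = of_real (k x)" by (simp add: ut[OF x(1)] k_def)
  then have "f x - g x = of_real (k x) * (f x - g1 x) + of_real (1 - k x) * (f x - g2 x)"
    by (simp add: g_def algebra_simps)
  then have "norm (f x - g x) \<le> k x * norm (f x - g1 x) + (1 - k x) * norm (f x - g2 x)"
    using k(1,2) norm_triangle_ineq[of "of_real (k x) * (f x - g1 x)" "of_real (1 - k x) * (f x - g2 x)"]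
    by (simp add: norm_mult del: of_real_diff)
  also have "\<dots> < e"
  proof (cases "t x \<le> 1/3 \<or> 2/3 \<le> t x")
    case False
    then have "k x * norm (f x - g1 x) + (1 - k x) * norm (f x - g2 x) \<le> k x * d + (1 - k x) * d"
      using d(2)[of x] d(3)[of x] x(1) k(1,2) by (intro add_mono mult_left_mono) (auto simp: E1_def E2_def)
    also have "\<dots> = d" by (simp add: algebra_simps)
    finally show ?thesis using d(1) by simp
  next
    case True
    have "0 \<le> d" using order_trans[OF norm_ge_zero d(2)[of a]] a(1) tab by (simp add: E1_def)
    from True have "k x * norm (f x - g1 x) + (1 - k x) * norm (f x - g2 x) \<le> d + (3/4) ^ n * B"
    proof
      assume t: "t x \<le> 1/3"
      have "k x * norm (f x - g1 x) + (1 - k x) * norm (f x - g2 x) \<le> 1 * d + (3/4) ^ n * B"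
        using d(2)[of x] x(1) t k B0 B(2)[of x]
        by (intro add_mono mult_mono) (auto simp: E1_def)
      then show ?thesis by simp
    next
      assume t: "2/3 \<le> t x"
      have "k x * norm (f x - g1 x) + (1 - k x) * norm (f x - g2 x) \<le> (3/4) ^ n * B + 1 * d"
        using d(3)[of x] x(1) t k B0 B(1)[of x]
        by (intro add_mono mult_mono) (auto simp: E2_def)
      then show ?thesis by simp
    qed
    with n show ?thesis by simp
  qed
  finally show False using x(2) by simp
qed

text \<open>Were \<open>f\<close> not approximable, a minimal bad set would be a set of
  antisymmetry. There \<open>f\<close> is constant, and the constants belong to
  \<open>A\<close>.\<close>

theorem bishop:
  assumes f: "continuous_on UNIV f"
    and const: "\<And>E. closed E \<Longrightarrow> antisymmetry_set A E \<Longrightarrow> f constant_on E"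
  shows "f \<in> A"
proof (rule approx_mem, rule ccontr)
  fix e :: real assume e: "0 < e" and "\<not> (\<exists>g\<in>A. \<forall>x. norm (f x - g x) \<le> e)"
  then have "\<exists>x. e \<le> norm (f x - g x)" if "g \<in> A" for g using that by (meson less_imp_le not_le)
  then obtain E where E: "closed E" "\<And>g. g \<in> A \<Longrightarrow> \<exists>x\<in>E. e \<le> norm (f x - g x)"
    "\<And>F. closed F \<Longrightarrow> F \<subset> E \<Longrightarrow> \<exists>g\<in>A. \<forall>x\<in>F. norm (f x - g x) < e"
    using closed_approx_minimal_exists[OF f] by blast
  then have "f constant_on E"
    using const minimal_nonapproximable_antisymmetric[OF f] by blast
  then obtain c where "\<And>x. x \<in> E \<Longrightarrow> f x = c" by (auto simp: constant_on_def)
  then show False using E(2)[OF const_mem[of c]] e by force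
qed

end

section \<open>Haar measure on a closed subgroup\<close>

context compact_group
begin

lemma carrier_simp [simp]: "x \<in> carrier G"
  using carrier_UNIV by simp

lemma continuous_on_group_mult:
  "continuous_on S f \<Longrightarrow> continuous_on S g \<Longrightarrow> continuous_on S (\<lambda>x. f x \<otimes> g x)"
  using continuous_on_compose2[OF continuous_mult, of S "\<lambda>x. (f x, g x)"]
  by (auto intro: continuous_on_Pair)

lemma continuous_on_m_inv: "continuous_on S f \<Longrightarrow> continuous_on S (\<lambda>x. inv (f x))"
  using continuous_on_compose2[OF continuous_inv, of S f] by auto

lemma continuous_on_after:
  "continuous_on UNIV f \<Longrightarrow> continuous_on S g \<Longrightarrow> continuous_on S (\<lambda>x. f (g x))"
  by (rule continuous_on_compose2[of UNIV f]) auto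

lemmas group_continuous_intros = continuous_on_group_mult continuous_on_m_inv continuous_intros

text \<open>These are operators rather than averaged functions because linearity arguments apply one
  average to several functions. Averaging on the right commutes with left translations and so
  preserves a left modulus of continuity.\<close>

inductive_set right_averages :: "'a set \<Rightarrow> (('a \<Rightarrow> real) \<Rightarrow> 'a \<Rightarrow> real) set" for N where
  id: "(\<lambda>f. f) \<in> right_averages N"
| step: "T \<in> right_averages N \<Longrightarrow> finite Z \<Longrightarrow> Z \<noteq> {} \<Longrightarrow> Z \<subseteq> N \<Longrightarrow>
    (\<lambda>f x. (\<Sum>z\<in>Z. T f (x \<otimes> z)) / card Z) \<in> right_averages N"

lemma right_averages_comp:
  "S \<in> right_averages N \<Longrightarrow> T \<in> right_averages N \<Longrightarrow> (\<lambda>f. S (T f)) \<in> right_averages N"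
proof (induction rule: right_averages.induct)
  case (step S Z)
  from right_averages.step[OF step(5)[OF step(6)] step(2,3,4)] show ?case .
qed

lemma right_averages_continuous:
  "T \<in> right_averages N \<Longrightarrow> continuous_on UNIV f \<Longrightarrow> continuous_on UNIV (T f)"
proof (induction rule: right_averages.induct)
  case (step T Z)
  have "continuous_on UNIV (T f)" using step by blast
  have "continuous_on UNIV (\<lambda>x. T f (x \<otimes> z))" for z
    by (rule continuous_on_after[OF \<open>continuous_on UNIV (T f)\<close>]) (intro group_continuous_intros)
  then show ?case using step(2,3) by (auto intro!: continuous_intros)
qed auto

lemma right_averages_add:
  "T \<in> right_averages N \<Longrightarrow> T (\<lambda>x. f x + g x) = (\<lambda>x. T f x + T g x)"
  by (induction rule: right_averages.induct) (auto simp: sum.distrib add_divide_distrib)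

lemma right_averages_scale:
  "T \<in> right_averages N \<Longrightarrow> T (\<lambda>x. c * f x) = (\<lambda>x. c * T f x)"
  by (induction rule: right_averages.induct) (auto simp: sum_distrib_left)

lemma right_averages_left_translate:
  "T \<in> right_averages N \<Longrightarrow> T (\<lambda>x. f (a \<otimes> x)) = (\<lambda>x. T f (a \<otimes> x))"
  by (induction rule: right_averages.induct) (auto simp: m_assoc)

lemma average_le:
  fixes u :: "'c \<Rightarrow> real"
  assumes "finite Z" "Z \<noteq> {}" "\<And>z. z \<in> Z \<Longrightarrow> u z \<le> b"
  shows "(\<Sum>z\<in>Z. u z) / card Z \<le> b"
proof -
  have "(\<Sum>z\<in>Z. u z) \<le> card Z * b" using sum_bounded_above[of Z u b] assms by simp
  then show ?thesis using assms by (simp add: card_gt_0_iff divide_le_eq mult.commute)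
qed

lemma right_averages_le:
  assumes N: "subgroup N G"
  shows "T \<in> right_averages N \<Longrightarrow> (\<And>x. x \<in> N \<Longrightarrow> f x \<le> b) \<Longrightarrow> x \<in> N \<Longrightarrow> T f x \<le> b"
proof (induction arbitrary: x rule: right_averages.induct)
  case (step T Z)
  show ?case
    by (rule average_le) (use step subgroup.m_closed[OF N] in auto)
qed

lemma right_averages_abs_le:
  assumes N: "subgroup N G" and T: "T \<in> right_averages N"
    and "\<And>x. x \<in> N \<Longrightarrow> \<bar>f x\<bar> \<le> b" "x \<in> N"
  shows "\<bar>T f x\<bar> \<le> b"
  using right_averages_le[OF N T, of f b x] right_averages_le[OF N T, of "\<lambda>x. - 1 * f x" b x]
    right_averages_scale[OF T, of "- 1" f] assms(3,4) by (force simp: abs_le_iff)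

lemma right_averages_modulus:
  assumes "T \<in> right_averages N" "\<And>x. f (y \<otimes> x) \<le> f x + d"
  shows "T f (y \<otimes> x) \<le> T f x + d"
  using assms
proof (induction arbitrary: x rule: right_averages.induct)
  case (step T Z)
  have "(\<Sum>z\<in>Z. T f (y \<otimes> x \<otimes> z) - T f (x \<otimes> z)) / card Z \<le> d"
    by (rule average_le) (use step in \<open>auto simp: m_assoc algebra_simps\<close>)
  then show ?case by (simp add: sum_subtractf diff_divide_distrib algebra_simps)
qed auto

text \<open>Averaging over \<open>{inv c \<otimes> x\<^sub>0 | c \<in> C}\<close>, where \<open>x\<^sub>0\<close> is a minimum and the \<open>V c\<close> cover \<open>N\<close>, brings
  one of the \<open>card C\<close> summands close to the minimum; as \<open>C\<close> depends only on the modulus of continuity,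
  which averaging preserves, the oscillation decreases by a fixed factor.\<close>

lemma right_averages_small_oscillation:
  assumes N: "subgroup N G" "closed N" and f: "continuous_on UNIV f" and d: "0 < d"
  obtains T where "T \<in> right_averages N" "\<And>x y. x \<in> N \<Longrightarrow> y \<in> N \<Longrightarrow> T f x - T f y \<le> d"
proof -
  have one: "\<one> \<in> N" by (rule subgroup.one_closed[OF N(1)])
  have cN: "compact N" using compact_Int_closed[OF compact_UNIV N(2)] by simp
  have "continuous_on (UNIV \<times> UNIV) (\<lambda>z. f (fst z \<otimes> snd z))"
    by (intro continuous_on_after[OF f] group_continuous_intros)
  from continuous_on_prod_compactE[OF this compact_UNIV UNIV_I[of \<one>], of "d / 2"] d
  obtain V where V: "\<one> \<in> V" "open V"
    "\<forall>y\<in>V \<inter> UNIV. \<forall>x\<in>UNIV. dist (f (fst (y, x) \<otimes> snd (y, x))) (f (fst (\<one>, x) \<otimes> snd (\<one>, x))) \<le> d / 2"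
    by auto
  have fV: "f (y \<otimes> x) \<le> f x + d / 2" if "y \<in> V" for y x
  proof -
    have "dist (f (y \<otimes> x)) (f x) \<le> d / 2" using bspec[OF bspec[OF V(3), of y], of x] that by simp
    then show ?thesis unfolding dist_real_def by linarith
  qed
  have openV: "open {x. x \<otimes> inv c \<in> V}" for c
  proof -
    have "continuous_on UNIV (\<lambda>x. x \<otimes> inv c)" by (intro group_continuous_intros)
    then show ?thesis using open_vimage[OF V(2)] by (auto simp: vimage_def)
  qed
  obtain C where C: "C \<subseteq> N" "finite C" "N \<subseteq> (\<Union>c\<in>C. {x. x \<otimes> inv c \<in> V})"
  proof (rule compactE_image[OF cN, of N "\<lambda>c. {x. x \<otimes> inv c \<in> V}"])
    show "N \<subseteq> (\<Union>c\<in>N. {x. x \<otimes> inv c \<in> V})" using V(1) by (auto intro!: bexI)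
  qed (use openV in auto)
  have C0: "C \<noteq> {}" using C(3) one by auto
  define k where "k = real (card C)"
  have k: "1 \<le> k" using C(2) C0 by (simp add: k_def Suc_le_eq card_gt_0_iff)
  define q where "q = 1 - 1 / k"
  have q: "0 \<le> q" "q < 1" using k by (auto simp: q_def)
  have "bounded (range f)"
    using compact_imp_bounded[OF compact_continuous_image[OF f compact_UNIV]] .
  then obtain B where B: "\<And>x. \<bar>f x\<bar> \<le> B" by (auto simp: bounded_iff)
  \<comment> \<open>One averaging step sends an oscillation bound \<open>b\<close> to
    \<open>d / 2 / k + q * b\<close>. The fixed point of this map is \<open>d / 2\<close>, so the
    excess over it shrinks by \<open>q\<close>; \<open>2 * B\<close> bounds the oscillation at the
    start.\<close>
  have "\<exists>T\<in>right_averages N. \<forall>x\<in>N. \<forall>y\<in>N. T f x - T f y \<le> d / 2 + q ^ j * (2 * B)" for j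
  proof (induction j)
    case 0
    have "f x - f y \<le> d / 2 + q ^ 0 * (2 * B)" for x y
      using B[of x] B[of y] d by (simp add: abs_le_iff)
    then show ?case by (intro bexI[OF _ right_averages.id]) auto
  next
    case (Suc j)
    define b where "b = d / 2 + q ^ j * (2 * B)"
    obtain T where T: "T \<in> right_averages N" "\<And>x y. x \<in> N \<Longrightarrow> y \<in> N \<Longrightarrow> T f x - T f y \<le> b"
      using Suc by (auto simp: b_def)
    define u where "u = T f"
    have "continuous_on N u"
      unfolding u_def using right_averages_continuous[OF T(1) f] continuous_on_subset by blast
    then obtain x0 where x0: "x0 \<in> N" "\<And>x. x \<in> N \<Longrightarrow> u x0 \<le> u x"
      using continuous_attains_inf[OF cN] one by blast
    define Z where "Z = (\<lambda>c. inv c \<otimes> x0) ` C"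
    have inj: "inj_on (\<lambda>c. inv c \<otimes> x0) C"
      by (auto simp: inj_on_def) (metis carrier_simp inv_inv)
    have Z: "finite Z" "Z \<noteq> {}" "Z \<subseteq> N" "real (card Z) = k"
      using C C0 x0(1) subgroup.m_closed[OF N(1)] subgroup.m_inv_closed[OF N(1)] card_image[OF inj]
      by (auto simp: Z_def k_def)
    define S where "S = (\<lambda>f x. (\<Sum>z\<in>Z. T f (x \<otimes> z)) / card Z)"
    have "S \<in> right_averages N"
      unfolding S_def by (rule right_averages.step[OF T(1) Z(1-3)])
    moreover have "S f x - S f y \<le> d / 2 + q ^ Suc j * (2 * B)" if x: "x \<in> N" and y: "y \<in> N" for x y
    proof -
      obtain c where c: "c \<in> C" "x \<otimes> inv c \<in> V" using C(3) x by auto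
      define z0 where "z0 = inv c \<otimes> x0"
      have z0: "z0 \<in> Z" using c by (simp add: Z_def z0_def)
      \<comment> \<open>\<open>x \<otimes> z0\<close> differs from the minimum point
        \<open>x0\<close> by a left factor in \<open>V\<close>.\<close>
      have "u ((x \<otimes> inv c) \<otimes> x0) \<le> u x0 + d / 2"
        unfolding u_def by (rule right_averages_modulus[OF T(1)]) (rule fV[OF c(2)])
      then have 1: "u (x \<otimes> z0) \<le> u x0 + d / 2" by (simp add: z0_def m_assoc)
      have 2: "u (x \<otimes> z) \<le> u x0 + b" if "z \<in> Z" for z
        using T(2)[of "x \<otimes> z" x0] x0(1) x that Z(3) subgroup.m_closed[OF N(1), of x z]
        by (auto simp: u_def)
      have "(\<Sum>z\<in>Z. u (x \<otimes> z)) = u (x \<otimes> z0) + (\<Sum>z\<in>Z - {z0}. u (x \<otimes> z))"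
        using Z(1) z0 by (simp add: sum.remove)
      also have "\<dots> \<le> (u x0 + d / 2) + (k - 1) * (u x0 + b)"
      proof (rule add_mono[OF 1])
        have "(\<Sum>z\<in>Z - {z0}. u (x \<otimes> z)) \<le> real (card (Z - {z0})) * (u x0 + b)"
          using 2 by (intro sum_bounded_above) auto
        also have "real (card (Z - {z0})) = k - 1"
          using Z z0 by (simp add: card_Diff_singleton of_nat_diff card_gt_0_iff Suc_le_eq)
        finally show "(\<Sum>z\<in>Z - {z0}. u (x \<otimes> z)) \<le> (k - 1) * (u x0 + b)" .
      qed
      finally have "S f x \<le> ((u x0 + d / 2) + (k - 1) * (u x0 + b)) / k"
        unfolding S_def Z(4) u_def using k by (intro divide_right_mono) auto
      also have "\<dots> = u x0 + (d / 2 / k + q * b)"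
        using k by (simp add: q_def field_simps)
      also have "d / 2 / k + q * b = d / 2 + q ^ Suc j * (2 * B)"
        using k by (simp add: b_def q_def field_simps)
      finally have "S f x \<le> u x0 + (d / 2 + q ^ Suc j * (2 * B))" .
      moreover have "u x0 \<le> S f y"
      proof -
        have "(\<Sum>z\<in>Z. - u (y \<otimes> z)) / card Z \<le> - u x0"
          using Z x0(2) y subgroup.m_closed[OF N(1), of y] by (intro average_le) auto
        then show ?thesis by (simp add: S_def u_def sum_negf)
      qed
      ultimately show ?thesis by simp
    qed
    ultimately show ?case by blast
  qed
  moreover obtain j where "q ^ j * (2 * B) < d / 2"
  proof -
    have "(\<lambda>j. q ^ j * (2 * B)) \<longlonglongrightarrow> 0 * (2 * B)"
      using q by (intro tendsto_intros LIMSEQ_realpow_zero) auto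
    then have "\<forall>\<^sub>F j in sequentially. q ^ j * (2 * B) < d / 2"
      using d by (intro order_tendstoD) auto
    then show ?thesis using that by (auto simp: eventually_sequentially)
  qed
  ultimately show ?thesis using that by (metis add_less_cancel_left field_sum_of_halves less_imp_le order_trans)
qed

text \<open>\<open>W\<close> consists of the functions that averaging can make small on
  \<open>N\<close>. None of them lies below a negative constant, since averages keep such a bound,
  so the zero functional on \<open>W\<close> is dominated by the supremum and extends to a
  probability measure killing \<open>W\<close>. Differences \<open>f - f (n \<otimes> _)\<close> and
  functions vanishing on \<open>N\<close> belong to \<open>W\<close>.\<close>

lemma left_invariant_measure_exists:
  assumes N: "subgroup N G" "closed N"
  obtains m where "prob_space m" "finite_regular_borel m"
    "\<And>(f :: 'a \<Rightarrow> real) n. continuous_on UNIV f \<Longrightarrow> n \<in> N \<Longrightarrow> (\<integral>x. f (n \<otimes> x) \<partial>m) = (\<integral>x. f x \<partial>m)"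
    "\<And>f :: 'a \<Rightarrow> real. continuous_on UNIV f \<Longrightarrow> (\<And>x. x \<in> N \<Longrightarrow> f x = 0) \<Longrightarrow> (\<integral>x. f x \<partial>m) = 0"
proof -
  let ?R = "right_averages N"
  \<comment> \<open>Smallness is demanded after every preliminary \<open>T\<close> to make
    \<open>W\<close> additive: an average found for \<open>u\<close> is followed by one found for
    the already averaged \<open>v\<close>, and averaging never enlarges a bound on
    \<open>N\<close>.\<close>
  define W where "W = {w. continuous_on UNIV w \<and>
    (\<forall>T\<in>?R. \<forall>d>0. \<exists>S\<in>?R. \<forall>x\<in>N. \<bar>S (T w) x\<bar> \<le> d)}"
  have one: "\<one> \<in> N" by (rule subgroup.one_closed[OF N(1)])
  have WD: "\<exists>S\<in>?R. \<forall>x\<in>N. \<bar>S (T w) x\<bar> \<le> d" if "w \<in> W" "T \<in> ?R" "0 < d" for w T d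
    using that by (auto simp: W_def)
  have vanish: "f \<in> W" if "continuous_on UNIV f" "\<And>x. x \<in> N \<Longrightarrow> f x = 0" for f
  proof -
    have "\<exists>S\<in>?R. \<forall>x\<in>N. \<bar>S (T f) x\<bar> \<le> d" if "T \<in> ?R" "0 < d" for T d
      using right_averages_abs_le[OF N(1) that(1), of f d] \<open>\<And>x. x \<in> N \<Longrightarrow> f x = 0\<close> that(2)
      by (intro bexI[OF _ right_averages.id]) auto
    then show ?thesis using that(1) by (auto simp: W_def)
  qed
  have W_add: "(\<lambda>x. u x + v x) \<in> W" if u: "u \<in> W" and v: "v \<in> W" for u v
  proof -
    have "\<exists>S\<in>?R. \<forall>x\<in>N. \<bar>S (T (\<lambda>x. u x + v x)) x\<bar> \<le> d" if T: "T \<in> ?R" and d: "0 < d" for T d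
    proof -
      obtain S1 where S1: "S1 \<in> ?R" "\<And>x. x \<in> N \<Longrightarrow> \<bar>S1 (T u) x\<bar> \<le> d / 2"
        using WD[OF u T half_gt_zero[OF d]] by blast
      obtain S2 where S2: "S2 \<in> ?R" "\<And>x. x \<in> N \<Longrightarrow> \<bar>S2 (S1 (T v)) x\<bar> \<le> d / 2"
        using WD[OF v right_averages_comp[OF S1(1) T] half_gt_zero[OF d]] by blast
      have "\<bar>S2 (S1 (T (\<lambda>x. u x + v x))) x\<bar> \<le> d" if x: "x \<in> N" for x
      proof -
        have "S2 (S1 (T (\<lambda>x. u x + v x))) x = S2 (S1 (T u)) x + S2 (S1 (T v)) x"
          by (simp add: right_averages_add[OF T] right_averages_add[OF S1(1)] right_averages_add[OF S2(1)])
        moreover have "\<bar>S2 (S1 (T u)) x\<bar> \<le> d / 2"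
          by (rule right_averages_abs_le[OF N(1) S2(1) _ x]) (rule S1(2))
        ultimately show ?thesis using S2(2)[OF x] by linarith
      qed
      then show ?thesis by (intro bexI[OF _ right_averages_comp[OF S2(1) S1(1)]]) auto
    qed
    then show ?thesis using u v by (auto simp: W_def intro!: continuous_intros)
  qed
  have W_scale: "(\<lambda>x. c * u x) \<in> W" if u: "u \<in> W" for c u
  proof -
    have "\<exists>S\<in>?R. \<forall>x\<in>N. \<bar>S (T (\<lambda>x. c * u x)) x\<bar> \<le> d" if T: "T \<in> ?R" and d: "0 < d" for T d
    proof -
      have pos: "0 < d / (1 + \<bar>c\<bar>)" using d by (simp add: add_pos_nonneg)
      obtain S where S: "S \<in> ?R" "\<And>x. x \<in> N \<Longrightarrow> \<bar>S (T u) x\<bar> \<le> d / (1 + \<bar>c\<bar>)"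
        using WD[OF u T pos] by blast
      have "\<bar>S (T (\<lambda>x. c * u x)) x\<bar> \<le> d" if x: "x \<in> N" for x
      proof -
        have "\<bar>S (T (\<lambda>x. c * u x)) x\<bar> = \<bar>c\<bar> * \<bar>S (T u) x\<bar>"
          by (simp add: right_averages_scale[OF T] right_averages_scale[OF S(1)] abs_mult)
        also have "\<dots> \<le> (1 + \<bar>c\<bar>) * (d / (1 + \<bar>c\<bar>))"
          using S(2)[OF x] by (intro mult_mono) auto
        also have "\<dots> = d" by (simp add: add_nonneg_eq_0_iff)
        finally show ?thesis .
      qed
      then show ?thesis using S(1) by blast
    qed
    then show ?thesis using u by (auto simp: W_def intro!: continuous_intros)
  qed
  have W_le: "0 \<le> c" if w: "w \<in> W" and le: "\<And>x. w x \<le> c" for w c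
  proof (rule ccontr)
    assume "\<not> 0 \<le> c"
    then have pos: "0 < - c / 2" by simp
    obtain S where S: "S \<in> ?R" "\<And>x. x \<in> N \<Longrightarrow> \<bar>S w x\<bar> \<le> - c / 2"
      using WD[OF w right_averages.id pos] by blast
    have "S w \<one> \<le> c" by (rule right_averages_le[OF N(1) S(1) _ one]) (rule le)
    then show False using S(2)[OF one] \<open>\<not> 0 \<le> c\<close> by linarith
  qed
  obtain m where m: "prob_space m" "finite_regular_borel m" "\<And>w. w \<in> W \<Longrightarrow> integral\<^sup>L m w = 0"
  proof (rule dominated_functional_measure[OF compact_UNIV, of W "\<lambda>_. 0"])
    show "continuous_on UNIV w" if "w \<in> W" for w using that by (simp add: W_def)
    show "(\<lambda>_. 0) \<in> W" by (rule vanish) auto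
  qed (use W_add W_scale W_le in auto)
  have fin: "finite_measure m" "sets m = sets borel" using m(2) by (auto simp: finite_regular_borel_def)
  have "(\<integral>x. f (n \<otimes> x) \<partial>m) = (\<integral>x. f x \<partial>m)" if f: "continuous_on UNIV f" and n: "n \<in> N" for f :: "'a \<Rightarrow> real" and n
  proof -
    have fn: "continuous_on UNIV (\<lambda>x. f (n \<otimes> x))" by (intro continuous_on_after[OF f] group_continuous_intros)
    have "\<exists>S\<in>?R. \<forall>x\<in>N. \<bar>S (T (\<lambda>x. f x + - 1 * f (n \<otimes> x))) x\<bar> \<le> d" if T: "T \<in> ?R" and d: "0 < d" for T d
    proof -
      obtain S where S: "S \<in> ?R" "\<And>x y. x \<in> N \<Longrightarrow> y \<in> N \<Longrightarrow> S (T f) x - S (T f) y \<le> d"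
        using right_averages_small_oscillation[OF N right_averages_continuous[OF T f] d] by blast
      have "\<bar>S (T (\<lambda>x. f x + - 1 * f (n \<otimes> x))) x\<bar> \<le> d" if x: "x \<in> N" for x
      proof -
        have nx: "n \<otimes> x \<in> N" by (rule subgroup.m_closed[OF N(1) n x])
        note lin = right_averages_add right_averages_scale right_averages_left_translate
        have "S (T (\<lambda>x. f x + - 1 * f (n \<otimes> x))) x = S (T f) x + - 1 * S (T f) (n \<otimes> x)"
          by (simp only: lin[OF T] lin[OF S(1)])
        then show ?thesis using S(2)[OF x nx] S(2)[OF nx x] by (simp add: abs_le_iff)
      qed
      then show ?thesis using S(1) by blast
    qed
    then have "(\<lambda>x. f x + - 1 * f (n \<otimes> x)) \<in> W"
      using f fn by (auto simp: W_def intro!: continuous_intros)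
    from m(3)[OF this] show ?thesis
      using integrable_continuous_compact[OF compact_UNIV fin f]
        integrable_continuous_compact[OF compact_UNIV fin fn] by simp
  qed
  then show ?thesis by (rule that[OF m(1,2)]) (use m(3) vanish in auto)
qed

text \<open>The measure lives on the whole group; being carried by \<open>N\<close> is expressed
  through continuous functions vanishing on \<open>N\<close>.\<close>

definition haar_measure_on :: "'a set \<Rightarrow> 'a measure \<Rightarrow> bool" where
  "haar_measure_on N m \<longleftrightarrow> prob_space m \<and> sets m = sets borel \<and>
    (\<forall>f :: 'a \<Rightarrow> complex. continuous_on UNIV f \<longrightarrow>
      (\<forall>n\<in>N. (\<integral>x. f (n \<otimes> x) \<partial>m) = (\<integral>x. f x \<partial>m) \<and> (\<integral>x. f (x \<otimes> n) \<partial>m) = (\<integral>x. f x \<partial>m)) \<and>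
      ((\<forall>x\<in>N. f x = 0) \<longrightarrow> (\<integral>x. f x \<partial>m) = 0))"

text \<open>Convolving a left invariant measure with its image under inversion shows that the two agree.\<close>

theorem haar_measure_on_exists:
  assumes N: "subgroup N G" "closed N"
  obtains m where "haar_measure_on N m"
proof -
  obtain m where m: "prob_space m" "finite_regular_borel m"
    and real_inv: "\<And>(f :: 'a \<Rightarrow> real) n. continuous_on UNIV f \<Longrightarrow> n \<in> N \<Longrightarrow>
      (\<integral>x. f (n \<otimes> x) \<partial>m) = (\<integral>x. f x \<partial>m)"
    and real_zero: "\<And>f :: 'a \<Rightarrow> real. continuous_on UNIV f \<Longrightarrow> (\<And>x. x \<in> N \<Longrightarrow> f x = 0) \<Longrightarrow>
      (\<integral>x. f x \<partial>m) = 0"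
    using left_invariant_measure_exists[OF N] by blast
  interpret m: prob_space m by fact
  have fin: "finite_measure m" "sets m = sets borel" using m(2) by (auto simp: finite_regular_borel_def)
  note int = integrable_continuous_compact[OF compact_UNIV fin]
  have inv: "(\<integral>x. f (n \<otimes> x) \<partial>m) = (\<integral>x. f x \<partial>m)" if f: "continuous_on UNIV f" and n: "n \<in> N"
    for f :: "'a \<Rightarrow> complex" and n
  proof (rule complex_eqI)
    have fn: "continuous_on UNIV (\<lambda>x. f (n \<otimes> x))" by (intro continuous_on_after[OF f] group_continuous_intros)
    show "Re (\<integral>x. f (n \<otimes> x) \<partial>m) = Re (\<integral>x. f x \<partial>m)"
      using real_inv[of "\<lambda>x. Re (f x)", OF _ n] int[OF f] int[OF fn] f by (simp add: continuous_on_Re)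
    show "Im (\<integral>x. f (n \<otimes> x) \<partial>m) = Im (\<integral>x. f x \<partial>m)"
      using real_inv[of "\<lambda>x. Im (f x)", OF _ n] int[OF f] int[OF fn] f by (simp add: continuous_on_Im)
  qed
  have zero: "(\<integral>x. f x \<partial>m) = 0" if f: "continuous_on UNIV f" "\<And>x. x \<in> N \<Longrightarrow> f x = 0"
    for f :: "'a \<Rightarrow> complex"
    using real_zero[of "\<lambda>x. Re (f x)"] real_zero[of "\<lambda>x. Im (f x)"] f int[OF f(1)]
    by (intro complex_eqI) (auto simp: continuous_on_Re continuous_on_Im)
  have const: "(\<integral>x. f x \<partial>m) = c" if f: "continuous_on UNIV f" "\<And>x. x \<in> N \<Longrightarrow> f x = c"
    for f :: "'a \<Rightarrow> complex" and c
  proof -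
    have "continuous_on UNIV (\<lambda>x. f x - c)" using f(1) by (intro continuous_intros)
    from zero[OF this] show ?thesis using f int[OF f(1)] by (simp add: m.prob_space)
  qed
  have inv_closed: "n \<in> N \<Longrightarrow> inv n \<in> N" for n by (rule subgroup.m_inv_closed[OF N(1)])
  have inversion_left: "(\<integral>x. f (inv x \<otimes> n) \<partial>m) = (\<integral>x. f (inv x) \<partial>m)"
    if f: "continuous_on UNIV f" and n: "n \<in> N" for f :: "'a \<Rightarrow> complex" and n
    using inv[OF continuous_on_after[OF f continuous_inv] inv_closed[OF n]]
    by (simp add: inv_mult_group)
  have inversion: "(\<integral>x. f (inv x) \<partial>m) = (\<integral>x. f x \<partial>m)" if f: "continuous_on UNIV f" for f :: "'a \<Rightarrow> complex"
  proof -
    have F: "continuous_on UNIV (\<lambda>z. f (inv (fst z) \<otimes> snd z))" by (intro continuous_on_after[OF f] group_continuous_intros)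
    have F': "continuous_on UNIV (\<lambda>z. f (inv (snd z) \<otimes> fst z))" by (intro continuous_on_after[OF f] group_continuous_intros)
    \<comment> \<open>For \<open>y\<close> in \<open>N\<close> the inner integral does not depend on
      \<open>y\<close>: \<open>f (inv x \<otimes> y)\<close> is a left translate of \<open>f\<close>
      composed with inversion.\<close>
    have "(\<integral>x. f (inv x) \<partial>m) = (\<integral>y. (\<integral>x. f (inv x \<otimes> y) \<partial>m) \<partial>m)"
      by (rule const[symmetric])
        (use continuous_on_integral[OF compact_UNIV compact_UNIV F' fin] inversion_left[OF f] in auto)
    also have "\<dots> = (\<integral>x. (\<integral>y. f (inv x \<otimes> y) \<partial>m) \<partial>m)"
      by (rule Fubini_continuous[OF compact_UNIV compact_UNIV F fin fin])
    also have "\<dots> = (\<integral>x. f x \<partial>m)"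
      by (rule const)
        (use continuous_on_integral[OF compact_UNIV compact_UNIV F fin] inv[OF f inv_closed] in auto)
    finally show ?thesis .
  qed
  have "(\<integral>x. f (x \<otimes> n) \<partial>m) = (\<integral>x. f x \<partial>m)" if f: "continuous_on UNIV f" and n: "n \<in> N"
    for f :: "'a \<Rightarrow> complex" and n
  proof -
    have "continuous_on UNIV (\<lambda>x. f (x \<otimes> n))"
      by (intro continuous_on_after[OF f] group_continuous_intros)
    from inversion[OF this] show ?thesis using inversion_left[OF f n] inversion[OF f] by simp
  qed
  then show ?thesis
    using that[of m] m(1) fin inv zero unfolding haar_measure_on_def by blast
qed

context
  fixes N m assumes haar: "haar_measure_on N m"

\<comment> \<open>Integration rules for the Haar measure of a subgroup\<close>
begin

lemma haar_prob: "prob_space m" "finite_measure m" "sets m = sets borel"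
  using haar by (auto simp: haar_measure_on_def prob_space_def)

lemma haar_integrable: "continuous_on UNIV f \<Longrightarrow> integrable m (f :: 'a \<Rightarrow> complex)"
  by (rule integrable_continuous_compact[OF compact_UNIV haar_prob(2,3)])

lemma haar_left: "continuous_on UNIV f \<Longrightarrow> n \<in> N \<Longrightarrow> (\<integral>x. f (n \<otimes> x) \<partial>m) = (\<integral>x. f x \<partial>m)"
  and haar_right: "continuous_on UNIV f \<Longrightarrow> n \<in> N \<Longrightarrow> (\<integral>x. f (x \<otimes> n) \<partial>m) = (\<integral>x. f x \<partial>m)"
  for f :: "'a \<Rightarrow> complex"
  using haar by (auto simp: haar_measure_on_def)

lemma haar_cong:
  fixes f g :: "'a \<Rightarrow> complex"
  assumes "continuous_on UNIV f" "continuous_on UNIV g" "\<And>x. x \<in> N \<Longrightarrow> f x = g x"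
  shows "(\<integral>x. f x \<partial>m) = (\<integral>x. g x \<partial>m)"
proof -
  have "continuous_on UNIV (\<lambda>x. f x - g x)" "\<forall>x\<in>N. f x - g x = 0"
    using assms by (simp_all add: continuous_on_diff)
  then have "(\<integral>x. f x - g x \<partial>m) = 0"
    using haar unfolding haar_measure_on_def by blast
  then show ?thesis using haar_integrable assms by simp
qed

lemma haar_const:
  fixes f :: "'a \<Rightarrow> complex"
  assumes "continuous_on UNIV f" "\<And>x. x \<in> N \<Longrightarrow> f x = c"
  shows "(\<integral>x. f x \<partial>m) = c"
  using haar_cong[OF assms(1), of "\<lambda>_. c"] assms(2) prob_space.prob_space[OF haar_prob(1)] by simp

end

end

section \<open>The maximal set of antisymmetry containing the identity\<close>

locale invariant_algebra_on = compact_group G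
  for G :: "('a::t2_space, 'b) monoid_scheme" (structure) +
  fixes A :: "('a \<Rightarrow> complex) set"
  assumes invariant: "invariant_algebra G A"
begin

sublocale uniform_algebra A
proof
  show "f \<in> A" if "\<And>n::nat. F n \<in> A" "uniform_limit UNIV F f sequentially" for F f
    using invariant that unfolding invariant_algebra_def by blast
qed (use invariant compact_UNIV in \<open>auto simp: invariant_algebra_def\<close>)

lemma left_mem: "f \<in> A \<Longrightarrow> (\<lambda>x. f (g \<otimes> x)) \<in> A"
  and right_mem: "f \<in> A \<Longrightarrow> (\<lambda>x. f (x \<otimes> g)) \<in> A"
  using invariant by (auto simp: invariant_algebra_def)

lemma antisymmetry_set_image:
  assumes "antisymmetry_set A E" "\<And>f. f \<in> A \<Longrightarrow> (\<lambda>x. f (h x)) \<in> A"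
  shows "antisymmetry_set A (h ` E)"
  unfolding antisymmetry_set_def
proof (intro ballI impI)
  fix f assume "f \<in> A" "\<forall>x\<in>h ` E. f x \<in> \<real>"
  then have "(\<lambda>x. f (h x)) constant_on E" using assms by (auto simp: antisymmetry_set_def)
  then show "f constant_on h ` E" by (auto simp: constant_on_def)
qed

text \<open>A union of sets of antisymmetry with a common point is again one, because the constants
  agree at that point; hence this is the greatest through the identity. It is identified with the
  stabilizer of \<open>\<epsilon>\<close> only at the end.\<close>

definition core :: "'a set" where
  "core = \<Union>{E. antisymmetry_set A E \<and> \<one> \<in> E}"

lemma core_greatest: "antisymmetry_set A E \<Longrightarrow> \<one> \<in> E \<Longrightarrow> E \<subseteq> core"
  by (auto simp: core_def)

lemma antisymmetry_set_core: "antisymmetry_set A core"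
  unfolding antisymmetry_set_def
proof (intro ballI impI)
  fix f assume f: "f \<in> A" "\<forall>x\<in>core. f x \<in> \<real>"
  have "f x = f \<one>" if "x \<in> core" for x
  proof -
    obtain E where E: "antisymmetry_set A E" "\<one> \<in> E" "x \<in> E" using \<open>x \<in> core\<close> by (auto simp: core_def)
    then have "f constant_on E" using f core_greatest[OF E(1,2)] by (auto simp: antisymmetry_set_def)
    then show ?thesis using E by (auto simp: constant_on_def)
  qed
  then show "f constant_on core" by (auto simp: constant_on_def)
qed

lemma one_core: "\<one> \<in> core"
  using core_greatest[of "{\<one>}"] by (auto simp: antisymmetry_set_def constant_on_def)

lemma antisymmetry_set_left: "antisymmetry_set A E \<Longrightarrow> antisymmetry_set A ((\<lambda>x. g \<otimes> x) ` E)"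
  by (erule antisymmetry_set_image) (rule left_mem)

text \<open>Translating \<open>E\<close> by \<open>inv x\<close> brings it through the identity.
  This one fact yields the subgroup law, the shape of the maximal sets, and the constancy of
  invariant functions on sets of antisymmetry.\<close>

lemma antisymmetry_set_subset_coset:
  assumes "antisymmetry_set A E" "x \<in> E" "y \<in> E"
  shows "inv x \<otimes> y \<in> core"
proof -
  have "\<one> \<in> (\<lambda>y. inv x \<otimes> y) ` E" using assms(2) by (auto intro!: image_eqI[of _ _ x])
  then show ?thesis
    using core_greatest[OF antisymmetry_set_left[OF assms(1), of "inv x"]] assms(3) by blast
qed

lemma core_inv_mult: "x \<in> core \<Longrightarrow> y \<in> core \<Longrightarrow> inv x \<otimes> y \<in> core"
  by (rule antisymmetry_set_subset_coset[OF antisymmetry_set_core])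

lemma subgroup_core: "subgroup core G"
proof
  show inv: "inv x \<in> core" if "x \<in> core" for x using core_inv_mult[OF that one_core] by simp
  show "x \<otimes> y \<in> core" if "x \<in> core" "y \<in> core" for x y
    using core_inv_mult[OF inv[OF that(1)] that(2)] by simp
qed (use one_core in auto)

lemma conj_core:
  assumes "n \<in> core" shows "x \<otimes> n \<otimes> inv x \<in> core"
proof -
  have "antisymmetry_set A ((\<lambda>n. x \<otimes> n \<otimes> inv x) ` core)"
    by (rule antisymmetry_set_image[OF antisymmetry_set_core])
      (use right_mem left_mem in \<open>auto simp: m_assoc intro: left_mem[OF right_mem]\<close>)
  moreover have "\<one> \<in> (\<lambda>n. x \<otimes> n \<otimes> inv x) ` core"
    using one_core by (auto intro!: image_eqI[of _ _ \<one>])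
  ultimately show ?thesis using core_greatest assms by blast
qed

lemma normal_core: "core \<lhd> G"
  unfolding normal_inv_iff using subgroup_core conj_core by blast

text \<open>Continuity passes antisymmetry to the closure, and \<open>core\<close> is already the
  greatest such set.\<close>

lemma closed_core: "closed core"
proof -
  have "antisymmetry_set A (closure core)"
    unfolding antisymmetry_set_def
  proof (intro ballI impI)
    fix f assume f: "f \<in> A" "\<forall>x\<in>closure core. f x \<in> \<real>"
    then have "f constant_on core"
      using antisymmetry_set_core subsetD[OF closure_subset, of _ core]
      unfolding antisymmetry_set_def by blast
    then obtain c where "\<And>x. x \<in> core \<Longrightarrow> f x = c" by (auto simp: constant_on_def)
    then have "core \<subseteq> {x. f x = c}" by auto
    moreover have "closed {x. f x = c}"
      by (intro closed_Collect_eq cont f continuous_intros)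
    ultimately have "closure core \<subseteq> {x. f x = c}" by (rule closure_minimal)
    then show "f constant_on closure core" unfolding constant_on_def by blast
  qed
  then have "closure core \<subseteq> core" using core_greatest one_core closure_subset by blast
  then show ?thesis by (metis closure_subset closure_closed subset_antisym closed_closure)
qed

lemma l_coset_image: "g <# S = (\<lambda>x. g \<otimes> x) ` S"
  by (auto simp: l_coset_def)

lemma maximal_antisymmetry_set_iff:
  "maximal_antisymmetry_set A E \<longleftrightarrow> (\<exists>g. E = g <# core)"
proof
  assume E: "maximal_antisymmetry_set A E"
  have "E \<noteq> {}"
    using E antisymmetry_set_core one_core unfolding maximal_antisymmetry_set_def by blast
  then obtain x where x: "x \<in> E" by blast
  have "y \<in> x <# core" if "y \<in> E" for y
    using antisymmetry_set_subset_coset[OF _ x that] E unfolding maximal_antisymmetry_set_def l_coset_image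
    by (auto intro!: image_eqI[of _ _ "inv x \<otimes> y"] simp: m_assoc[symmetric])
  then have "E \<subseteq> x <# core" by blast
  then have "x <# core = E"
    using E antisymmetry_set_left[OF antisymmetry_set_core, of x]
    unfolding maximal_antisymmetry_set_def l_coset_image by blast
  then show "\<exists>g. E = g <# core" by blast
next
  assume "\<exists>g. E = g <# core"
  then obtain g where g: "E = (\<lambda>x. g \<otimes> x) ` core" by (auto simp: l_coset_image)
  have "F = E" if F: "antisymmetry_set A F" "E \<subseteq> F" for F
  proof -
    have "g \<in> F" using F(2) g one_core by (force intro: image_eqI[of _ _ \<one>])
    then have "y \<in> E" if "y \<in> F" for y
      using antisymmetry_set_subset_coset[OF F(1) _ that, of g] unfolding g
      by (auto intro!: image_eqI[of _ _ "inv g \<otimes> y"] simp: m_assoc[symmetric])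
    with F(2) show ?thesis by blast
  qed
  then show "maximal_antisymmetry_set A E"
    using antisymmetry_set_left[OF antisymmetry_set_core, of g] g
    by (auto simp: maximal_antisymmetry_set_def)
qed

text \<open>Every set of antisymmetry lies in one coset of \<open>core\<close>, so an invariant
  function satisfies the hypothesis of \<open>bishop\<close>.\<close>

lemma core_invariant_mem:
  assumes u: "continuous_on UNIV u" "\<And>x n. n \<in> core \<Longrightarrow> u (x \<otimes> n) = u x"
  shows "u \<in> A"
proof (rule bishop[OF u(1)])
  fix E assume E: "antisymmetry_set A E"
  have "u y = u x" if "x \<in> E" "y \<in> E" for x y
    using u(2)[OF antisymmetry_set_subset_coset[OF E that], of x] by (simp add: m_assoc[symmetric])
  then show "u constant_on E" unfolding constant_on_def by (metis (full_types))
qed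

lemma real_mem_invariant:
  assumes f: "f \<in> A" "\<And>x. f x \<in> \<real>" and n: "n \<in> core"
  shows "f (x \<otimes> n) = f x"
proof -
  have "(\<lambda>y. f (x \<otimes> y)) constant_on core"
    using bspec[OF antisymmetry_set_core[unfolded antisymmetry_set_def] left_mem[OF f(1)]] f(2) by simp
  then obtain c where "\<And>n. n \<in> core \<Longrightarrow> f (x \<otimes> n) = c" unfolding constant_on_def by auto
  from this[OF n] this[OF one_core] show ?thesis by simp
qed

lemma real_valued_part_eq:
  "real_valued_part A = {f. continuous_on UNIV f \<and> (\<forall>x. f x \<in> \<real>) \<and>
     (\<forall>g\<in>carrier G. f constant_on (g <# core))}"
proof (intro equalityI subsetI)
  fix f assume "f \<in> real_valued_part A"
  then have f: "f \<in> A" "\<And>x. f x \<in> \<real>" by (auto simp: real_valued_part_def)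
  then have "f constant_on (g <# core)" for g
    using real_mem_invariant[OF f] unfolding constant_on_def l_coset_image by blast
  then show "f \<in> {f. continuous_on UNIV f \<and> (\<forall>x. f x \<in> \<real>) \<and> (\<forall>g\<in>carrier G. f constant_on (g <# core))}"
    using f cont by auto
next
  fix f :: "'a \<Rightarrow> complex"
  assume "f \<in> {f. continuous_on UNIV f \<and> (\<forall>x. f x \<in> \<real>) \<and> (\<forall>g\<in>carrier G. f constant_on (g <# core))}"
  then have f: "continuous_on UNIV f" "\<And>x. f x \<in> \<real>" "\<And>g. f constant_on (g <# core)" by auto
  have "f (x \<otimes> n) = f x" if "n \<in> core" for x n
  proof -
    obtain c where "\<And>n. n \<in> core \<Longrightarrow> f (x \<otimes> n) = c"
      using f(3)[of x] unfolding constant_on_def l_coset_image by auto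
    from this[OF that] this[OF one_core] show ?thesis by simp
  qed
  then show "f \<in> real_valued_part A" using core_invariant_mem[OF f(1)] f(2) by (auto simp: real_valued_part_def)
qed

lemma antisymmetric_algebra_iff_core: "antisymmetric_algebra A \<longleftrightarrow> core = UNIV"
proof
  assume "antisymmetric_algebra A"
  then have "antisymmetry_set A UNIV" by (auto simp: antisymmetric_algebra_def antisymmetry_set_def)
  then show "core = UNIV" using core_greatest[of UNIV] by auto
next
  assume "core = UNIV"
  then show "antisymmetric_algebra A"
    using antisymmetry_set_core by (auto simp: antisymmetric_algebra_def antisymmetry_set_def)
qed

end

context invariant_algebra_on
begin

section \<open>Haar measure is multiplicative on antisymmetric algebras\<close>

text \<open>The Haar measure has full support in \<open>N\<close>: if
  \<open>v \<one> > d > 0\<close>, finitely many translates of \<open>v\<close> have a sum exceeding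
  \<open>d\<close> on \<open>N\<close>, yet each of them has integral 0.\<close>

lemma haar_integral_zero_imp_zero:
  fixes v :: "'a \<Rightarrow> real"
  assumes haar: "haar_measure_on N m" and N: "subgroup N G" "closed N"
    and v: "continuous_on UNIV v" "\<And>x. 0 \<le> v x" and int: "(\<integral>x. v x \<partial>m) = 0"
  shows "v \<one> = 0"
proof (rule ccontr)
  define d where "d = v \<one> / 2"
  assume "v \<one> \<noteq> 0"
  then have d: "0 < d" using v(2)[of \<one>] by (simp add: d_def)
  define U where "U = (\<lambda>c. {x. d < v (inv c \<otimes> x)})"
  have trans: "continuous_on UNIV (\<lambda>x. v (inv c \<otimes> x))" for c
    by (rule continuous_on_after[OF v(1)]) (intro group_continuous_intros)
  have "compact N" using compact_Int_closed[OF compact_UNIV N(2)] by simp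
  then obtain C where C: "C \<subseteq> N" "finite C" "N \<subseteq> (\<Union>c\<in>C. U c)"
  proof (rule compactE_image[of N N U])
    show "open (U c)" for c unfolding U_def using trans by (intro open_Collect_less continuous_intros)
    show "N \<subseteq> (\<Union>c\<in>N. U c)" using d by (auto simp: U_def d_def)
  qed
  define s where "s = (\<lambda>x. \<Sum>c\<in>C. v (inv c \<otimes> x))"
  have s: "continuous_on UNIV s" unfolding s_def using trans by (intro continuous_intros)
  note int_real = integrable_continuous_compact[OF compact_UNIV haar_prob(2,3)[OF haar]]
  have "(\<integral>x. v (inv c \<otimes> x) \<partial>m) = 0" if "c \<in> C" for c
  proof -
    have "inv c \<in> N" using that C(1) subgroup.m_inv_closed[OF N(1)] by auto
    from haar_left[OF haar continuous_on_of_real[OF v(1)] this] int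
    have "complex_of_real (\<integral>x. v (inv c \<otimes> x) \<partial>m) = 0"
      by (simp only: integral_complex_of_real of_real_0)
    then show ?thesis by simp
  qed
  then have int_s: "(\<integral>x. s x \<partial>m) = 0"
    unfolding s_def using int_real[OF trans] by (simp add: Bochner_Integration.integral_sum)
  \<comment> \<open>\<open>haar_const\<close> wants a value attained exactly on \<open>N\<close>, so
    the lower bound \<open>d\<close> is turned into an equality by cutting off.\<close>
  have ms: "continuous_on UNIV (\<lambda>x. min (s x) d)" using s by (intro continuous_intros)
  have "min (s x) d = d" if x: "x \<in> N" for x
  proof -
    obtain c where c: "c \<in> C" "d < v (inv c \<otimes> x)" using C(3) x by (auto simp: U_def)
    have "v (inv c \<otimes> x) \<le> s x"
      unfolding s_def by (rule member_le_sum[OF c(1)]) (use v(2) C(2) in auto)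
    with c(2) show ?thesis by simp
  qed
  then have "(\<integral>x. complex_of_real (min (s x) d) \<partial>m) = of_real d"
    by (intro haar_const[OF haar] continuous_on_of_real ms) simp
  then have "(\<integral>x. min (s x) d \<partial>m) = d"
    unfolding integral_complex_of_real by (simp only: of_real_eq_iff)
  moreover have "(\<integral>x. min (s x) d \<partial>m) \<le> (\<integral>x. s x \<partial>m)"
    by (rule integral_mono[OF int_real[OF ms] int_real[OF s]]) simp
  ultimately show False using int_s d by simp
qed

lemma integral_mem_fst:
  assumes "continuous_on UNIV (\<lambda>z. F (fst z) (snd z))" "\<And>y. (\<lambda>x. F x y) \<in> A"
    and "haar_measure_on N m"
  shows "(\<lambda>x. \<integral>y. F x y \<partial>m) \<in> A"
  by (rule integral_mem[OF compact_UNIV assms(1,2) haar_prob(2,3)[OF assms(3)]])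

text \<open>With \<open>h = \<integral> f(\<cdot> y) g(y) dm(y)\<close>, both \<open>h\<close> and, on \<open>N\<close>, its composition with inversion belong to
  \<open>A\<close>. Hence so do the function \<open>k\<close> of positive type built from \<open>h\<close> and its complex conjugate, and the
  antisymmetry of \<open>N\<close> forces \<open>Re k\<close> to be constant on \<open>N\<close>; its value at the identity is
  \<open>\<integral> |h|\<^sup>2 dm\<close> and its mean is \<open>|\<integral> h dm|\<^sup>2\<close>.\<close>

lemma haar_integral_mult_zero:
  assumes anti: "antisymmetry_set A N" and N: "subgroup N G" "closed N" and haar: "haar_measure_on N m"
    and f: "f \<in> A" and g: "g \<in> A" and zero: "(\<integral>x. f x \<partial>m) = 0"
  shows "(\<integral>x. f x * g x \<partial>m) = 0"
proof -
  note fc = cont[OF f] and gc = cont[OF g]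
  have one: "\<one> \<in> N" by (rule subgroup.one_closed[OF N(1)])
  have invN: "inv x \<in> N" and mN: "x \<otimes> y \<in> N" if "x \<in> N" "y \<in> N" for x y
    using subgroup.m_inv_closed[OF N(1) that(1)] subgroup.m_closed[OF N(1) that] by auto
  note Fubini = Fubini_continuous[OF compact_UNIV compact_UNIV _ haar_prob(2,3)[OF haar] haar_prob(2,3)[OF haar]]
  have prod: "continuous_on UNIV (\<lambda>z. u (p z) * v (q z))"
    if "continuous_on UNIV u" "continuous_on UNIV v" "continuous_on UNIV p" "continuous_on UNIV q"
    for u v :: "'a \<Rightarrow> complex" and p q :: "'c::topological_space \<Rightarrow> 'a"
    using continuous_on_after[OF that(1,3)] continuous_on_after[OF that(2,4)] by (rule continuous_on_mult)
  define h where "h = (\<lambda>x. \<integral>y. f (x \<otimes> y) * g y \<partial>m)"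
  define h' where "h' = (\<lambda>x. \<integral>y. f y * g (x \<otimes> y) \<partial>m)"
  have hF: "continuous_on UNIV (\<lambda>z. f (fst z \<otimes> snd z) * g (snd z))"
    by (rule prod[OF fc gc]) (intro group_continuous_intros)+
  have h: "h \<in> A"
    unfolding h_def
  proof (rule integral_mem_fst[OF hF _ haar])
    show "(\<lambda>x. f (x \<otimes> y) * g y) \<in> A" for y
      using scale_mem[OF right_mem[OF f], of "g y" y] by (simp add: mult.commute)
  qed
  have h': "h' \<in> A"
    unfolding h'_def
  proof (rule integral_mem_fst[OF _ _ haar])
    show "continuous_on UNIV (\<lambda>z. f (snd z) * g (fst z \<otimes> snd z))"
      by (rule prod[OF fc gc]) (intro group_continuous_intros)+
    show "(\<lambda>x. f y * g (x \<otimes> y)) \<in> A" for y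
      by (rule scale_mem[OF right_mem[OF g]])
  qed
  note hc = cont[OF h] and h'c = cont[OF h']
  \<comment> \<open>Substituting \<open>x \<otimes> y\<close> for \<open>y\<close> moves the
    translation from \<open>f\<close> to \<open>g\<close>; invariance under \<open>x\<close>
    restricts this to \<open>N\<close>.\<close>
  have h_inv: "h (inv x) = h' x" if x: "x \<in> N" for x
  proof -
    have "continuous_on UNIV (\<lambda>y. f (inv x \<otimes> y) * g y)"
      by (rule prod[OF fc gc]) (intro group_continuous_intros)+
    from haar_left[OF haar this x] show ?thesis by (simp add: h_def h'_def m_assoc[symmetric])
  qed
  \<comment> \<open>In the other order, right invariance makes the inner integral \<open>g y\<close>
    times the mean of \<open>f\<close>.\<close>
  have int_h: "(\<integral>x. h x \<partial>m) = 0"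
  proof -
    have "(\<integral>x. h x \<partial>m) = (\<integral>y. (\<integral>x. f (x \<otimes> y) * g y \<partial>m) \<partial>m)"
      unfolding h_def by (rule Fubini[OF hF, symmetric])
    also have "\<dots> = 0"
    proof (rule haar_const[OF haar])
      have "continuous_on UNIV (\<lambda>z. f (snd z \<otimes> fst z) * g (fst z))"
        by (rule prod[OF fc gc]) (intro group_continuous_intros)+
      from continuous_on_integral[OF compact_UNIV compact_UNIV this haar_prob(2,3)[OF haar]]
      show "continuous_on UNIV (\<lambda>y. \<integral>x. f (x \<otimes> y) * g y \<partial>m)" by simp
      show "(\<integral>x. f (x \<otimes> y) * g y \<partial>m) = 0" if "y \<in> N" for y
        using haar_right[OF haar fc that] zero by simp
    qed
    finally show ?thesis .
  qed
  have cc: "continuous_on UNIV (\<lambda>x. cnj (h x))" by (intro continuous_on_cnj hc)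
  define k where "k = (\<lambda>x. \<integral>y. h (x \<otimes> y) * cnj (h y) \<partial>m)"
  \<comment> \<open>Formally the conjugate of \<open>k\<close>: after the substitution the other
    factor is \<open>h (inv x \<otimes> y)\<close>, the value of \<open>h\<close> at the inverse of
    \<open>inv y \<otimes> x\<close>. Writing it with \<open>h'\<close> makes it a translate in
    \<open>x\<close> of an element of \<open>A\<close>.\<close>
  define k' where "k' = (\<lambda>x. \<integral>y. cnj (h y) * h' (inv y \<otimes> x) \<partial>m)"
  have kF: "continuous_on UNIV (\<lambda>z. h (fst z \<otimes> snd z) * cnj (h (snd z)))"
    by (rule prod[OF hc cc]) (intro group_continuous_intros)+
  have k: "k \<in> A"
    unfolding k_def
  proof (rule integral_mem_fst[OF kF _ haar])
    show "(\<lambda>x. h (x \<otimes> y) * cnj (h y)) \<in> A" for y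
      using scale_mem[OF right_mem[OF h], of "cnj (h y)" y] by (simp add: mult.commute)
  qed
  have k': "k' \<in> A"
    unfolding k'_def
  proof (rule integral_mem_fst[OF _ _ haar])
    show "continuous_on UNIV (\<lambda>z. cnj (h (snd z)) * h' (inv (snd z) \<otimes> fst z))"
      by (rule prod[OF cc h'c]) (intro group_continuous_intros)+
    show "(\<lambda>x. cnj (h y) * h' (inv y \<otimes> x)) \<in> A" for y
      by (rule scale_mem[OF left_mem[OF h']])
  qed
  have k_cnj: "cnj (k x) = k' x" if x: "x \<in> N" for x
  proof -
    have 1: "continuous_on UNIV (\<lambda>y. cnj (h y) * h (inv x \<otimes> y))"
      by (rule prod[OF cc hc]) (intro group_continuous_intros)+
    have 2: "continuous_on UNIV (\<lambda>y. cnj (h y) * h' (inv y \<otimes> x))"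
      by (rule prod[OF cc h'c]) (intro group_continuous_intros)+
    have "cnj (k x) = (\<integral>y. cnj (h (x \<otimes> y) * cnj (h y)) \<partial>m)"
      unfolding k_def by (rule Bochner_Integration.integral_cnj[symmetric])
    also have "\<dots> = (\<integral>y. cnj (h y) * h (inv x \<otimes> y) \<partial>m)"
      using haar_left[OF haar 1 x] by (simp add: m_assoc[symmetric])
    also have "\<dots> = k' x"
      unfolding k'_def
    proof (rule haar_cong[OF haar 1 2])
      fix y assume y: "y \<in> N"
      have "inv y \<otimes> x \<in> N" using invN[OF y y] x mN by blast
      from h_inv[OF this] show "cnj (h y) * h (inv x \<otimes> y) = cnj (h y) * h' (inv y \<otimes> x)"
        by (simp add: inv_mult_group)
    qed
    finally show ?thesis .
  qed
  have "(\<lambda>x. k x + k' x) constant_on N"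
  proof -
    have "k x + k' x \<in> \<real>" if "x \<in> N" for x
      using k_cnj[OF that] by (simp add: complex_is_Real_iff flip: k_cnj[OF that])
    then show ?thesis using bspec[OF anti[unfolded antisymmetry_set_def] add_mem[OF k k']] by simp
  qed
  then obtain c where c: "\<And>x. x \<in> N \<Longrightarrow> k x + k' x = c" by (auto simp: constant_on_def)
  have "c = (\<integral>x. k x + k' x \<partial>m)"
    by (rule haar_const[OF haar, symmetric]) (use cont[OF add_mem[OF k k']] c in auto)
  also have "\<dots> = (\<integral>x. k x \<partial>m) + cnj (\<integral>x. k x \<partial>m)"
  proof -
    have "(\<integral>x. k' x \<partial>m) = (\<integral>x. cnj (k x) \<partial>m)"
      by (rule haar_cong[OF haar]) (use cont[OF k] cont[OF k'] k_cnj in \<open>auto intro: continuous_on_cnj\<close>)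
    then show ?thesis
      using haar_integrable[OF haar cont[OF k]] haar_integrable[OF haar cont[OF k']]
      by simp
  qed
  also have "(\<integral>x. k x \<partial>m) = 0"
  proof -
    have "(\<integral>x. k x \<partial>m) = (\<integral>y. (\<integral>x. h (x \<otimes> y) * cnj (h y) \<partial>m) \<partial>m)"
      unfolding k_def by (rule Fubini[OF kF, symmetric])
    also have "\<dots> = 0"
    proof (rule haar_const[OF haar])
      have "continuous_on UNIV (\<lambda>z. h (snd z \<otimes> fst z) * cnj (h (fst z)))"
        by (rule prod[OF hc cc]) (intro group_continuous_intros)+
      from continuous_on_integral[OF compact_UNIV compact_UNIV this haar_prob(2,3)[OF haar]]
      show "continuous_on UNIV (\<lambda>y. \<integral>x. h (x \<otimes> y) * cnj (h y) \<partial>m)" by simp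
      show "(\<integral>x. h (x \<otimes> y) * cnj (h y) \<partial>m) = 0" if "y \<in> N" for y
        using haar_right[OF haar hc that] int_h by simp
    qed
    finally show ?thesis .
  qed
  finally have "c = 0" by simp
  then have "Re (k \<one>) = 0"
    using c[OF one] k_cnj[OF one] by (metis add.commute cnj.simps(1) complex_add_cnj mult_eq_0_iff of_real_eq_0_iff zero_neq_numeral)
  moreover have "k \<one> = of_real (\<integral>y. (norm (h y))\<^sup>2 \<partial>m)"
    unfolding k_def
    by (simp only: l_one carrier_simp complex_norm_square[symmetric] integral_complex_of_real)
  ultimately have int0: "(\<integral>y. (norm (h y))\<^sup>2 \<partial>m) = 0" by simp
  have sq: "continuous_on UNIV (\<lambda>y. (norm (h y))\<^sup>2)" by (intro continuous_intros hc)
  \<comment> \<open>Full support turns the vanishing integral into a value at the identity, and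
    \<open>h \<one>\<close> is the integral of \<open>f * g\<close>.\<close>
  have "(norm (h \<one>))\<^sup>2 = 0"
    by (rule haar_integral_zero_imp_zero[OF haar N sq _ int0]) simp
  then show ?thesis by (simp add: h_def)
qed

text \<open>Subtracting from \<open>f\<close> its mean reduces multiplicativity to the case of mean
  zero.\<close>

lemma haar_multiplicative:
  assumes anti: "antisymmetry_set A N" and N: "subgroup N G" "closed N" and haar: "haar_measure_on N m"
  shows "multiplicative_measure A m"
proof -
  let ?I = "\<lambda>f :: 'a \<Rightarrow> complex. \<integral>x. f x \<partial>m"
  note int = haar_integrable[OF haar cont]
  interpret prob_space m by (rule haar_prob(1)[OF haar])
  have "?I (\<lambda>x. f x * g x) = ?I f * ?I g" if f: "f \<in> A" and g: "g \<in> A" for f g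
  proof -
    have fc: "(\<lambda>x. f x - ?I f) \<in> A" by (intro diff_mem f const_mem)
    have "?I (\<lambda>x. f x - ?I f) = 0" using int[OF f] by (simp add: prob_space)
    from haar_integral_mult_zero[OF anti N haar fc g this]
    have "?I (\<lambda>x. f x * g x - ?I f * g x) = 0" by (simp add: algebra_simps)
    then show ?thesis using int[OF mult_mem[OF f g]] int[OF g] by simp
  qed
  moreover have "?I (\<lambda>_. 1) \<noteq> 0" by (simp add: prob_space)
  then have "\<exists>f\<in>A. ?I f \<noteq> 0" using const_mem by blast
  ultimately show ?thesis
    unfolding multiplicative_measure_def multiplicative_functionals_def
    using int by (auto simp: add_mem mult_mem scale_mem)
qed

section \<open>The convolution of multiplicative functionals\<close>

text \<open>The inner integrand is a translate of \<open>f\<close>, hence in \<open>A\<close>, so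
  any extending measure gives the value of \<open>\<phi>\<close>; the result is again in
  \<open>A\<close> as a function of \<open>h\<close>, so the outer measure may be replaced by
  \<open>\<psi>\<close>. This makes the description in \<open>convolution\<close> unique, and
  representing measures make it nonempty.\<close>

lemma convolution_formula:
  assumes phi: "\<phi> \<in> multiplicative_functionals A" and psi: "\<psi> \<in> multiplicative_functionals A"
    and f: "f \<in> A"
  shows "(\<lambda>h. \<phi> (\<lambda>g. f (g \<otimes> h))) \<in> A" "(\<lambda>g. \<psi> (\<lambda>h. f (g \<otimes> h))) \<in> A"
    and "convolution G A \<phi> \<psi> f = \<psi> (\<lambda>h. \<phi> (\<lambda>g. f (g \<otimes> h)))"
    and "convolution G A \<phi> \<psi> f = \<phi> (\<lambda>g. \<psi> (\<lambda>h. f (g \<otimes> h)))"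
proof -
  obtain M where M: "prob_space M" "finite_regular_borel M" "\<And>f. f \<in> A \<Longrightarrow> integral\<^sup>L M f = \<phi> f"
    using representing_measure_exists[OF phi] by blast
  obtain N where N: "prob_space N" "finite_regular_borel N" "\<And>f. f \<in> A \<Longrightarrow> integral\<^sup>L N f = \<psi> f"
    using representing_measure_exists[OF psi] by blast
  have finM: "finite_measure M" "sets M = sets borel" and finN: "finite_measure N" "sets N = sets borel"
    using M(2) N(2) by (auto simp: finite_regular_borel_def)
  note fc = cont[OF f]
  have F: "continuous_on UNIV (\<lambda>z. f (fst z \<otimes> snd z))"
    by (rule continuous_on_after[OF fc]) (intro group_continuous_intros)
  have F': "continuous_on UNIV (\<lambda>z. f (snd z \<otimes> fst z))"
    by (rule continuous_on_after[OF fc]) (intro group_continuous_intros)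
  let ?P = "\<lambda>h. \<phi> (\<lambda>g. f (g \<otimes> h))" and ?Q = "\<lambda>g. \<psi> (\<lambda>h. f (g \<otimes> h))"
  have P: "(\<integral>g. f (g \<otimes> h) \<partial>M) = ?P h" for h using M(3)[OF right_mem[OF f]] .
  have Q: "(\<integral>h. f (g \<otimes> h) \<partial>N) = ?Q g" for g using N(3)[OF left_mem[OF f]] .
  show PA: "?P \<in> A"
    using integral_mem[OF compact_UNIV F' left_mem[OF f] finM] by (simp add: P)
  show QA: "?Q \<in> A"
    using integral_mem[OF compact_UNIV F right_mem[OF f] finN] by (simp add: Q)
  show eq: "convolution G A \<phi> \<psi> f = \<psi> ?P"
  proof -
    let ?c = "\<lambda>M. \<lparr>re_pos = M, re_neg = null_measure borel, im_pos = null_measure borel,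
        im_neg = null_measure borel\<rparr>"
    have null: "finite_regular_borel (null_measure borel :: 'a measure)"
    proof (rule finite_regular_borelI[OF compact_UNIV])
      fix B :: "'a set"
      have "(INF U\<in>{U. B \<subseteq> U \<and> open U}. emeasure (null_measure borel) U) = 0"
        by (rule INF_eq_const) auto
      then show "emeasure (null_measure borel) B =
          (INF U\<in>{U. B \<subseteq> U \<and> open U}. emeasure (null_measure borel) U)" by simp
    qed (auto intro: finite_measureI)
    have ext: "measure_extends A (?c M) \<phi>" "measure_extends A (?c N) \<psi>"
      using M(2,3) N(2,3) null
      by (auto simp: measure_extends_def regular_complex_measure_def complex_measure_integral_def)
    have unique: "complex_measure_integral \<nu> (\<lambda>h. complex_measure_integral \<mu> (\<lambda>g. f (g \<otimes> h))) = \<psi> ?P"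
      if "measure_extends A \<mu> \<phi>" "measure_extends A \<nu> \<psi>" for \<mu> \<nu>
      using that right_mem[OF f] PA by (simp add: measure_extends_def)
    have "(THE c. \<exists>\<mu> \<nu>. measure_extends A \<mu> \<phi> \<and> measure_extends A \<nu> \<psi> \<and>
        c = complex_measure_integral \<nu> (\<lambda>h. complex_measure_integral \<mu> (\<lambda>g. f (g \<otimes> h)))) = \<psi> ?P"
    proof (rule the_equality)
      show "\<exists>\<mu> \<nu>. measure_extends A \<mu> \<phi> \<and> measure_extends A \<nu> \<psi> \<and>
          \<psi> ?P = complex_measure_integral \<nu> (\<lambda>h. complex_measure_integral \<mu> (\<lambda>g. f (g \<otimes> h)))"
        using unique[OF ext] ext by metis
    qed (use unique in auto)
    then show ?thesis using f by (simp add: convolution_def)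
  qed
  have "\<psi> ?P = (\<integral>h. (\<integral>g. f (g \<otimes> h) \<partial>M) \<partial>N)" using N(3)[OF PA] by (simp add: P)
  also have "\<dots> = (\<integral>g. (\<integral>h. f (g \<otimes> h) \<partial>N) \<partial>M)"
    by (rule Fubini_continuous[OF compact_UNIV compact_UNIV F finM finN])
  also have "\<dots> = \<phi> ?Q" using M(3)[OF QA] by (simp add: Q)
  finally show "convolution G A \<phi> \<psi> f = \<phi> ?Q" using eq by simp
qed

lemma convolution_eqI:
  assumes "\<And>f. f \<in> A \<Longrightarrow> convolution G A \<phi> \<psi> f = \<theta> f" "\<theta> \<in> multiplicative_functionals A"
  shows "convolution G A \<phi> \<psi> = \<theta>"
proof (rule extensionalityI[of _ A])
  show "convolution G A \<phi> \<psi> \<in> extensional A" by (simp add: convolution_def)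
qed (use assms in \<open>auto simp: multiplicative_functionals_def\<close>)

lemma evaluation_mem: "evaluation A g \<in> multiplicative_functionals A"
  using const_mem[of 1] add_mem mult_mem scale_mem
  by (auto simp: evaluation_def multiplicative_functionals_def intro!: bexI[of _ "\<lambda>_. 1"])

lemma convolution_evaluation:
  assumes phi: "\<phi> \<in> multiplicative_functionals A" and f: "f \<in> A"
  shows "convolution G A (evaluation A g) \<phi> f = \<phi> (\<lambda>h. f (g \<otimes> h))"
    and "convolution G A \<phi> (evaluation A g) f = \<phi> (\<lambda>h. f (h \<otimes> g))"
  using convolution_formula(3)[OF evaluation_mem phi f, of g]
    convolution_formula(4)[OF phi evaluation_mem f, of g] right_mem[OF f] left_mem[OF f]
  by (auto simp: evaluation_def)

text \<open>On the self-adjoint algebra of functions invariant under \<open>core\<close>, a multiplicative functional is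
  evaluation at a point \<open>x\<close>; if it is idempotent then \<open>x\<close> and \<open>x\<^sup>2\<close> lie in the same coset.\<close>

lemma idempotent_invariant:
  assumes phi: "\<phi> \<in> multiplicative_functionals A" and idem: "convolution G A \<phi> \<phi> = \<phi>"
    and u: "continuous_on UNIV u" "\<And>x n. n \<in> core \<Longrightarrow> u (x \<otimes> n) = u x"
  shows "\<phi> u = u \<one>"
proof -
  define C where "C = {u :: 'a \<Rightarrow> complex. continuous_on UNIV u \<and> (\<forall>x. \<forall>n\<in>core. u (x \<otimes> n) = u x)}"
  have CA: "u \<in> A" if "u \<in> C" for u using that core_invariant_mem by (auto simp: C_def)
  obtain M where M: "prob_space M" "finite_regular_borel M" "\<And>f. f \<in> A \<Longrightarrow> integral\<^sup>L M f = \<phi> f"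
    using representing_measure_exists[OF phi] by blast
  interpret M: prob_space M by fact
  have finM: "finite_measure M" "sets M = sets borel" using M(2) by (auto simp: finite_regular_borel_def)
  have "\<exists>x. \<forall>u\<in>C. u x = \<phi> u"
  proof (rule ccontr)
    assume "\<not> ?thesis"
    then have ex: "\<forall>x. \<exists>u\<in>C. u x \<noteq> \<phi> u" by blast
    have "UNIV \<subseteq> (\<Union>u\<in>C. {x. u x \<noteq> \<phi> u})" using ex by blast
    moreover have "open {x. u x \<noteq> \<phi> u}" if "u \<in> C" for u
      using that by (intro open_Collect_neq continuous_intros) (simp add: C_def)
    ultimately obtain D where D: "D \<subseteq> C" "finite D" "UNIV \<subseteq> (\<Union>u\<in>D. {x. u x \<noteq> \<phi> u})"
      by - (rule compactE_image[OF compact_UNIV, of C "\<lambda>u. {x. u x \<noteq> \<phi> u}"])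
    \<comment> \<open>If no point works, compactness yields a strictly positive \<open>w\<close>.
      Each summand is an element of the kernel of \<open>\<phi>\<close> times its conjugate, which
      also lies in \<open>A\<close>, so the representing measure integrates \<open>w\<close> to
      0.\<close>
    define w where "w = (\<lambda>x. \<Sum>u\<in>D. (cmod (u x - \<phi> u))\<^sup>2)"
    have wc: "continuous_on UNIV w"
      unfolding w_def using D(1) by (intro continuous_intros) (auto simp: C_def)
    have w_pos: "0 < w x" for x
    proof -
      obtain u where "u \<in> D" "u x \<noteq> \<phi> u" using D(3) by blast
      then show ?thesis unfolding w_def using D(2) by (intro sum_pos2[of D u]) auto
    qed
    have "(\<integral>x. complex_of_real (w x) \<partial>M) = 0"
    proof -
      have square_zero: "(\<lambda>x. (u x - \<phi> u) * cnj (u x - \<phi> u)) \<in> A \<and>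
          \<phi> (\<lambda>x. (u x - \<phi> u) * cnj (u x - \<phi> u)) = 0" if "u \<in> D" for u
      proof -
        have uC: "u \<in> C" using that D(1) by blast
        then have "(\<lambda>x. u x - \<phi> u) \<in> C" "(\<lambda>x. cnj (u x - \<phi> u)) \<in> C"
          by (auto simp: C_def intro!: continuous_intros)
        then have mem: "(\<lambda>x. u x - \<phi> u) \<in> A" "(\<lambda>x. cnj (u x - \<phi> u)) \<in> A" using CA by blast+
        have "\<phi> (\<lambda>x. u x - \<phi> u) = 0"
          using phi_diff[OF phi CA[OF uC] const_mem] phi_const[OF phi] by simp
        then show ?thesis using mult_mem[OF mem] phi_mult[OF phi mem] by simp
      qed
      have "(\<integral>x. complex_of_real (w x) \<partial>M) = (\<integral>x. (\<Sum>u\<in>D. (u x - \<phi> u) * cnj (u x - \<phi> u)) \<partial>M)"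
        unfolding w_def of_real_sum complex_norm_square ..
      also have "\<dots> = (\<Sum>u\<in>D. (\<integral>x. (u x - \<phi> u) * cnj (u x - \<phi> u) \<partial>M))"
        using square_zero cont by (intro Bochner_Integration.integral_sum
            integrable_continuous_compact[OF compact_UNIV finM]) blast
      also have "\<dots> = 0" using square_zero M(3) by (intro sum.neutral) auto
      finally show ?thesis .
    qed
    then have "(\<integral>x. w x \<partial>M) = 0" by simp
    then have "AE x in M. w x = 0"
      using integral_nonneg_eq_0_iff_AE[OF integrable_continuous_compact[OF compact_UNIV finM wc]]
        w_pos less_imp_le by auto
    then have "AE x in M. False" by (rule eventually_mono) (use w_pos in \<open>auto simp: less_le\<close>)
    then show False using M.AE_False by simp
  qed
  then obtain x where x: "\<And>u. u \<in> C \<Longrightarrow> \<phi> u = u x" by force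
  have left: "(\<lambda>h. u (g \<otimes> h)) \<in> C" if "u \<in> C" for u g
  proof -
    have "continuous_on UNIV (\<lambda>h. g \<otimes> h)" by (intro group_continuous_intros)
    from continuous_on_after[OF _ this, of u] show ?thesis
      using that by (simp add: C_def m_assoc[symmetric])
  qed
  \<comment> \<open>Normality of \<open>core\<close> is what keeps right translates
    invariant.\<close>
  have right: "(\<lambda>h. u (h \<otimes> g)) \<in> C" if u: "u \<in> C" for u g
  proof -
    have "u (h \<otimes> n \<otimes> g) = u (h \<otimes> g)" if n: "n \<in> core" for h n
    proof -
      have "inv g \<otimes> n \<otimes> g \<in> core" using conj_core[OF n, of "inv g"] by simp
      then have "u ((h \<otimes> g) \<otimes> (inv g \<otimes> n \<otimes> g)) = u (h \<otimes> g)" using u by (simp add: C_def)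
      moreover have "g \<otimes> (inv g \<otimes> n \<otimes> g) = n \<otimes> g" by (simp add: m_assoc[symmetric])
      ultimately show ?thesis by (simp add: m_assoc)
    qed
    moreover have "continuous_on UNIV (\<lambda>h. h \<otimes> g)" by (intro group_continuous_intros)
    from continuous_on_after[OF _ this, of u] have "continuous_on UNIV (\<lambda>h. u (h \<otimes> g))"
      using u by (simp add: C_def)
    ultimately show ?thesis by (simp add: C_def)
  qed
  have square: "v (x \<otimes> x) = v x" if v: "v \<in> C" for v
  proof -
    have "v x = convolution G A \<phi> \<phi> v" using idem x[OF v] by simp
    also have "\<dots> = \<phi> (\<lambda>h. \<phi> (\<lambda>g. v (g \<otimes> h)))" by (rule convolution_formula(3)[OF phi phi CA[OF v]])
    also have "\<dots> = v (x \<otimes> x)" using x[OF right[OF v]] x[OF left[OF v]] by simp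
    finally show ?thesis by simp
  qed
  have "u \<in> C" using u by (simp add: C_def)
  \<comment> \<open>For the translate by \<open>inv x\<close>, equality of the values at
    \<open>x \<otimes> x\<close> and \<open>x\<close> becomes \<open>u x = u \<one>\<close>.\<close>
  from x[OF this] square[OF left[OF this, of "inv x"]] show ?thesis by (simp add: m_assoc[symmetric])
qed

section \<open>The least idempotent\<close>

context
  fixes m assumes haar: "haar_measure_on core m"
begin

definition haar_functional :: "('a \<Rightarrow> complex) \<Rightarrow> complex" where
  "haar_functional = (\<lambda>f\<in>A. \<integral>x. f x \<partial>m)"

lemma haar_functional_apply: "f \<in> A \<Longrightarrow> haar_functional f = (\<integral>x. f x \<partial>m)"
  by (simp add: haar_functional_def)

lemma haar_functional_mem: "haar_functional \<in> multiplicative_functionals A"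
  using haar_multiplicative[OF antisymmetry_set_core subgroup_core closed_core haar]
  by (simp add: haar_functional_def multiplicative_measure_def)

lemma haar_functional_left:
  "f \<in> A \<Longrightarrow> n \<in> core \<Longrightarrow> haar_functional (\<lambda>x. f (n \<otimes> x)) = haar_functional f"
  by (simp add: haar_functional_apply left_mem haar_left[OF haar cont])

lemma haar_functional_right:
  "f \<in> A \<Longrightarrow> n \<in> core \<Longrightarrow> haar_functional (\<lambda>x. f (x \<otimes> n)) = haar_functional f"
  by (simp add: haar_functional_apply right_mem haar_right[OF haar cont])

lemma haar_functional_const:
  "f \<in> A \<Longrightarrow> (\<And>x. x \<in> core \<Longrightarrow> f x = c) \<Longrightarrow> haar_functional f = c"
  by (simp add: haar_functional_apply haar_const[OF haar cont])

lemma haar_functional_idempotent: "convolution G A haar_functional haar_functional = haar_functional"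
proof (rule convolution_eqI[OF _ haar_functional_mem])
  fix f assume f: "f \<in> A"
  note conv = convolution_formula[OF haar_functional_mem haar_functional_mem f]
  show "convolution G A haar_functional haar_functional f = haar_functional f"
    unfolding conv(4) by (rule haar_functional_const[OF conv(2) haar_functional_left[OF f]])
qed

text \<open>Averaging the translates of \<open>f\<close> over \<open>core\<close> gives an invariant
  function of \<open>x\<close>, and the idempotent \<open>\<phi>\<close> evaluates it at the
  identity, where it is the Haar integral of \<open>f\<close>.\<close>

lemma idempotent_convolution_haar:
  assumes phi: "\<phi> \<in> multiplicative_functionals A" and idem: "convolution G A \<phi> \<phi> = \<phi>"
  shows "convolution G A \<phi> haar_functional = haar_functional"
proof (rule convolution_eqI[OF _ haar_functional_mem])
  fix f assume f: "f \<in> A"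
  note conv = convolution_formula[OF phi haar_functional_mem f]
  have "haar_functional (\<lambda>h. f (x \<otimes> n \<otimes> h)) = haar_functional (\<lambda>h. f (x \<otimes> h))" if "n \<in> core" for x n
    using haar_functional_left[OF left_mem[OF f, of x] that] by (simp add: m_assoc)
  from idempotent_invariant[OF phi idem cont[OF conv(2)] this]
  show "convolution G A \<phi> haar_functional f = haar_functional f"
    unfolding conv(4) by simp
qed

text \<open>The product of \<open>\<epsilon>\<close> with the Haar functional equals the latter by
  absorption and equals \<open>\<epsilon>\<close> by leastness.\<close>

lemma least_idempotent_eq_haar:
  assumes "least_idempotent (spectrum_semigroup G A) \<epsilon>"
  shows "\<epsilon> = haar_functional"
proof -
  have eps: "\<epsilon> \<in> multiplicative_functionals A" "convolution G A \<epsilon> \<epsilon> = \<epsilon>"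
    and least: "\<And>k. k \<in> multiplicative_functionals A \<Longrightarrow> convolution G A k k = k \<Longrightarrow> convolution G A \<epsilon> k = \<epsilon>"
    using assms by (auto simp: least_idempotent_def idempotents_def idempotent_le_def spectrum_semigroup_def)
  show ?thesis
    using idempotent_convolution_haar[OF eps] least[OF haar_functional_mem haar_functional_idempotent]
    by simp
qed

text \<open>The stabilizer \<open>H\<close> is a union of cosets of \<open>core\<close>. An
  \<open>f\<close> in \<open>A\<close> that is real on \<open>H\<close> is constant on each of them,
  hence equal to its mean over the coset, and membership in \<open>H\<close> says that this mean is
  the same for all of them.\<close>

lemma haar_stabilizer_core:
  assumes "\<And>f. f \<in> A \<Longrightarrow> haar_functional (\<lambda>x. f (g \<otimes> x)) = haar_functional f"
  shows "g \<in> core"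
proof -
  define H where "H = {g. \<forall>f\<in>A. haar_functional (\<lambda>x. f (g \<otimes> x)) = haar_functional f}"
  have core_H: "x \<otimes> n \<in> H" if "x \<in> H" "n \<in> core" for x n
    using that haar_functional_left[OF left_mem] by (auto simp: H_def m_assoc)
  have "antisymmetry_set A H"
    unfolding antisymmetry_set_def
  proof (intro ballI impI)
    fix f assume f: "f \<in> A" "\<forall>x\<in>H. f x \<in> \<real>"
    have "f x = haar_functional f" if x: "x \<in> H" for x
    proof -
      have "(\<lambda>n. f (x \<otimes> n)) constant_on core"
        using bspec[OF antisymmetry_set_core[unfolded antisymmetry_set_def] left_mem[OF f(1)]]
          f(2) core_H[OF x] by simp
      then obtain c where c: "\<And>n. n \<in> core \<Longrightarrow> f (x \<otimes> n) = c" unfolding constant_on_def by auto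
      from haar_functional_const[OF left_mem[OF f(1)] c]
      have "haar_functional (\<lambda>n. f (x \<otimes> n)) = c" .
      then show ?thesis using c[OF one_core] x f(1) by (simp add: H_def)
    qed
    then show "f constant_on H" by (auto simp: constant_on_def)
  qed
  then have "H \<subseteq> core" by (rule core_greatest) (simp add: H_def)
  then show ?thesis using assms by (auto simp: H_def)
qed

lemma fixing_set_haar: "fixing_set G A haar_functional = core"
proof (intro equalityI subsetI)
  fix g assume "g \<in> fixing_set G A haar_functional"
  then have "convolution G A (evaluation A g) haar_functional = haar_functional"
    by (simp add: fixing_set_def spectrum_semigroup_def)
  then show "g \<in> core"
    using convolution_evaluation(1)[OF haar_functional_mem, of _ g] by (intro haar_stabilizer_core) simp
next
  fix n assume n: "n \<in> core"
  have "convolution G A (evaluation A n) haar_functional = haar_functional"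
    by (rule convolution_eqI[OF _ haar_functional_mem])
      (simp add: convolution_evaluation[OF haar_functional_mem] haar_functional_left n)
  moreover have "convolution G A haar_functional (evaluation A n) = haar_functional"
    by (rule convolution_eqI[OF _ haar_functional_mem])
      (simp add: convolution_evaluation[OF haar_functional_mem] haar_functional_right n)
  ultimately show "n \<in> fixing_set G A haar_functional"
    by (simp add: fixing_set_def spectrum_semigroup_def)
qed

text \<open>A zero is idempotent, so it equals the Haar functional of \<open>core\<close>; being
  fixed by every point evaluation, it has the whole group as stabilizer. Conversely, invariance
  under all translations makes the inner function of either convolution constant.\<close>

lemma semigroup_zero_iff:
  "(\<exists>z. semigroup_zero (spectrum_semigroup G A) z) \<longleftrightarrow> core = UNIV"
proof
  assume "\<exists>z. semigroup_zero (spectrum_semigroup G A) z"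
  then obtain z where z: "z \<in> multiplicative_functionals A"
    "\<And>s. s \<in> multiplicative_functionals A \<Longrightarrow> convolution G A z s = z"
    "\<And>s. s \<in> multiplicative_functionals A \<Longrightarrow> convolution G A s z = z"
    by (auto simp: semigroup_zero_def spectrum_semigroup_def)
  have "z = haar_functional"
    using idempotent_convolution_haar[OF z(1) z(2)[OF z(1)]] z(2)[OF haar_functional_mem] by simp
  then have "fixing_set G A haar_functional = UNIV"
    using z evaluation_mem by (auto simp: fixing_set_def spectrum_semigroup_def)
  then show "core = UNIV" by (simp add: fixing_set_haar)
next
  assume core: "core = UNIV"
  have "convolution G A haar_functional s = haar_functional"
    "convolution G A s haar_functional = haar_functional"
    if s: "s \<in> multiplicative_functionals A" for s
  proof -
    show "convolution G A haar_functional s = haar_functional"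
      by (rule convolution_eqI[OF _ haar_functional_mem])
        (simp add: convolution_formula(3)[OF haar_functional_mem s] haar_functional_right core phi_const[OF s])
    show "convolution G A s haar_functional = haar_functional"
      by (rule convolution_eqI[OF _ haar_functional_mem])
        (simp add: convolution_formula(4)[OF s haar_functional_mem] haar_functional_left core phi_const[OF s])
  qed
  then show "\<exists>z. semigroup_zero (spectrum_semigroup G A) z"
    using haar_functional_mem by (auto simp: semigroup_zero_def spectrum_semigroup_def)
qed

text \<open>A multiplicative left invariant functional absorbs every functional from the left, so it
  is idempotent; leastness then identifies it with the Haar functional of \<open>core\<close>, which
  is thus fixed by all translations.\<close>

lemma multiplicative_normalized_haar_iff:
  assumes m': "normalized_haar G m'"
    and least: "least_idempotent (spectrum_semigroup G A) haar_functional"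
  shows "multiplicative_measure A m' \<longleftrightarrow> core = UNIV"
proof -
  have prob: "prob_space m'" and fin: "finite_measure m'" "sets m' = sets borel"
    and distr: "\<And>g. distr m' borel (\<lambda>x. g \<otimes> x) = m'"
    using m' by (auto simp: normalized_haar_def finite_regular_borel_def)
  have left: "(\<integral>x. f (g \<otimes> x) \<partial>m') = (\<integral>x. f x \<partial>m')" if f: "continuous_on UNIV f" for f :: "'a \<Rightarrow> complex" and g
  proof -
    have "(\<lambda>x. g \<otimes> x) \<in> borel_measurable borel"
      by (intro borel_measurable_continuous_onI group_continuous_intros)
    then have "(\<lambda>x. g \<otimes> x) \<in> measurable m' borel" using measurable_cong_sets[OF fin(2) refl] by blast
    from integral_distr[OF this borel_measurable_continuous_onI[OF f]] show ?thesis by (simp add: distr)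
  qed
  show ?thesis
  proof
    assume core: "core = UNIV"
    have "(\<integral>x. f x \<partial>m') = (\<integral>x. f x \<partial>m)" if f: "continuous_on UNIV f" for f :: "'a \<Rightarrow> complex"
    proof -
      have F: "continuous_on UNIV (\<lambda>z. f (fst z \<otimes> snd z))"
        by (rule continuous_on_after[OF f]) (intro group_continuous_intros)
      interpret m': prob_space m' by (rule prob)
      interpret m: prob_space m by (rule haar_prob(1)[OF haar])
      \<comment> \<open>Uniqueness of the Haar integral: right invariance of \<open>m\<close>
        evaluates one order of integration, left invariance of \<open>m'\<close> the other.\<close>
      have "(\<integral>y. (\<integral>x. f (x \<otimes> y) \<partial>m) \<partial>m') = (\<integral>x. (\<integral>y. f (x \<otimes> y) \<partial>m') \<partial>m)"
        by (rule Fubini_continuous[OF compact_UNIV compact_UNIV F haar_prob(2,3)[OF haar] fin])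
      then show ?thesis
        using haar_right[OF haar f] by (simp add: core left[OF f] m.prob_space m'.prob_space)
    qed
    then have "(\<lambda>f\<in>A. integral\<^sup>L m' f) = haar_functional"
      using cont by (auto simp: haar_functional_def)
    then show "multiplicative_measure A m'"
      using haar_functional_mem by (simp add: multiplicative_measure_def)
  next
    define \<mu> where "\<mu> = (\<lambda>f\<in>A. integral\<^sup>L m' f)"
    assume "multiplicative_measure A m'"
    then have mu: "\<mu> \<in> multiplicative_functionals A" by (simp add: multiplicative_measure_def \<mu>_def)
    have mu_left: "\<mu> (\<lambda>x. f (g \<otimes> x)) = \<mu> f" if "f \<in> A" for f g
      using left[OF cont[OF that]] that left_mem[OF that] by (simp add: \<mu>_def)
    have absorb: "convolution G A \<phi> \<mu> = \<mu>" if phi: "\<phi> \<in> multiplicative_functionals A" for \<phi>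
      by (rule convolution_eqI[OF _ mu])
        (simp add: convolution_formula(4)[OF phi mu] mu_left phi_const[OF phi])
    have "convolution G A haar_functional \<mu> = haar_functional"
      using least mu absorb[OF mu]
      by (auto simp: least_idempotent_def idempotents_def idempotent_le_def spectrum_semigroup_def)
    then have "\<mu> = haar_functional" using absorb[OF haar_functional_mem] by simp
    then have "g \<in> core" for g using mu_left by (intro haar_stabilizer_core) simp
    then show "core = UNIV" by auto
  qed
qed

end

end

section \<open>The theorem\<close>

theorem theorem8:
  fixes G :: "('a::t2_space, 'b) monoid_scheme"
    and A :: "('a \<Rightarrow> complex) set"
    and \<epsilon> :: "('a \<Rightarrow> complex) \<Rightarrow> complex"
  assumes "compact_group G"
    and "invariant_algebra G A"
    and "least_idempotent (spectrum_semigroup G A) \<epsilon>"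
  shows "maximal_antisymmetry_set A (fixing_set G A \<epsilon>) \<and>
    fixing_set G A \<epsilon> \<lhd> G \<and>
    {E. maximal_antisymmetry_set A E} =
      {g <#\<^bsub>G\<^esub> fixing_set G A \<epsilon> | g. g \<in> carrier G} \<and>
    real_valued_part A =
      {f. continuous_on UNIV f \<and> (\<forall>x. f x \<in> \<real>) \<and>
          (\<forall>g\<in>carrier G. f constant_on (g <#\<^bsub>G\<^esub> fixing_set G A \<epsilon>))} \<and>
    (antisymmetric_algebra A \<longleftrightarrow> (\<exists>z. semigroup_zero (spectrum_semigroup G A) z)) \<and>
    (\<forall>m. normalized_haar G m \<longrightarrow>
      (antisymmetric_algebra A \<longleftrightarrow> multiplicative_measure A m))"
proof -
  interpret invariant_algebra_on G A
    using assms(1,2) by (simp add: invariant_algebra_on_def invariant_algebra_on_axioms_def)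
  obtain m where haar: "haar_measure_on core m"
    using haar_measure_on_exists[OF subgroup_core closed_core] by blast
  have eps: "\<epsilon> = haar_functional m" by (rule least_idempotent_eq_haar[OF haar assms(3)])
  have fixing: "fixing_set G A \<epsilon> = core" unfolding eps by (rule fixing_set_haar[OF haar])
  have max: "maximal_antisymmetry_set A E \<longleftrightarrow> (\<exists>g. E = g <#\<^bsub>G\<^esub> core)" for E
    by (rule maximal_antisymmetry_set_iff)
  have "core = \<one>\<^bsub>G\<^esub> <#\<^bsub>G\<^esub> core" by (simp add: l_coset_image)
  then have "maximal_antisymmetry_set A core" using max by blast
  moreover have "{E. maximal_antisymmetry_set A E} = {g <#\<^bsub>G\<^esub> core | g. g \<in> carrier G}"
    using max by auto
  moreover note normal_core real_valued_part_eq
  moreover have "antisymmetric_algebra A \<longleftrightarrow> (\<exists>z. semigroup_zero (spectrum_semigroup G A) z)"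
    by (simp add: antisymmetric_algebra_iff_core semigroup_zero_iff[OF haar])
  moreover have "antisymmetric_algebra A \<longleftrightarrow> multiplicative_measure A m'" if "normalized_haar G m'" for m'
    using multiplicative_normalized_haar_iff[OF haar that] assms(3) eps
    by (simp add: antisymmetric_algebra_iff_core)
  ultimately show ?thesis unfolding fixing by blast
qed

end
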